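(* Let $\mathcal X$ be a finite set with $n$ elements, let $w(x,y)=w(y,x)\ge 0$ ($x,y\in\mathcal X$, $w(x,x)=0$) be the weights of a non-oriented weighted graph on $\mathcal X$, let $L$ be its graph Laplacian, and let $W$ be the diagonal matrix with entries $w(x)=\sum_{y\ne x}w(x,y)$, $x\in\mathcal X$. Put $\alpha=\max_{x}w(x)$ and $\beta=\frac1n\sum_{x}\max_{y}w(y,x)$. For all $q_0>0$, the number $S$ of sampled arrows and the number $R$ of extra reads needed by the coupled forest algorithm (in Wilson's order) to build one random forest trajectory $t\in[0,1/q_0]\mapsto\Phi_{1/t}$ satisfy $$\mathbb E[S]=\mathrm{Tr}\bigl((q_0\mathrm{Id}-L)^{-1}(q_0\mathrm{Id}+W)\bigr)\le n\left(1+\frac{\beta}{q_0}\right)$$ and $$\mathbb E[R]\le n\ln\left(1+\frac{\alpha}{q_0}\right).$$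
   Context: Graph. $x\ne y$ are connected by an edge iff $w(x,y)>0$; each edge gives two oriented arrows $(x,y)$ (leaving $x$, pointing to $y$) and $(y,x)$. The graph Laplacian is $L_{x,y}=w(x,y)$ for $x\ne y$, $L_{x,x}=-w(x)$. A rooted spanning forest is a set of arrows with at most one arrow leaving each node and containing no oriented loop; its roots are the nodes that no arrow leaves. Stacks. Attach to each node $x$ an infinite stack of independent entries (all stacks independent); each entry is a pair consisting of a mark $U$ uniform on $[0,1]$ and, independently, an arrow $(x,y)$ chosen with probability $w(x,y)/w(x)$ (irrelevant if $w(x)=0$). At parameter $q>0$, an entry at $x$ is interpreted as a stop if $U<q/(q+w(x))$, and as its arrow otherwise. Forest at a fixed $q$ (Wilson's algorithm). Initially no node is frozen. Repeatedly pick any non-frozen node and run from it a walk: at the current node read the next unread entry of its stack; if it is a stop, the walk ends there and that node becomes a root; if it is an arrow, move along it, and whenever the walk closes a cycle, erase the arrows of that cycle. The walk ends at a stop or on reaching a frozen node; then the arrows of the resulting loop-erased path are kept and its nodes become frozen. When all nodes are frozen, the kept arrows form $\Phi_q$. Neither $\Phi_q$ nor the set of stack entries that are read depends on the choice of starting nodes. Using the same stacks for all $q$ defines the coupled family $(\Phi_q)_{q>0}$; the trajectory is $t\mapsto\Phi_{1/t}$, with $\Phi_\infty=\emptyset$ (every node is a root) at $t=0$, and it is piecewise constant. Coupled forest algorithm (Wilson's order). It builds the trajectory by increasing $t=1/q$ from $0$ to $1/q_0$. At any time each root $x$ has a current stack entry, interpreted as a stop, with mark $U$; the root $x$ is unfrozen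 at the time $t$ at which $1/(1+tw(x))=U$, from which time on this entry is interpreted as its arrow. When $x$ is unfrozen at time $t=1/q$, all nodes of the tree of $\Phi_{1/t_-}$ covering $x$ become active, all other nodes are frozen (the active/frozen status of nodes is considered as known), and $\Phi_{1/t}$ is built as follows. Initially no node is tagged. A walk starts at $x$ with the arrow of the current entry of $x$ (and $x$ is tagged). Afterwards, when the walk is at an active node $u$: if $u$ is not tagged and an arrow of $\Phi_{1/t_-}$ leaves $u$, this previously sampled arrow is read again and followed, and $u$ is tagged (this is one extra read); otherwise the next unread entry of the stack of $u$ is read and interpreted at parameter $q$, and $u$ is tagged: either it is a stop, and $u$ becomes a frozen root, or its arrow is followed. Whenever a cycle is closed, its arrows are erased, so that its nodes have no leaving arrow, and the walk continues from the node at which the cycle was closed. The walk ends when a stop is read or a frozen node is reached; then every node whose path of current arrows leads to a frozen root becomes frozen. If active nodes remain, a new walk is started from an active root (a node without leaving arrow), with the same rules and the same tags, until all nodes are frozen; the resulting forest is $\Phi_{1/t}$. Counts. $S$ is the total number of distinct stack entries read in building the trajectory on $[0,1/q_0]$ (an entry read first as a stop and later used as an arrow is counted once, and the entries at the roots of the final forest, interpreted as stops, are counted); equivalently, it is the number of stack entries read to build $\Phi_{q_0}$ by Wilson's algorithm. $R$ is the total number of extra reads, summed over all unfreezing times $t\in[0,1/q_0]$, where an extra read at an unfreezing time $t$ is an event, during the construction of $\Phi_{1/t}$ from $\Phi_{1/t_-}$ by the coupled forest algorithm, in which the walk is at an active, not yet tagged node $u$ that an arrow of $\Phi_{1/t_-}$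 leaves, and this already sampled arrow is read again and followed. *)

theory Defs
  imports "HOL-Probability.Probability"
begin

definition node_weight :: "('a::finite \<Rightarrow> 'a \<Rightarrow> real) \<Rightarrow> 'a \<Rightarrow> real" where
  "node_weight w x = (\<Sum>y\<in>UNIV - {x}. w x y)"

definition graph_laplacian :: "('a::finite \<Rightarrow> 'a \<Rightarrow> real) \<Rightarrow> real^'a^'a" where
  "graph_laplacian w = (\<chi> x y. if x = y then - node_weight w x else w x y)"

definition weight_matrix :: "('a::finite \<Rightarrow> 'a \<Rightarrow> real) \<Rightarrow> real^'a^'a" where
  "weight_matrix w = (\<chi> x y. if x = y then node_weight w x else 0)"

definition max_node_weight :: "('a::finite \<Rightarrow> 'a \<Rightarrow> real) \<Rightarrow> real" where
  "max_node_weight w = Max (range (node_weight w))"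

definition mean_max_weight :: "('a::finite \<Rightarrow> 'a \<Rightarrow> real) \<Rightarrow> real" where
  "mean_max_weight w = (\<Sum>x\<in>UNIV. Max (range (\<lambda>y. w y x))) / CARD('a)"

text \<open>Entry number \<open>i\<close> (from 0) of the stack at \<open>x\<close> is \<open>\<omega> (x, i) = (U, y)\<close>: the mark \<open>U\<close>
  and the arrow from \<open>x\<close> to \<open>y\<close>. At a node of weight 0 the arrow is irrelevant: the entry is
  almost surely a stop at every parameter.\<close>

type_synonym 'a stacks = "'a \<times> nat \<Rightarrow> real \<times> 'a"

definition arrow_pmf :: "('a::finite \<Rightarrow> 'a \<Rightarrow> real) \<Rightarrow> 'a \<Rightarrow> 'a pmf" where
  "arrow_pmf w x = (if node_weight w x = 0 then return_pmf x
                    else embed_pmf (\<lambda>y. w x y / node_weight w x))"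

definition stack_space :: "('a::finite \<Rightarrow> 'a \<Rightarrow> real) \<Rightarrow> 'a stacks measure" where
  "stack_space w =
     (\<Pi>\<^sub>M (x, i)\<in>UNIV. uniform_measure lborel {0..1} \<Otimes>\<^sub>M measure_pmf (arrow_pmf w x))"

text \<open>A set of arrows with at most one arrow leaving each node is a partial map; its roots are
  the nodes outside its domain.

  The algorithm is a transition system. In a state,
  \<open>time\<close> is the last unfreezing time \<open>t\<close>,
  \<open>prev\<close> is the forest just before \<open>t\<close>,
  \<open>arrows\<close> holds the current arrows (a node that is not yet tagged keeps its arrow of \<open>prev\<close>),
  \<open>nread x\<close> is the number of entries read so far at \<open>x\<close>, so that the current entry has number
  \<open>nread x - 1\<close> and the next unread one has number \<open>nread x\<close>,
  \<open>walk\<close> is the loop-erased path of the running walk, current position first (empty if no walk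
  is running), and \<open>extra\<close> counts the extra reads made so far.
  The forest built at \<open>time\<close> is \<open>arrows\<close> in the states where all nodes are frozen and no walk is
  running.\<close>

record 'a state =
  time :: real
  prev :: "'a \<rightharpoonup> 'a"
  arrows :: "'a \<rightharpoonup> 'a"
  nread :: "'a \<Rightarrow> nat"
  frozen :: "'a set"
  tagged :: "'a set"
  walk :: "'a list"
  extra :: nat

text \<open>At \<open>t = 0\<close> every node is a root, its first entry having been read as a stop.\<close>

definition init :: "'a state" where
  "init = \<lparr>time = 0, prev = Map.empty, arrows = Map.empty, nread = (\<lambda>x. 1),
           frozen = UNIV, tagged = {}, walk = [], extra = 0\<rparr>"

text \<open>With \<open>q = 1/t\<close>, the threshold \<open>q / (q + w x)\<close> below which an entry is a stop is
  \<open>1 / (1 + t * w x)\<close>.\<close>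

definition threshold :: "('a::finite \<Rightarrow> 'a \<Rightarrow> real) \<Rightarrow> real \<Rightarrow> 'a \<Rightarrow> real" where
  "threshold w t x = 1 / (1 + t * node_weight w x)"

definition move :: "'a \<Rightarrow> 'a state \<Rightarrow> 'a state" where
  "move v s =
     (if v \<in> set (walk s)
      then let cycle = insert v (set (takeWhile (\<lambda>u. u \<noteq> v) (walk s)))
           in s\<lparr>arrows := arrows s |` (- cycle), walk := dropWhile (\<lambda>u. u \<noteq> v) (walk s)\<rparr>
      else s\<lparr>walk := v # walk s\<rparr>)"

definition follow :: "'a \<Rightarrow> 'a \<Rightarrow> 'a state \<Rightarrow> 'a state" where
  "follow u v s = move v (s\<lparr>arrows := (arrows s)(u \<mapsto> v), tagged := insert u (tagged s)\<rparr>)"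

definition end_walk :: "'a state \<Rightarrow> 'a state" where
  "end_walk s =
     s\<lparr>frozen := frozen s \<union> {v. \<exists>r. r \<in> frozen s \<and> r \<notin> dom (arrows s)
                                  \<and> (v, r) \<in> (Map.graph (arrows s))\<^sup>*},
       walk := []\<rparr>"

definition walk_step :: "('a::finite \<Rightarrow> 'a \<Rightarrow> real) \<Rightarrow> 'a stacks \<Rightarrow> 'a \<Rightarrow> 'a state \<Rightarrow> 'a state" where
  "walk_step w \<omega> u s =
     (if u \<in> frozen s then end_walk s
      else if u \<notin> tagged s \<and> u \<in> dom (prev s)
      then follow u (the (prev s u)) (s\<lparr>extra := Suc (extra s)\<rparr>)
      else let (U, v) = \<omega> (u, nread s u);
               s' = s\<lparr>nread := (nread s)(u := Suc (nread s u)), tagged := insert u (tagged s)\<rparr>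
           in if U < threshold w (time s) u
              then end_walk (s'\<lparr>frozen := insert u (frozen s')\<rparr>)
              else follow u v s')"

definition unfreezes_at ::
    "('a::finite \<Rightarrow> 'a \<Rightarrow> real) \<Rightarrow> 'a stacks \<Rightarrow> 'a state \<Rightarrow> 'a \<Rightarrow> real \<Rightarrow> bool" where
  "unfreezes_at w \<omega> s x t \<longleftrightarrow>
     0 \<le> t \<and> x \<notin> dom (arrows s) \<and> threshold w t x = fst (\<omega> (x, nread s x - 1))"

definition unfreeze :: "'a stacks \<Rightarrow> 'a \<Rightarrow> real \<Rightarrow> 'a state \<Rightarrow> 'a state" where
  "unfreeze \<omega> x t s =
     follow x (snd (\<omega> (x, nread s x - 1)))
       (s\<lparr>time := t, prev := arrows s,
          frozen := - {v. (v, x) \<in> (Map.graph (arrows s))\<^sup>*},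
          tagged := {}, walk := [x]\<rparr>)"

text \<open>The function \<open>c\<close> chooses the active root at which a new walk starts (and, on the null event
  that several roots are unfrozen at the same time, which of them comes first). When no root is
  unfrozen up to time \<open>1 / q0\<close> any more, the state no longer changes.\<close>

definition step ::
    "('a::finite \<Rightarrow> 'a \<Rightarrow> real) \<Rightarrow> real \<Rightarrow> ('a set \<Rightarrow> 'a) \<Rightarrow> 'a stacks \<Rightarrow> 'a state \<Rightarrow> 'a state" where
  "step w q0 c \<omega> s =
     (case walk s of
        u # _ \<Rightarrow> walk_step w \<omega> u s
      | [] \<Rightarrow>
          if frozen s \<noteq> UNIV
          then s\<lparr>walk := [c (- frozen s - dom (arrows s))]\<rparr>
          else if \<exists>t\<le>1 / q0. \<exists>x. unfreezes_at w \<omega> s x t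
          then let t = (LEAST t. \<exists>x. unfreezes_at w \<omega> s x t)
               in unfreeze \<omega> (c {x. unfreezes_at w \<omega> s x t}) t s
          else s)"

text \<open>\<open>pick \<omega> k\<close> makes the choice at step \<open>k\<close>. As \<open>\<omega>\<close> and \<open>k\<close> determine the state before that
  step, the choice may depend on everything the algorithm has seen.\<close>

primrec run ::
    "('a::finite \<Rightarrow> 'a \<Rightarrow> real) \<Rightarrow> real \<Rightarrow> ('a stacks \<Rightarrow> nat \<Rightarrow> 'a set \<Rightarrow> 'a) \<Rightarrow> 'a stacks \<Rightarrow> nat
      \<Rightarrow> 'a state" where
  "run w q0 pick \<omega> 0 = init"
| "run w q0 pick \<omega> (Suc k) = step w q0 (pick \<omega> k) \<omega> (run w q0 pick \<omega> k)"

definition choice_rule ::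
    "('a::finite \<Rightarrow> 'a \<Rightarrow> real) \<Rightarrow> ('a stacks \<Rightarrow> nat \<Rightarrow> 'a set \<Rightarrow> 'a) \<Rightarrow> bool" where
  "choice_rule w pick \<longleftrightarrow>
     (\<forall>\<omega> k A. A \<noteq> {} \<longrightarrow> pick \<omega> k A \<in> A) \<and>
     (\<forall>k A. (\<lambda>\<omega>. pick \<omega> k A) \<in> measurable (stack_space w) (count_space UNIV))"

text \<open>Both counters are nondecreasing along a run, so these suprema are their final values; they
  may be infinite if the run does not end.\<close>

definition sampled_arrows ::
    "('a::finite \<Rightarrow> 'a \<Rightarrow> real) \<Rightarrow> real \<Rightarrow> ('a stacks \<Rightarrow> nat \<Rightarrow> 'a set \<Rightarrow> 'a) \<Rightarrow> 'a stacks \<Rightarrow> ennreal"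
  where
  "sampled_arrows w q0 pick \<omega> = (SUP k. of_nat (\<Sum>x\<in>UNIV. nread (run w q0 pick \<omega> k) x))"

definition extra_reads ::
    "('a::finite \<Rightarrow> 'a \<Rightarrow> real) \<Rightarrow> real \<Rightarrow> ('a stacks \<Rightarrow> nat \<Rightarrow> 'a set \<Rightarrow> 'a) \<Rightarrow> 'a stacks \<Rightarrow> ennreal"
  where
  "extra_reads w q0 pick \<omega> = (SUP k. of_nat (extra (run w q0 pick \<omega> k)))"

end

theory Submission
  imports Defs
begin

text \<open>
  Read the stacks at the parameter \<open>q = 1 / t\<close>. The entries erased in cycles form a circulation: at
  every node as many erased arrows enter as leave. Circulations are closed under maxima, which
  gives the abelian property: the forest and the set of entries read do not depend on the order of
  the walks.

  Sampled arrows: the number of entries read at \<open>x\<close> is the number of visits to \<open>x\<close> of a single walk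
  from \<open>x\<close> that runs until its first stop. Whether that walk uses entry \<open>i\<close> at \<open>z\<close> is independent of
  that entry, so its mean visit numbers solve a linear recursion, whose limit is the Green function.

  Extra reads: every node is tagged at most once per unfreezing, so unfreezing \<open>x\<close> costs at most the
  size of the tree of \<open>x\<close>. A root \<open>x\<close> is unfrozen at time \<open>t\<close> at rate
  \<open>w(x) / (1 + t w(x)) \<le> \<alpha> / (1 + t \<alpha>)\<close>, independently of its tree, and the sizes of the trees
  add up to \<open>n\<close>. Integrate over \<open>t\<close> from \<open>0\<close> to \<open>1 / q0\<close>.
\<close>

section \<open>Circulations\<close>

text \<open>The obstacle is that the parameter moves during the run, arrows are reread, and
  termination is not known in advance. One monotonicity settles all of this: as \<open>t\<close>
  grows, stops turn into arrows and never back, so a circulation at time \<open>t\<close> is still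
  one at time \<open>1 / q0\<close>. The erased entries of every intermediate state can therefore be
  compared with the single odometer at \<open>1 / q0\<close>. Its expectation is finite, so it is
  almost surely bounded, and an integer that grows in every unfinished step then forces the run to
  end. For the extra reads the difficulty is that the unfreezing time of \<open>x\<close> is a
  function of the very entry that roots its tree. \<open>reaches\<close> ignores that entry, so the
  time can be integrated out with the trees held fixed. With \<open>c = w(x)\<close> its density is
  \<open>c / (1 + t c)^2\<close>, which is the rate \<open>c / (1 + t c)\<close> times the
  probability \<open>1 / (1 + t c)\<close> that the entry is a stop at time \<open>t\<close>. That
  probability is turned back into the event, because disjointness of the trees is available only
  over actual stops.\<close>

definition inflow :: "('a::finite \<times> nat \<Rightarrow> 'a option) \<Rightarrow> ('a \<Rightarrow> nat) \<Rightarrow> 'a \<Rightarrow> nat" where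
  "inflow \<zeta> h y = (\<Sum>z\<in>UNIV. card {i. i < h z \<and> \<zeta> (z, i) = Some y})"

text \<open>\<open>h x\<close> counts the entries at \<open>x\<close> erased so far; \<open>None\<close> is a stop.\<close>

definition circulation :: "('a::finite \<times> nat \<Rightarrow> 'a option) \<Rightarrow> ('a \<Rightarrow> nat) \<Rightarrow> bool" where
  "circulation \<zeta> h \<longleftrightarrow> (\<forall>x. \<forall>i<h x. \<zeta> (x, i) \<noteq> None) \<and> (\<forall>y. inflow \<zeta> h y = h y)"

text \<open>Visits of the walk from \<open>x\<close> that takes at each visit of a node its next entry, as the limit of
  parallel updates: in round \<open>k + 1\<close> all entries known to be used after round \<open>k\<close> are followed.\<close>

primrec odometer :: "('a::finite \<times> nat \<Rightarrow> 'a option) \<Rightarrow> 'a \<Rightarrow> nat \<Rightarrow> 'a \<Rightarrow> nat" where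
  "odometer \<zeta> x 0 = (\<lambda>y. 0)"
| "odometer \<zeta> x (Suc k) = (\<lambda>y. (if y = x then 1 else 0) + inflow \<zeta> (odometer \<zeta> x k) y)"

text \<open>Wilson's picture of cycle popping: the arrows visible on top of the stacks once
  \<open>h z\<close> entries have been removed at each \<open>z\<close>.\<close>

definition top_graph :: "('a \<times> nat \<Rightarrow> 'a option) \<Rightarrow> ('a \<Rightarrow> nat) \<Rightarrow> ('a \<times> 'a) set" where
  "top_graph \<zeta> h = {(a, b). \<zeta> (a, h a) = Some b}"

lemma inflow_mono: "(\<And>z. h z \<le> h' z) \<Longrightarrow> inflow \<zeta> h y \<le> inflow \<zeta> h' y"
  unfolding inflow_def
  by (intro sum_mono card_mono) (auto intro: less_le_trans)

text \<open>Double counting: every counted entry is a stop or points to exactly one node.\<close>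

lemma sum_inflow:
  fixes \<zeta> :: "'a::finite \<times> nat \<Rightarrow> 'a option"
  shows "(\<Sum>y\<in>UNIV. inflow \<zeta> h y) + (\<Sum>z\<in>UNIV. card {i. i < h z \<and> \<zeta> (z, i) = None}) = (\<Sum>z\<in>UNIV. h z)"
proof -
  have "h z = (\<Sum>y\<in>UNIV. card {i. i < h z \<and> \<zeta> (z, i) = Some y}) + card {i. i < h z \<and> \<zeta> (z, i) = None}" for z
  proof -
    have "{..<h z} = (\<Union>y. {i. i < h z \<and> \<zeta> (z, i) = Some y}) \<union> {i. i < h z \<and> \<zeta> (z, i) = None}"
      by auto
    then have "h z = card ((\<Union>y. {i. i < h z \<and> \<zeta> (z, i) = Some y}) \<union> {i. i < h z \<and> \<zeta> (z, i) = None})"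
      by (metis card_lessThan)
    also have "\<dots> = card (\<Union>y. {i. i < h z \<and> \<zeta> (z, i) = Some y}) + card {i. i < h z \<and> \<zeta> (z, i) = None}"
      by (intro card_Un_disjoint) auto
    also have "card (\<Union>y. {i. i < h z \<and> \<zeta> (z, i) = Some y}) = (\<Sum>y\<in>UNIV. card {i. i < h z \<and> \<zeta> (z, i) = Some y})"
      by (intro card_UN_disjoint) auto
    finally show ?thesis .
  qed
  then have "(\<Sum>z\<in>UNIV. h z) = (\<Sum>z\<in>UNIV. (\<Sum>y\<in>UNIV. card {i. i < h z \<and> \<zeta> (z, i) = Some y})
      + card {i. i < h z \<and> \<zeta> (z, i) = None})"
    by (intro sum.cong) auto
  then show ?thesis
    unfolding inflow_def sum.distrib by (subst sum.swap) simp
qed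

text \<open>The total inflow is the number of arrows among the counted entries, hence at most the
  sum of \<open>h\<close>. Inflow at least \<open>h\<close> everywhere leaves room neither for a
  stop nor for a strict excess. One inequality thus suffices to recognise a circulation.\<close>

lemma circulation_if_le_inflow:
  fixes \<zeta> :: "'a::finite \<times> nat \<Rightarrow> 'a option"
  assumes "\<And>y. h y \<le> inflow \<zeta> h y"
  shows "circulation \<zeta> h"
proof -
  have 1: "(\<Sum>z\<in>UNIV. h z) \<le> (\<Sum>y\<in>UNIV. inflow \<zeta> h y)"
    by (intro sum_mono assms)
  with sum_inflow[of \<zeta> h] have 2: "(\<Sum>z\<in>UNIV. card {i. i < h z \<and> \<zeta> (z, i) = None}) = 0"
    and 3: "(\<Sum>y\<in>UNIV. inflow \<zeta> h y) = (\<Sum>z\<in>UNIV. h z)" by linarith+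
  have "\<zeta> (x, i) \<noteq> None" if "i < h x" for x i
    using 2 that by (auto simp: sum_eq_0_iff)
  moreover have "inflow \<zeta> h y = h y" for y
  proof (rule ccontr)
    assume "inflow \<zeta> h y \<noteq> h y"
    then have "h y < inflow \<zeta> h y" using assms[of y] by simp
    then have "(\<Sum>z\<in>UNIV. h z) < (\<Sum>y\<in>UNIV. inflow \<zeta> h y)"
      by (intro sum_strict_mono_ex1) (use assms in auto)
    with 3 show False by simp
  qed
  ultimately show ?thesis unfolding circulation_def by blast
qed

text \<open>Monotonicity of \<open>inflow\<close> gives the one-sided bound for the maximum, and
  that bound is enough.\<close>

lemma circulation_max:
  assumes "circulation \<zeta> c" "circulation \<zeta> c'"
  shows "circulation \<zeta> (\<lambda>x. max (c x) (c' x))"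
proof (rule circulation_if_le_inflow)
  fix y
  have "c y \<le> inflow \<zeta> (\<lambda>x. max (c x) (c' x)) y" "c' y \<le> inflow \<zeta> (\<lambda>x. max (c x) (c' x)) y"
    using assms inflow_mono[of c "\<lambda>x. max (c x) (c' x)"] inflow_mono[of c' "\<lambda>x. max (c x) (c' x)"]
    unfolding circulation_def by (metis max.cobounded1, metis max.cobounded2)
  then show "max (c y) (c' y) \<le> inflow \<zeta> (\<lambda>x. max (c x) (c' x)) y" by simp
qed

text \<open>If \<open>c x\<close> were as large as the final odometer, the maximum of both would be a circulation. But the
  odometer uses a stop, which a circulation cannot contain.\<close>

lemma circulation_less_odometer:
  fixes \<zeta> :: "'a::finite \<times> nat \<Rightarrow> 'a option"
  assumes c: "circulation \<zeta> c" and h: "odometer \<zeta> x (Suc k) = odometer \<zeta> x k"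
  shows "c x < odometer \<zeta> x k x"
proof (rule ccontr)
  define h where "h = odometer \<zeta> x k"
  have fix_h: "h y = (if y = x then 1 else 0) + inflow \<zeta> h y" for y
    unfolding h_def using fun_cong[OF h, of y] by simp
  assume "\<not> c x < odometer \<zeta> x k x"
  then have cx: "h x \<le> c x" by (simp add: h_def)
  define m where "m = (\<lambda>y. max (c y) (h y))"
  have "circulation \<zeta> m"
  proof (rule circulation_if_le_inflow)
    fix y
    have "c y \<le> inflow \<zeta> m y"
      using c inflow_mono[of c m] unfolding circulation_def m_def by (metis max.cobounded1)
    moreover have "inflow \<zeta> h y \<le> inflow \<zeta> m y"
      by (intro inflow_mono) (simp add: m_def)
    \<comment> \<open>The source unit of the odometer enters only at \<open>x\<close>, and there
      \<open>cx\<close> lets \<open>c\<close> alone carry the bound.\<close>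
    ultimately show "m y \<le> inflow \<zeta> m y"
      using fix_h[of y] cx by (auto simp: m_def split: if_splits)
  qed
  then have "\<zeta> (z, i) \<noteq> None" if "i < h z" for z i
    using that unfolding circulation_def m_def by auto
  then have "(\<Sum>z\<in>UNIV. card {i. i < h z \<and> \<zeta> (z, i) = None}) = 0" by simp
  then have "(\<Sum>y\<in>UNIV. inflow \<zeta> h y) = (\<Sum>y\<in>UNIV. h y)" using sum_inflow[of \<zeta> h] by linarith
  also have "\<dots> = (\<Sum>y\<in>UNIV. (if y = x then 1 else 0) + inflow \<zeta> h y)"
    by (intro sum.cong fix_h refl)
  also have "\<dots> = 1 + (\<Sum>y\<in>UNIV. inflow \<zeta> h y)" by (simp add: sum.distrib)
  finally show False by simp
qed

text \<open>Iteration from 0 stays below every supersolution, since \<open>inflow\<close> is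
  monotone. Exhibiting one supersolution is how the odometer gets bounded above.\<close>

lemma odometer_le:
  assumes "\<And>y. (if y = x then 1 else 0) + inflow \<zeta> h y \<le> h y"
  shows "odometer \<zeta> x k y \<le> h y"
proof (induction k arbitrary: y)
  case (Suc k)
  have "inflow \<zeta> (odometer \<zeta> x k) y \<le> inflow \<zeta> h y" by (intro inflow_mono Suc)
  with assms[of y] show ?case by simp
qed simp

lemma odometer_mono_Suc: "odometer \<zeta> x k y \<le> odometer \<zeta> x (Suc k) y"
proof (induction k arbitrary: y)
  case (Suc k)
  then have "inflow \<zeta> (odometer \<zeta> x k) y \<le> inflow \<zeta> (odometer \<zeta> x (Suc k)) y"
    by (intro inflow_mono)
  then show ?case by simp
qed simp

text \<open>The rounds increase, so a round that is not stationary raises the sum over all nodes by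
  at least one, which a uniform bound permits only finitely often.\<close>

lemma odometer_stable:
  fixes \<zeta> :: "'a::finite \<times> nat \<Rightarrow> 'a option"
  assumes "\<And>k y. odometer \<zeta> x k y \<le> B"
  obtains k where "odometer \<zeta> x (Suc k) = odometer \<zeta> x k"
proof (rule ccontr)
  assume "\<not> thesis"
  with that have ne: "odometer \<zeta> x (Suc k) \<noteq> odometer \<zeta> x k" for k by blast
  have "k \<le> (\<Sum>y\<in>UNIV. odometer \<zeta> x k y)" for k
  proof (induction k)
    case (Suc k)
    obtain y where "odometer \<zeta> x (Suc k) y \<noteq> odometer \<zeta> x k y" using ne[of k] by blast
    then have "odometer \<zeta> x k y < odometer \<zeta> x (Suc k) y"
      using odometer_mono_Suc[of \<zeta> x k y] by linarith
    then have "(\<Sum>y\<in>UNIV. odometer \<zeta> x k y) < (\<Sum>y\<in>UNIV. odometer \<zeta> x (Suc k) y)"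
      by (intro sum_strict_mono_ex1) (use odometer_mono_Suc in \<open>auto simp del: odometer.simps\<close>)
    with Suc show ?case by linarith
  qed simp
  moreover have "(\<Sum>y\<in>UNIV. odometer \<zeta> x k y) \<le> CARD('a) * B" for k
    using sum_bounded_above[of UNIV "odometer \<zeta> x k" B] assms by simp
  ultimately have "Suc (CARD('a) * B) \<le> CARD('a) * B" using le_trans by blast
  then show False by simp
qed

lemma card_less_add_indicator:
  "card {i. i < h z + (if z \<in> A then 1 else (0::nat)) \<and> P z i} =
    card {i. i < h z \<and> P z i} + (if z \<in> A \<and> P z (h z) then 1 else 0)"
proof -
  have "{i. i < Suc (h z) \<and> P z i} = {i. i < h z \<and> P z i} \<union> {i. i = h z \<and> P z i}"
    by auto
  moreover have "card ({i. i < h z \<and> P z i} \<union> {i. i = h z \<and> P z i})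
     = card {i. i < h z \<and> P z i} + card {i. i = h z \<and> P z i}"
    by (intro card_Un_disjoint) auto
  moreover have "card {i. i = h z \<and> P z i} = (if P z (h z) then 1 else 0)"
    by (simp cong: conj_cong)
  ultimately show ?thesis by auto
qed

text \<open>Raising \<open>h\<close> by one on \<open>A\<close> uncovers exactly the entries
  \<open>(z, h z)\<close> with \<open>z\<close> in \<open>A\<close>.\<close>

lemma inflow_add_indicator:
  fixes \<zeta> :: "'a::finite \<times> nat \<Rightarrow> 'a option"
  shows "inflow \<zeta> (\<lambda>z. h z + (if z \<in> A then 1 else 0)) y
    = inflow \<zeta> h y + card {z\<in>A. \<zeta> (z, h z) = Some y}"
proof -
  have "card {z\<in>A. \<zeta> (z, h z) = Some y} = (\<Sum>z\<in>UNIV. if z \<in> A \<and> \<zeta> (z, h z) = Some y then 1 else 0)"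
    by (simp add: sum.If_cases)
  then show ?thesis
    unfolding inflow_def by (simp add: card_less_add_indicator[where P = "\<lambda>z i. \<zeta> (z, i) = Some y"] sum.distrib)
qed

text \<open>\<open>f\<close> maps the finite set \<open>A\<close> onto itself, hence permutes it:
  each node of \<open>A\<close> gains one outgoing and one incoming entry. This is the erasure of a
  cycle.\<close>

lemma circulation_add_cycle:
  fixes \<zeta> :: "'a::finite \<times> nat \<Rightarrow> 'a option"
  assumes c: "circulation \<zeta> c" and nxt: "\<And>z. z \<in> A \<Longrightarrow> \<zeta> (z, c z) = Some (f z)" and "f ` A = A"
  shows "circulation \<zeta> (\<lambda>z. c z + (if z \<in> A then 1 else 0))"
proof -
  have inj: "inj_on f A" using \<open>f ` A = A\<close> by (intro eq_card_imp_inj_on) auto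
  have "card {z\<in>A. \<zeta> (z, c z) = Some y} = (if y \<in> A then 1 else 0)" for y
  proof (cases "y \<in> A")
    case True
    then obtain z where z: "z \<in> A" "y = f z" using \<open>f ` A = A\<close> by auto
    then have "{z\<in>A. \<zeta> (z, c z) = Some y} = {z}"
      using nxt inj by (auto dest: inj_onD)
    with True show ?thesis by simp
  next
    case False
    then have "{z\<in>A. \<zeta> (z, c z) = Some y} = {}" using nxt \<open>f ` A = A\<close> by auto
    with False show ?thesis by (simp only: card.empty if_False)
  qed
  then have "inflow \<zeta> (\<lambda>z. c z + (if z \<in> A then 1 else 0)) y = c y + (if y \<in> A then 1 else 0)" for y
    using c by (simp add: inflow_add_indicator circulation_def)
  moreover have "\<zeta> (z, i) \<noteq> None" if "i < c z + (if z \<in> A then 1 else 0)" for z i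
    using that c nxt[of z] by (cases "i < c z") (auto simp: circulation_def less_Suc_eq split: if_splits)
  ultimately show ?thesis unfolding circulation_def by simp
qed

section \<open>Paths to a stop, and uniqueness of that stop\<close>

lemma relpow_terminal_unique:
  assumes "single_valued R" "r \<notin> Domain R"
  shows "(x, r) \<in> R ^^ j \<Longrightarrow> (x, r) \<in> R ^^ k \<Longrightarrow> j = k"
proof (induction j arbitrary: x k)
  case 0
  show ?case
  proof (cases k)
    case (Suc k')
    with 0 obtain y where "(r, y) \<in> R" by (metis relpow_0_E relpow_Suc_D2)
    with assms(2) show ?thesis by blast
  qed simp
next
  case (Suc j)
  then obtain y where y: "(x, y) \<in> R" "(y, r) \<in> R ^^ j" by (meson relpow_Suc_D2)
  show ?case
  proof (cases k)
    case 0
    with Suc.prems y assms(2) show ?thesis by auto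
  next
    case (Suc k')
    with Suc.prems obtain y' where y': "(x, y') \<in> R" "(y', r) \<in> R ^^ k'" by (meson relpow_Suc_D2)
    then have "y' = y" using y(1) assms(1) by (auto dest: single_valuedD)
    then show ?thesis using Suc.IH y(2) y'(2) Suc by auto
  qed
qed

lemma single_valued_top_graph: "single_valued (top_graph \<zeta> h)"
  unfolding top_graph_def single_valued_def by auto

text \<open>\<open>A\<close> is the node set of the path from \<open>x\<close> to the sink
  \<open>r\<close>: every node on it is entered once, from its predecessor or, at \<open>x\<close>,
  from the source. The distances to \<open>r\<close> are carried along to show that the path is
  simple.\<close>

lemma path_indicator:
  fixes R :: "('a::finite \<times> 'a) set"
  assumes "single_valued R" "r \<notin> Domain R"
  shows "(x, r) \<in> R ^^ n \<Longrightarrow> \<exists>A. x \<in> A \<and> (\<forall>u\<in>A. \<exists>j\<le>n. (u, r) \<in> R ^^ j) \<and>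
    (\<forall>y. (if y = x then 1 else 0) + card {z\<in>A. (z, y) \<in> R} \<le> (if y \<in> A then 1 else (0::nat)))"
proof (induction n arbitrary: x)
  case 0
  then have "x = r" by simp
  then show ?case using assms(2)
    by (intro exI[of _ "{r}"]) (auto simp: Domain_iff card_eq_0_iff)
next
  case (Suc n)
  then obtain z where z: "(x, z) \<in> R" "(z, r) \<in> R ^^ n" by (meson relpow_Suc_D2)
  from Suc.IH[OF z(2)] obtain A where A: "z \<in> A" "\<And>u. u \<in> A \<Longrightarrow> \<exists>j\<le>n. (u, r) \<in> R ^^ j"
    "\<And>y. (if y = z then 1 else 0) + card {u\<in>A. (u, y) \<in> R} \<le> (if y \<in> A then 1 else (0::nat))" by blast
  \<comment> \<open>Otherwise \<open>x\<close> would have distance at most \<open>n\<close> to the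
    sink besides \<open>Suc n\<close>, but in a deterministic graph this distance is unique.\<close>
  have x: "x \<notin> A"
    using A(2)[of x] relpow_terminal_unique[OF assms, of x "Suc n"] Suc.prems by force
  have "{u \<in> insert x A. (u, y) \<in> R} = (if y = z then insert x {u\<in>A. (u, y) \<in> R} else {u\<in>A. (u, y) \<in> R})" for y
    using z(1) assms(1) by (auto dest: single_valuedD)
  then have *: "card {u \<in> insert x A. (u, y) \<in> R} = (if y = z then 1 else 0) + card {u\<in>A. (u, y) \<in> R}" for y
    using x by (simp add: card_insert_if)
  show ?case
  proof (intro exI[of _ "insert x A"] conjI allI ballI)
    fix u assume "u \<in> insert x A"
    then show "\<exists>j\<le>Suc n. (u, r) \<in> R ^^ j"
      using Suc.prems A(2)[of u] le_Suc_eq by blast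
  next
    fix y
    show "(if y = x then 1 else 0) + card {z \<in> insert x A. (z, y) \<in> R} \<le> (if y \<in> insert x A then 1 else (0::nat))"
      using A(3)[of y] x unfolding * by (auto split: if_splits)
  qed simp
qed

text \<open>The circulation plus one unit sent from \<open>x\<close> along the top arrows to the
  stop is a supersolution of the odometer recursion.\<close>

lemma odometer_le_Suc_circulation:
  fixes \<zeta> :: "'a::finite \<times> nat \<Rightarrow> 'a option"
  assumes c: "circulation \<zeta> c" and r: "(x, r) \<in> (top_graph \<zeta> c)\<^sup>*" "\<zeta> (r, c r) = None"
  shows "odometer \<zeta> x k x \<le> Suc (c x)"
proof -
  obtain n where "(x, r) \<in> top_graph \<zeta> c ^^ n" using r(1) by (meson rtrancl_imp_relpow)
  moreover have "r \<notin> Domain (top_graph \<zeta> c)" using r(2) by (auto simp: top_graph_def)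
  ultimately have "\<exists>A. x \<in> A \<and> (\<forall>u\<in>A. \<exists>j\<le>n. (u, r) \<in> top_graph \<zeta> c ^^ j) \<and>
    (\<forall>y. (if y = x then 1 else 0) + card {z\<in>A. (z, y) \<in> top_graph \<zeta> c} \<le> (if y \<in> A then 1 else (0::nat)))"
    by (intro path_indicator single_valued_top_graph)
  then obtain A where A: "x \<in> A" "\<And>y. (if y = x then 1 else 0) + card {z\<in>A. (z, y) \<in> top_graph \<zeta> c} \<le> (if y \<in> A then 1 else (0::nat))"
    by blast
  have "odometer \<zeta> x k x \<le> c x + (if x \<in> A then 1 else 0)"
  proof (rule odometer_le)
    fix y
    show "(if y = x then 1 else 0) + inflow \<zeta> (\<lambda>z. c z + (if z \<in> A then 1 else 0)) y \<le> c y + (if y \<in> A then 1 else 0)"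
      using A(2)[of y] c unfolding inflow_add_indicator by (simp add: circulation_def top_graph_def split: if_splits)
  qed
  then show ?thesis using A(1) by simp
qed

text \<open>Go backwards from the stop, with the maximum \<open>e\<close> of both circulations. At
  \<open>r\<close> it cannot exceed \<open>c\<close>, since it would contain the stop. If it
  exceeded \<open>c\<close> at \<open>v\<close>, it would contain the top arrow of \<open>v\<close>,
  and so exceed \<open>c\<close> also at the next node.\<close>

lemma circulation_le_on_path:
  fixes \<zeta> :: "'a::finite \<times> nat \<Rightarrow> 'a option"
  assumes c: "circulation \<zeta> c" and c': "circulation \<zeta> c'"
    and r: "(v, r) \<in> (top_graph \<zeta> c)\<^sup>*" "\<zeta> (r, c r) = None"
  shows "c' v \<le> c v"
proof -
  define e where "e = (\<lambda>x. max (c x) (c' x))"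
  have e: "circulation \<zeta> e" unfolding e_def by (rule circulation_max[OF c c'])
  have "e v \<le> c v"
    using r(1)
  proof (induction rule: converse_rtrancl_induct)
    case base
    show ?case using e r(2) unfolding circulation_def by (meson not_le)
  next
    case (step v u)
    show ?case
    proof (rule ccontr)
      assume "\<not> e v \<le> c v"
      \<comment> \<open>\<open>e\<close> dominates \<open>c\<close> everywhere and by at least one
        at \<open>v\<close>.\<close>
      then have "inflow \<zeta> (\<lambda>z. c z + (if z \<in> {v} then 1 else 0)) u \<le> inflow \<zeta> e u"
        by (intro inflow_mono) (auto simp: e_def)
      moreover have "{z\<in>{v}. \<zeta> (z, c z) = Some u} = {v}"
        using step(1) by (auto simp: top_graph_def)
      ultimately have "c u + 1 \<le> e u"
        using c e unfolding inflow_add_indicator circulation_def by simp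
      with step.IH show False by simp
    qed
  qed
  then show ?thesis by (simp add: e_def)
qed

text \<open>The preceding bound, applied in both directions, makes the two circulations agree at
  every node of the path, so both show the same top arrow there and the paths coincide up to the
  stop. This holds for any two circulations, not only for those of completed runs.\<close>

lemma stop_unique:
  fixes \<zeta> :: "'a::finite \<times> nat \<Rightarrow> 'a option"
  assumes c: "circulation \<zeta> c" and c': "circulation \<zeta> c'"
    and r: "(v, r) \<in> (top_graph \<zeta> c)\<^sup>*" "\<zeta> (r, c r) = None"
    and r': "(v, r') \<in> (top_graph \<zeta> c')\<^sup>*" "\<zeta> (r', c' r') = None"
  shows "r = r' \<and> c r = c' r'"
  using r(1) r'(1)
proof (induction rule: converse_rtrancl_induct)
  case base
  then have "c r = c' r"
    using circulation_le_on_path[OF c c' _ r(2), of r] circulation_le_on_path[OF c' c base r'(2)] by simp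
  moreover have "r = r'"
    using base
  proof (cases rule: converse_rtranclE)
    case (step u)
    with r(2) \<open>c r = c' r\<close> show ?thesis by (simp add: top_graph_def)
  qed
  ultimately show ?case by simp
next
  case (step v u)
  have "c v = c' v"
    using circulation_le_on_path[OF c c' converse_rtrancl_into_rtrancl[OF step.hyps] r(2)]
      circulation_le_on_path[OF c' c step.prems r'(2)] by simp
  then have u: "\<zeta> (v, c' v) = Some u" using step.hyps(1) by (simp add: top_graph_def)
  have "(u, r') \<in> (top_graph \<zeta> c')\<^sup>*"
    using step.prems
  proof (cases rule: converse_rtranclE)
    case base
    with u r'(2) show ?thesis by simp
  next
    case (step u')
    with u show ?thesis by (simp add: top_graph_def)
  qed
  then show ?case by (rule step.IH)
qed

text \<open>\<open>v\<close> is in the tree rooted at \<open>x\<close> if entry \<open>i\<close> at \<open>x\<close> is made a stop. Excluding the arrow of \<open>x\<close>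
  makes this independent of that entry.\<close>

definition reaches :: "('a::finite \<times> nat \<Rightarrow> 'a option) \<Rightarrow> 'a \<Rightarrow> nat \<Rightarrow> 'a \<Rightarrow> bool" where
  "reaches \<zeta> x i v \<longleftrightarrow>
     (\<exists>c. circulation \<zeta> c \<and> c x = i \<and> (v, x) \<in> {(a, b). a \<noteq> x \<and> \<zeta> (a, c a) = Some b}\<^sup>*)"

text \<open>When entry \<open>i\<close> at \<open>x\<close> really is a stop, leaving out the arrow
  of \<open>x\<close> removes nothing, and \<open>stop_unique\<close> applies. This is the
  disjointness of the trees.\<close>

lemma reaches_stop_unique:
  assumes "reaches \<zeta> x i v" "\<zeta> (x, i) = None" "reaches \<zeta> x' i' v" "\<zeta> (x', i') = None"
  shows "x = x' \<and> i = i'"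
proof -
  have *: "\<exists>c. circulation \<zeta> c \<and> c x = i \<and> (v, x) \<in> (top_graph \<zeta> c)\<^sup>* \<and> \<zeta> (x, c x) = None"
    if r: "reaches \<zeta> x i v" "\<zeta> (x, i) = None" for x i
  proof -
    obtain c where c: "circulation \<zeta> c" "c x = i" "(v, x) \<in> {(a, b). a \<noteq> x \<and> \<zeta> (a, c a) = Some b}\<^sup>*"
      using r(1) unfolding reaches_def by blast
    have "(v, x) \<in> (top_graph \<zeta> c)\<^sup>*"
      by (rule subsetD[OF rtrancl_mono c(3)]) (auto simp: top_graph_def)
    with c r(2) show ?thesis by blast
  qed
  show ?thesis using *[OF assms(1,2)] *[OF assms(3,4)] stop_unique[of \<zeta>] by metis
qed

section \<open>Independence from a single entry\<close>

lemma inflow_upd: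
  assumes "h x \<le> i"
  shows "inflow (\<zeta>((x, i) := e)) h y = inflow \<zeta> h y"
  unfolding inflow_def
  by (intro sum.cong refl arg_cong[where f = card]) (use assms in auto)

lemma circulation_upd:
  assumes "h x \<le> i"
  shows "circulation (\<zeta>((x, i) := e)) h \<longleftrightarrow> circulation \<zeta> h"
proof -
  have "(\<forall>z. \<forall>j<h z. (\<zeta>((x, i) := e)) (z, j) \<noteq> None) \<longleftrightarrow> (\<forall>z. \<forall>j<h z. \<zeta> (z, j) \<noteq> None)"
    using assms by (metis fun_upd_other leD prod.inject)
  then show ?thesis unfolding circulation_def inflow_upd[of h x i, OF assms] by simp
qed

text \<open>The condition \<open>c x = i\<close> confines the circulation to entries below
  \<open>i\<close> at \<open>x\<close>, and the path never uses the arrow of \<open>x\<close>; so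
  entry \<open>(x, i)\<close> is not consulted.\<close>

lemma reaches_upd: "reaches (\<zeta>((x, i) := e)) x i v \<longleftrightarrow> reaches \<zeta> x i v"
proof -
  have "{(a, b). a \<noteq> x \<and> (\<zeta>((x, i) := e)) (a, c a) = Some b} = {(a, b). a \<noteq> x \<and> \<zeta> (a, c a) = Some b}" for c
    by auto
  moreover have "circulation (\<zeta>((x, i) := e)) c \<and> c x = i \<longleftrightarrow> circulation \<zeta> c \<and> c x = i" for c
    using circulation_upd[of c x i \<zeta> e] by auto
  ultimately show ?thesis unfolding reaches_def by (simp only: flip: conj_assoc)
qed

lemma odometer_upd_eq:
  assumes "odometer \<zeta> x k z \<le> i"
  shows "odometer (\<zeta>((z, i) := e)) x k = odometer \<zeta> x k"
  using assms
proof (induction k)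
  case (Suc k)
  have le: "odometer \<zeta> x k z \<le> i"
    using odometer_mono_Suc[of \<zeta> x k z] Suc.prems by linarith
  then show ?case using Suc.IH[OF le] inflow_upd[of "odometer \<zeta> x k" z i, OF le] by (simp del: fun_upd_apply)
qed simp

text \<open>As long as the count at \<open>z\<close> has not passed \<open>i\<close>, no round has
  looked at entry \<open>(z, i)\<close>. Applying this to the changed stacks, with the change
  undone, gives the converse.\<close>

lemma less_odometer_upd: "i < odometer (\<zeta>((z, i) := e)) x k z \<longleftrightarrow> i < odometer \<zeta> x k z"
proof -
  have "odometer (\<zeta>((z, i) := e)) x k z \<le> i \<longleftrightarrow> odometer \<zeta> x k z \<le> i"
    using odometer_upd_eq[of \<zeta> x k z i e] odometer_upd_eq[of "\<zeta>((z, i) := e)" x k z i "\<zeta> (z, i)"] by auto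
  then show ?thesis by linarith
qed

section \<open>Invariants of a run\<close>

definition interp :: "('a::finite \<Rightarrow> 'a \<Rightarrow> real) \<Rightarrow> real \<Rightarrow> 'a stacks \<Rightarrow> 'a \<times> nat \<Rightarrow> 'a option" where
  "interp w t \<omega> e = (if fst (\<omega> e) < threshold w t (fst e) then None else Some (snd (\<omega> e)))"

text \<open>Solution \<open>t\<close> of \<open>1 / (1 + t * node_weight w x) = u\<close>; at weight
  0 the division yields 0.\<close>

definition unfreeze_time :: "('a::finite \<Rightarrow> 'a \<Rightarrow> real) \<Rightarrow> 'a \<Rightarrow> real \<Rightarrow> real" where
  "unfreeze_time w x u = (1 / u - 1) / node_weight w x"

definition tree_size :: "('a::finite \<Rightarrow> 'a \<Rightarrow> real) \<Rightarrow> 'a stacks \<Rightarrow> 'a \<times> nat \<Rightarrow> real \<Rightarrow> nat" where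
  "tree_size w \<omega> e t = card {v. reaches (interp w t \<omega>) (fst e) (snd e) v}"

text \<open>Charge carried by one entry: the condition says that the entry has turned into an arrow
  by time \<open>T\<close>, and the tree is evaluated at that very moment.\<close>

definition unfreeze_cost :: "('a::finite \<Rightarrow> 'a \<Rightarrow> real) \<Rightarrow> real \<Rightarrow> 'a stacks \<Rightarrow> 'a \<times> nat \<Rightarrow> nat" where
  "unfreeze_cost w T \<omega> e =
     (if threshold w T (fst e) \<le> fst (\<omega> e) then tree_size w \<omega> e (unfreeze_time w (fst e) (fst (\<omega> e))) else 0)"

text \<open>A node with an arrow and a frozen root keep their last entry as the current one. At an
  active node without arrow everything read has been erased.\<close>

definition popped :: "'a state \<Rightarrow> 'a \<Rightarrow> nat" where
  "popped s x = nread s x - (if x \<in> dom (arrows s) \<or> x \<in> frozen s then 1 else 0)"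

text \<open>Entries already used as arrows. Counting the current stop of a root as not settled makes the
  unfreezing of that root settle exactly one entry, which pays for its extra reads.\<close>

definition settled :: "'a state \<Rightarrow> 'a \<Rightarrow> nat" where
  "settled s x = nread s x - (if x \<notin> dom (arrows s) \<and> x \<in> frozen s then 1 else 0)"

lemma node_weight_nonneg: "(\<And>x y. 0 \<le> w x y) \<Longrightarrow> 0 \<le> node_weight w x"
  unfolding node_weight_def by (intro sum_nonneg) auto

text \<open>More arrows can only raise the inflow, and inflow at least \<open>c\<close> is
  enough.\<close>

lemma circulation_mono:
  assumes c: "circulation \<zeta> c" and "\<And>e y. \<zeta> e = Some y \<Longrightarrow> \<zeta>' e = Some y"
  shows "circulation \<zeta>' c"
proof (rule circulation_if_le_inflow)
  fix y
  have "c y = inflow \<zeta> c y" using c by (simp add: circulation_def)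
  also have "\<dots> \<le> inflow \<zeta>' c y"
    unfolding inflow_def by (intro sum_mono card_mono) (auto simp: assms(2))
  finally show "c y \<le> inflow \<zeta>' c y" .
qed

text \<open>Walks are stored newest node first, so for consecutive \<open>a\<close>,
  \<open>b\<close> the arrow leads from \<open>b\<close> to \<open>a\<close>, and only arrows
  leaving nodes of the tail occur.\<close>

lemma successively_arrows_cong:
  assumes "successively (\<lambda>a b. m b = Some a) (u # us)" "\<And>b. b \<in> set us \<Longrightarrow> m' b = m b"
  shows "successively (\<lambda>a b. m' b = Some a) (u # us)"
  using assms by (induction us arbitrary: u) auto

lemma successively_dom:
  "successively (\<lambda>a b. m b = Some a) (u # us) \<Longrightarrow> x \<in> set us \<Longrightarrow> x \<in> dom m"
  by (induction us arbitrary: u) auto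

lemma successively_rtrancl:
  "successively (\<lambda>a b. m b = Some a) (u # us) \<Longrightarrow> x \<in> set (u # us) \<Longrightarrow> (x, u) \<in> (Map.graph m)\<^sup>*"
proof (induction us arbitrary: u)
  case (Cons v us)
  then have "(v, u) \<in> Map.graph m" by (simp add: in_graphI)
  with Cons show ?case by (cases "x = u") (auto intro: rtrancl_into_rtrancl)
qed simp

lemma successively_image:
  "successively (\<lambda>a b. m b = Some a) (u # us) \<Longrightarrow>
    set (u # us) \<subseteq> insert (last (u # us)) ((\<lambda>z. the (m z)) ` set us)"
proof (induction us arbitrary: u)
  case (Cons v us)
  then have "m v = Some u" and "set (v # us) \<subseteq> insert (last (v # us)) ((\<lambda>z. the (m z)) ` set us)" by auto
  then show ?case by auto
qed simp

text \<open>It suffices that the image covers the cycle, as it cannot have more elements than the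
  cycle.\<close>

lemma cycle_image:
  assumes "successively (\<lambda>a b. m b = Some a) (u # us)" "m u = Some (last (u # us))"
  shows "(\<lambda>z. the (m z)) ` set (u # us) = set (u # us)"
proof (rule card_seteq[symmetric])
  show "set (u # us) \<subseteq> (\<lambda>z. the (m z)) ` set (u # us)"
    using successively_image[OF assms(1)] assms(2) by (force simp: image_iff)
  show "card ((\<lambda>z. the (m z)) ` set (u # us)) \<le> card (set (u # us))"
    by (rule card_image_le) simp
qed simp

lemma graph_rtrancl_dom: "(x, r) \<in> (Map.graph m)\<^sup>* \<Longrightarrow> x = r \<or> x \<in> dom m"
  by (erule converse_rtranclE) (auto dest: in_graphD)

text \<open>The deterministic part works with one fixed \<open>\<omega>\<close>. Marks strictly
  between 0 and 1 make all unfreezing times finite and nonnegative, and keep nodes of weight 0,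
  whose threshold is always 1, from ever being unfrozen.\<close>

locale marked_stacks =
  fixes w :: "'a::finite \<Rightarrow> 'a \<Rightarrow> real" and q0 :: real and \<omega> :: "'a stacks"
  assumes weight_nonneg: "0 \<le> w x y" and q0: "0 < q0"
    and mark_pos: "0 < fst (\<omega> e)" and mark_less_1: "fst (\<omega> e) < 1"
begin

lemma node_weight_ge_0: "0 \<le> node_weight w x"
  using weight_nonneg by (rule node_weight_nonneg)

lemma threshold_antimono: "0 \<le> t \<Longrightarrow> t \<le> t' \<Longrightarrow> threshold w t' x \<le> threshold w t x"
  unfolding threshold_def using node_weight_ge_0[of x]
  by (intro divide_left_mono mult_pos_pos add_mono mult_right_mono) (auto intro: add_pos_nonneg)

lemma interp_mono: "interp w t \<omega> e = Some y \<Longrightarrow> 0 \<le> t \<Longrightarrow> t \<le> t' \<Longrightarrow> interp w t' \<omega> e = Some y"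
  using threshold_antimono[of t t' "fst e"] by (auto simp: interp_def split: if_splits)

lemma interp_circulation_mono:
  "circulation (interp w t \<omega>) c \<Longrightarrow> 0 \<le> t \<Longrightarrow> t \<le> t' \<Longrightarrow> circulation (interp w t' \<omega>) c"
  by (erule circulation_mono) (rule interp_mono)

lemma threshold_eq_mark:
  assumes "0 \<le> t"
  shows "threshold w t x = fst (\<omega> e) \<longleftrightarrow> 0 < node_weight w x \<and> t = unfreeze_time w x (fst (\<omega> e))"
proof (cases "node_weight w x = 0")
  case True
  then show ?thesis using mark_less_1[of e] by (simp add: threshold_def)
next
  case False
  then have "0 < node_weight w x" using node_weight_ge_0[of x] by simp
  then have "0 < 1 + t * node_weight w x" using assms by (intro add_pos_nonneg mult_nonneg_nonneg) auto
  then have "threshold w t x = fst (\<omega> e) \<longleftrightarrow> 1 + t * node_weight w x = 1 / fst (\<omega> e)"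
    using mark_pos[of e] by (auto simp: threshold_def field_simps)
  also have "\<dots> \<longleftrightarrow> t = unfreeze_time w x (fst (\<omega> e))"
    using False by (auto simp: unfreeze_time_def field_simps)
  finally show ?thesis using \<open>0 < node_weight w x\<close> by simp
qed

lemma unfreeze_time_nonneg: "0 \<le> unfreeze_time w x (fst (\<omega> e))"
  using mark_pos[of e] mark_less_1[of e] node_weight_ge_0[of x] by (simp add: unfreeze_time_def)

lemma unfreezes_at_iff:
  "unfreezes_at w \<omega> s x t \<longleftrightarrow> x \<notin> dom (arrows s) \<and> 0 < node_weight w x \<and>
     t = unfreeze_time w x (fst (\<omega> (x, nread s x - 1)))"
  unfolding unfreezes_at_def using threshold_eq_mark[of t x] unfreeze_time_nonneg by blast

text \<open>\<open>LEAST\<close> over the reals is meaningful here because each node contributes at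
  most one time, so that the minimum of a finite set is taken.\<close>

lemma least_unfreezing:
  assumes "unfreezes_at w \<omega> s x0 t0"
  defines "t \<equiv> LEAST t. \<exists>x. unfreezes_at w \<omega> s x t"
  shows "\<exists>x. unfreezes_at w \<omega> s x t" "\<And>x t'. unfreezes_at w \<omega> s x t' \<Longrightarrow> t \<le> t'"
proof -
  let ?A = "{t. \<exists>x. unfreezes_at w \<omega> s x t}"
  have fin: "finite ?A"
    by (rule finite_subset[of _ "range (\<lambda>x. unfreeze_time w x (fst (\<omega> (x, nread s x - 1))))"])
      (auto simp: unfreezes_at_iff)
  have t: "t = Min ?A"
    unfolding t_def using assms(1) by (intro Least_Min fin) auto
  have "t \<in> ?A" unfolding t using assms(1) by (intro Min_in fin) auto
  then show "\<exists>x. unfreezes_at w \<omega> s x t" by simp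
  show "t \<le> t'" if "unfreezes_at w \<omega> s x t'" for x t'
    unfolding t using that by (intro Min_le fin) auto
qed

lemma mark_le_threshold_iff:
  assumes "0 < node_weight w x" "0 \<le> t"
  shows "fst (\<omega> e) \<le> threshold w t x \<longleftrightarrow> t \<le> unfreeze_time w x (fst (\<omega> e))"
proof -
  have "0 < 1 + t * node_weight w x" using assms by (intro add_pos_nonneg mult_nonneg_nonneg) auto
  then have "fst (\<omega> e) \<le> threshold w t x \<longleftrightarrow> 1 + t * node_weight w x \<le> 1 / fst (\<omega> e)"
    using mark_pos[of e] by (auto simp: threshold_def field_simps)
  also have "\<dots> \<longleftrightarrow> t \<le> unfreeze_time w x (fst (\<omega> e))"
    using assms by (auto simp: unfreeze_time_def field_simps)
  finally show ?thesis .
qed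

end

text \<open>The invariant that survives in the middle of a step. When the current node has just
  received its arrow but the walk has not moved, that node is not yet in the tail of the walk, so
  \<open>active_arrow\<close> is deferred to \<open>machine_state\<close>. \<open>stop_top\<close>
  has a non-strict inequality since several roots may share an unfreezing time.
  \<open>extra_bound\<close> is an amortised count: every active untagged node still owes at most
  one extra read, and the settled entries pay.\<close>

locale forest_state = marked_stacks w q0 \<omega>
  for w :: "'a::finite \<Rightarrow> 'a \<Rightarrow> real" and q0 :: real and \<omega> :: "'a stacks" +
  fixes s :: "'a state"
  assumes time_nonneg: "0 \<le> time s" and time_le: "time s \<le> 1 / q0"
    and nread_pos: "x \<in> dom (arrows s) \<or> x \<in> frozen s \<Longrightarrow> 0 < nread s x"
    and arrow_top: "arrows s x = Some y \<Longrightarrow> interp w (time s) \<omega> (x, nread s x - 1) = Some y"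
    and stop_top: "x \<in> frozen s \<Longrightarrow> arrows s x = None \<Longrightarrow>
      fst (\<omega> (x, nread s x - 1)) \<le> threshold w (time s) x"
    and circ: "circulation (interp w (time s) \<omega>) (popped s)"
    and frozen_root: "x \<in> frozen s \<Longrightarrow> \<exists>r\<in>frozen s. arrows s r = None \<and>
      (x, r) \<in> {(a, b). a \<in> frozen s \<and> arrows s a = Some b}\<^sup>*"
    and prev_root: "\<exists>r. prev s r = None \<and> (x, r) \<in> (Map.graph (prev s))\<^sup>*"
    and untagged: "x \<notin> tagged s \<Longrightarrow> x \<notin> frozen s \<Longrightarrow> arrows s x = prev s x"
    and walk_distinct: "distinct (walk s)"
    and walk_path: "successively (\<lambda>a b. arrows s b = Some a) (walk s)"
    and walk_tail: "x \<in> set (tl (walk s)) \<Longrightarrow> x \<in> tagged s \<and> x \<notin> frozen s"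
    and extra_bound: "extra s + card (- frozen s - tagged s)
      \<le> (\<Sum>x\<in>UNIV. \<Sum>i<settled s x. unfreeze_cost w (1 / q0) \<omega> (x, i))"
begin

lemma frozen_root_graph:
  assumes "x \<in> frozen s"
  obtains r where "r \<in> frozen s" "r \<notin> dom (arrows s)" "(x, r) \<in> (Map.graph (arrows s))\<^sup>*"
proof -
  obtain r where r: "r \<in> frozen s" "arrows s r = None"
      "(x, r) \<in> {(a, b). a \<in> frozen s \<and> arrows s a = Some b}\<^sup>*"
    using frozen_root[OF assms] by blast
  have "(x, r) \<in> (Map.graph (arrows s))\<^sup>*"
    by (rule subsetD[OF rtrancl_mono r(3)]) (auto intro: in_graphI)
  with r that show ?thesis by blast
qed

end

locale machine_state = forest_state +
  assumes active_arrow: "x \<in> tagged s \<Longrightarrow> x \<notin> frozen s \<Longrightarrow> x \<in> dom (arrows s) \<Longrightarrow> x \<in> set (tl (walk s))"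
    and idle_closed: "walk s = [] \<Longrightarrow> arrows s x = Some y \<Longrightarrow> y \<in> frozen s \<Longrightarrow> x \<in> frozen s"

section \<open>A progress measure for termination\<close>

definition weight :: "'a::finite state \<Rightarrow> nat" where
  "weight s = (\<Sum>x\<in>UNIV. nread s x + popped s x)"

text \<open>Orders the steps that change no counter: a walk standing on a frozen node ends (0 to 1),
  and a new walk starts at an active root (1 to 2).\<close>

definition stage :: "'a state \<Rightarrow> nat" where
  "stage s = (case walk s of [] \<Rightarrow> 1 | u # _ \<Rightarrow> if u \<in> frozen s then 0 else 2)"

text \<open>A lexicographic combination that increases in every step until the run is finished.\<close>

definition progress :: "'a::finite state \<Rightarrow> nat" where
  "progress s = ((weight s * Suc CARD('a) + card (dom (arrows s))) * Suc CARD('a) + card (tagged s)) * 3 + stage s"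

lemma lex_less:
  fixes a b :: nat
  assumes "b \<le> n" "a < a' \<or> a = a' \<and> b < b'"
  shows "a * Suc n + b < a' * Suc n + b'"
proof (cases "a < a'")
  case True
  then have "Suc a * Suc n \<le> a' * Suc n" by (intro mult_le_mono1) simp
  then show ?thesis using assms(1) by simp
qed (use assms in auto)

lemma card_le_CARD: "card (A :: 'a::finite set) \<le> CARD('a)"
  by (intro card_mono) auto

text \<open>The digits fit their bases: both cardinalities are at most that of the node set, and
  \<open>stage\<close> is at most 2.\<close>

lemma progress_less:
  fixes s s' :: "'a::finite state"
  assumes "weight s < weight s' \<or> weight s = weight s' \<and>
    (card (dom (arrows s)) < card (dom (arrows s')) \<or> card (dom (arrows s)) = card (dom (arrows s')) \<and>
    (card (tagged s) < card (tagged s') \<or> card (tagged s) = card (tagged s') \<and> stage s < stage s'))"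
  shows "progress s < progress s'"
proof -
  have st: "stage s \<le> 2" for s :: "'a state" by (auto simp: stage_def split: list.split)
  have three: "3 = Suc 2" by simp
  have "(weight s * Suc CARD('a) + card (dom (arrows s)) < weight s' * Suc CARD('a) + card (dom (arrows s'))) \<or>
     weight s * Suc CARD('a) + card (dom (arrows s)) = weight s' * Suc CARD('a) + card (dom (arrows s')) \<and>
    (card (tagged s) < card (tagged s') \<or> card (tagged s) = card (tagged s') \<and> stage s < stage s')"
    using assms lex_less[OF card_le_CARD[of "dom (arrows s)"], of "weight s" "weight s'" "card (dom (arrows s'))"] by metis
  then have "((weight s * Suc CARD('a) + card (dom (arrows s))) * Suc CARD('a) + card (tagged s)
     < (weight s' * Suc CARD('a) + card (dom (arrows s'))) * Suc CARD('a) + card (tagged s')) \<or>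
    ((weight s * Suc CARD('a) + card (dom (arrows s))) * Suc CARD('a) + card (tagged s)
     = (weight s' * Suc CARD('a) + card (dom (arrows s'))) * Suc CARD('a) + card (tagged s')) \<and> stage s < stage s'"
    using lex_less[OF card_le_CARD[of "tagged s"]] by metis
  then show ?thesis unfolding progress_def three by (intro lex_less[OF st])
qed

text \<open>Without a cycle only the walk grows. Closing a cycle raises \<open>popped\<close> by the
  indicator of the cycle, which \<open>circulation_add_cycle\<close> allows; its nodes are active,
  so \<open>settled\<close> and with it the budget stay the same.\<close>

lemma (in forest_state) machine_state_move:
  assumes walk: "walk s = u # us" and u: "u \<notin> frozen s" "u \<in> tagged s" "arrows s u = Some v"
    and act: "\<And>x. x \<in> tagged s \<Longrightarrow> x \<notin> frozen s \<Longrightarrow> x \<in> dom (arrows s) \<Longrightarrow> x \<in> set (walk s)"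
  shows "machine_state w q0 \<omega> (move v s)"
    and "weight s < weight (move v s) \<or> weight s = weight (move v s) \<and>
      dom (arrows (move v s)) = dom (arrows s)"
    and "tagged (move v s) = tagged s"
proof -
  have walk_active: "x \<in> tagged s \<and> x \<notin> frozen s \<and> x \<in> dom (arrows s)" if "x \<in> set (walk s)" for x
    using that walk_tail[of x] successively_dom[OF walk_path[unfolded walk], of x] u walk by auto
  have "machine_state w q0 \<omega> (move v s) \<and> (weight s < weight (move v s) \<or> weight s = weight (move v s) \<and>
      dom (arrows (move v s)) = dom (arrows s)) \<and> tagged (move v s) = tagged s"
  proof (cases "v \<in> set (walk s)")
    case False
    then have mv: "move v s = s\<lparr>walk := v # walk s\<rparr>" by (simp add: move_def)
    have pop: "popped (move v s) = popped s" "settled (move v s) = settled s"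
      by (auto simp: mv popped_def settled_def fun_eq_iff)
    have "machine_state w q0 \<omega> (move v s)"
    proof (unfold_locales, unfold pop)
      show "circulation (interp w (time (move v s)) \<omega>) (popped s)" using circ by (simp add: mv)
      show "distinct (walk (move v s))" using walk_distinct False by (simp add: mv)
      show "successively (\<lambda>a b. arrows (move v s) b = Some a) (walk (move v s))"
        using walk_path u walk by (simp add: mv)
      show "extra (move v s) + card (- frozen (move v s) - tagged (move v s))
        \<le> (\<Sum>x\<in>UNIV. \<Sum>i<settled s x. unfreeze_cost w (1 / q0) \<omega> (x, i))"
        using extra_bound by (simp add: mv)
    next
      fix x assume "x \<in> set (tl (walk (move v s)))"
      then show "x \<in> tagged (move v s) \<and> x \<notin> frozen (move v s)" using walk_active by (simp add: mv)
    next
      fix x assume "x \<in> tagged (move v s)" "x \<notin> frozen (move v s)" "x \<in> dom (arrows (move v s))"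
      then show "x \<in> set (tl (walk (move v s)))" using act by (simp add: mv)
    qed (use time_nonneg time_le nread_pos arrow_top stop_top frozen_root prev_root untagged in \<open>auto simp: mv\<close>)
    then show ?thesis using pop by (simp add: weight_def) (simp add: mv)
  next
    case True
    then obtain p r where split: "walk s = p @ v # r" "v \<notin> set p" by (meson split_list_first)
    \<comment> \<open>The walk is listed newest first, so \<open>p\<close> holds the nodes visited
      after \<open>v\<close>.\<close>
    define C where "C = insert v (set p)"
    define s' where "s' = s\<lparr>arrows := arrows s |` (- C), walk := v # r\<rparr>"
    have tw: "takeWhile (\<lambda>u. u \<noteq> v) (walk s) = p" "dropWhile (\<lambda>u. u \<noteq> v) (walk s) = v # r"
      unfolding split(1) using split(2) by (induction p) auto
    have mv: "move v s = s'"
      using True by (simp add: move_def tw s'_def C_def)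
    have CW: "C \<subseteq> set (walk s)" unfolding C_def split(1) by auto
    have rC: "set r \<inter> C = {}" using walk_distinct unfolding split(1) C_def by auto
    have arr: "arrows s' x = (if x \<in> C then None else arrows s x)" for x
      by (simp add: s'_def restrict_map_def)
    have other: "time s' = time s" "prev s' = prev s" "nread s' = nread s" "frozen s' = frozen s"
      "tagged s' = tagged s" "walk s' = v # r" "extra s' = extra s" by (simp_all add: s'_def)
    have CA: "x \<in> tagged s \<and> x \<notin> frozen s \<and> x \<in> dom (arrows s)" if "x \<in> C" for x
      using that CW walk_active by blast
    have npos: "0 < nread s x" if "x \<in> C" for x using CA[OF that] nread_pos by blast
    have pop: "popped s' = (\<lambda>x. popped s x + (if x \<in> C then 1 else 0))"
    proof
      fix x show "popped s' x = popped s x + (if x \<in> C then 1 else 0)"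
        using CA[of x] npos[of x] by (auto simp: popped_def arr other dom_def)
    qed
    have set: "settled s' = settled s"
    proof
      fix x show "settled s' x = settled s x"
        using CA[of x] by (auto simp: settled_def arr other dom_def)
    qed
    \<comment> \<open>\<open>p @ [v]\<close> begins with the current node \<open>u\<close>, whose
      new arrow to \<open>v\<close> closes the cycle.\<close>
    have pv: "\<exists>us'. p @ [v] = u # us'" using walk split(1) by (cases p) auto
    then obtain us' where us': "p @ [v] = u # us'" by blast
    have "successively (\<lambda>a b. arrows s b = Some a) ((p @ [v]) @ r)"
      using walk_path unfolding split(1) by simp
    then have "successively (\<lambda>a b. arrows s b = Some a) (u # us')"
      unfolding us'[symmetric] by (simp only: successively_append_iff)
    moreover have "arrows s u = Some (last (u # us'))" unfolding us'[symmetric] by (simp add: u)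
    ultimately have img: "(\<lambda>z. the (arrows s z)) ` C = C"
      using cycle_image[of "arrows s" u us'] unfolding us'[symmetric] by (simp add: C_def)
    have circ': "circulation (interp w (time s) \<omega>) (\<lambda>x. popped s x + (if x \<in> C then 1 else 0))"
    proof (rule circulation_add_cycle[OF circ _ img])
      fix z assume z: "z \<in> C"
      then obtain y where y: "arrows s z = Some y" using CA by blast
      \<comment> \<open>At a node with an arrow \<open>popped\<close> omits exactly the current
        entry, so the entry of that number is the arrow in use.\<close>
      then show "interp w (time s) \<omega> (z, popped s z) = Some (the (arrows s z))"
        using arrow_top[OF y] CA[OF z] by (simp add: popped_def)
    qed
    have "successively (\<lambda>a b. arrows s b = Some a) (v # r)"
      using walk_path unfolding split(1) by (simp add: successively_append_iff)
    then have path': "successively (\<lambda>a b. arrows s' b = Some a) (v # r)"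
      by (rule successively_arrows_cong) (use rC arr in auto)
    have "machine_state w q0 \<omega> s'"
    proof (unfold_locales, unfold other set pop)
      show "successively (\<lambda>a b. arrows s' b = Some a) (v # r)" by (rule path')
      show "circulation (interp w (time s) \<omega>) (\<lambda>x. popped s x + (if x \<in> C then 1 else 0))" by (rule circ')
      show "distinct (v # r)" using walk_distinct unfolding split(1) by simp
    next
      fix x assume "x \<in> frozen s"
      have *: "{(a, b). a \<in> frozen s \<and> arrows s' a = Some b} = {(a, b). a \<in> frozen s \<and> arrows s a = Some b}"
        by (auto simp: arr split: if_splits dest: CA)
      show "\<exists>r\<in>frozen s. arrows s' r = None \<and> (x, r) \<in> {(a, b). a \<in> frozen s \<and> arrows s' a = Some b}\<^sup>*"
        unfolding * using frozen_root[OF \<open>x \<in> frozen s\<close>] arr by fastforce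
    next
      fix x assume "x \<notin> tagged s" "x \<notin> frozen s"
      then show "arrows s' x = prev s x" using CA untagged arr by auto
    next
      fix x assume "x \<in> set (tl (v # r))"
      then show "x \<in> tagged s \<and> x \<notin> frozen s" using walk_active split(1) by auto
    next
      fix x assume x: "x \<in> tagged s" "x \<notin> frozen s" "x \<in> dom (arrows s')"
      then have "x \<in> dom (arrows s)" "x \<notin> C" by (auto simp: arr dom_def split: if_splits)
      then have "x \<in> set (walk s)" using act x by blast
      with \<open>x \<notin> C\<close> show "x \<in> set (tl (v # r))" using split(1) by (auto simp: C_def)
    next
      fix x assume "x \<in> frozen s" "arrows s' x = None"
      then show "fst (\<omega> (x, nread s x - 1)) \<le> threshold w (time s) x"
        using stop_top CA[of x] arr[of x] by (auto split: if_splits)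
    qed (use time_nonneg time_le nread_pos arrow_top prev_root extra_bound in \<open>auto simp: arr dom_def split: if_splits\<close>)
    moreover have "weight s < weight s'"
      unfolding weight_def pop other
      by (intro sum_strict_mono_ex1) (auto simp: C_def)
    ultimately show ?thesis by (simp add: mv other)
  qed
  then show "machine_state w q0 \<omega> (move v s)"
    and "weight s < weight (move v s) \<or> weight s = weight (move v s) \<and>
      dom (arrows (move v s)) = dom (arrows s)"
    and "tagged (move v s) = tagged s" by blast+
qed

text \<open>A newly frozen node has an arrow, since a root that is reached was frozen before; hence
  \<open>popped\<close> and \<open>settled\<close> do not change.\<close>

lemma (in forest_state) machine_state_end_walk:
  assumes walk: "walk s = u # us" and u: "u \<in> frozen s"
    and act: "\<And>x. x \<in> tagged s \<Longrightarrow> x \<notin> frozen s \<Longrightarrow> x \<in> dom (arrows s) \<Longrightarrow> x \<in> set us"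
  shows "machine_state w q0 \<omega> (end_walk s)" and "weight (end_walk s) = weight s"
    and "arrows (end_walk s) = arrows s" "tagged (end_walk s) = tagged s" "stage s < stage (end_walk s)"
proof -
  define F where "F = frozen s \<union> {v. \<exists>r. r \<in> frozen s \<and> r \<notin> dom (arrows s) \<and> (v, r) \<in> (Map.graph (arrows s))\<^sup>*}"
  have sel: "time (end_walk s) = time s" "prev (end_walk s) = prev s" "nread (end_walk s) = nread s"
    "frozen (end_walk s) = F" "arrows (end_walk s) = arrows s"
    "tagged (end_walk s) = tagged s" "walk (end_walk s) = []" "extra (end_walk s) = extra s"
    by (simp_all add: end_walk_def F_def)
  have F_sub: "x \<in> frozen s \<or> x \<in> dom (arrows s)" if xF: "x \<in> F" for x
  proof (cases "x \<in> frozen s")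
    case False
    then obtain r where "r \<in> frozen s" "(x, r) \<in> (Map.graph (arrows s))\<^sup>*"
      using xF unfolding F_def by blast
    then show ?thesis using graph_rtrancl_dom[of x r "arrows s"] by blast
  qed simp
  have F_sup: "frozen s \<subseteq> F" by (auto simp: F_def)
  have lead: "x \<in> F" if xy: "(x, y) \<in> (Map.graph (arrows s))\<^sup>*" "y \<in> F" for x y
  proof -
    obtain r where "r \<in> frozen s" "r \<notin> dom (arrows s)" "(y, r) \<in> (Map.graph (arrows s))\<^sup>*"
      using xy(2) frozen_root_graph[of y] unfolding F_def by blast
    then show ?thesis using xy(1) unfolding F_def by (blast intro: rtrancl_trans)
  qed
  have pop: "popped (end_walk s) = popped s"
    using F_sub F_sup by (auto simp: popped_def sel fun_eq_iff)
  have set: "settled (end_walk s) = settled s"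
    using F_sub F_sup by (auto simp: settled_def sel fun_eq_iff)
  show "machine_state w q0 \<omega> (end_walk s)"
  proof (unfold_locales, unfold sel set pop)
    fix x assume "x \<in> dom (arrows s) \<or> x \<in> F"
    then show "0 < nread s x" using F_sub nread_pos by blast
  next
    fix x assume "x \<in> F" "arrows s x = None"
    then show "fst (\<omega> (x, nread s x - 1)) \<le> threshold w (time s) x"
      using F_sub[of x] stop_top by auto
  next
    fix x assume "x \<in> F"
    then obtain r where r: "r \<in> frozen s" "r \<notin> dom (arrows s)" "(x, r) \<in> (Map.graph (arrows s))\<^sup>*"
      using frozen_root_graph[of x] unfolding F_def by blast
    from r(3) have "(x, r) \<in> {(a, b). a \<in> F \<and> arrows s a = Some b}\<^sup>*"
    proof (induction rule: converse_rtrancl_induct)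
      case (step y z)
      have "y \<in> F" using lead[of y r] step.hyps r(1) F_sup by (meson converse_rtrancl_into_rtrancl subsetD)
      then have "(y, z) \<in> {(a, b). a \<in> F \<and> arrows s a = Some b}" using step.hyps(1) by (auto dest: in_graphD)
      with step.IH show ?case by (rule converse_rtrancl_into_rtrancl[rotated])
    qed simp
    with r F_sup show "\<exists>r\<in>F. arrows s r = None \<and> (x, r) \<in> {(a, b). a \<in> F \<and> arrows s a = Some b}\<^sup>*"
      by (auto simp: domIff intro!: bexI[of _ r])
  next
    have "card (- F - tagged s) \<le> card (- frozen s - tagged s)" by (intro card_mono) (use F_sup in auto)
    with extra_bound show "extra s + card (- F - tagged s)
      \<le> (\<Sum>x\<in>UNIV. \<Sum>i<settled s x. unfreeze_cost w (1 / q0) \<omega> (x, i))" by linarith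
  next
    fix x assume "x \<in> tagged s" "x \<notin> F" "x \<in> dom (arrows s)"
    then have "x \<in> set us" using act F_sup by blast
    then have "(x, u) \<in> (Map.graph (arrows s))\<^sup>*"
      using successively_rtrancl[OF walk_path[unfolded walk], of x] by simp
    then show "x \<in> set (tl [])" using lead u F_sup \<open>x \<notin> F\<close> by blast
  next
    fix x y assume "arrows s x = Some y" "y \<in> F"
    then show "x \<in> F" using lead[of x y] by (auto intro: in_graphI)
  next
    fix x assume "x \<notin> tagged s" "x \<notin> F"
    then show "arrows s x = prev s x" using untagged F_sup by blast
  qed (use time_nonneg time_le arrow_top circ prev_root in auto)
  show "weight (end_walk s) = weight s" by (simp add: weight_def pop sel)
  show "arrows (end_walk s) = arrows s" "tagged (end_walk s) = tagged s" by (simp_all add: sel)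
  show "stage s < stage (end_walk s)" using u by (simp add: stage_def sel walk)
qed

text \<open>An untagged active node still carries its arrow of \<open>prev\<close>, so an extra read
  changes only the tag and the counter: one unit passes from the untagged nodes to
  \<open>extra\<close>. Reading a fresh entry raises \<open>weight\<close>.\<close>

lemma (in machine_state) machine_state_walk_step:
  assumes walk: "walk s = u # us"
  shows "machine_state w q0 \<omega> (walk_step w \<omega> u s) \<and> progress s < progress (walk_step w \<omega> u s)"
proof (cases "u \<in> frozen s")
  case True
  have act: "x \<in> set us" if "x \<in> tagged s" "x \<notin> frozen s" "x \<in> dom (arrows s)" for x
    using active_arrow[OF that] walk by simp
  have eq: "walk_step w \<omega> u s = end_walk s" using True by (simp add: walk_step_def)
  show ?thesis
    unfolding eq using machine_state_end_walk[OF walk True act] by (auto intro!: progress_less)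
next
  case unfrozen: False
  have u_us: "u \<notin> set us" using walk_distinct walk by simp
  have act: "x \<in> set us" if "x \<in> tagged s" "x \<notin> frozen s" "x \<in> dom (arrows s)" for x
    using active_arrow[OF that] walk by simp
  show ?thesis
  proof (cases "u \<notin> tagged s \<and> u \<in> dom (prev s)")
    case True
    then obtain v where v: "prev s u = Some v" by blast
    then have v': "arrows s u = Some v" using untagged True unfrozen by simp
    define s1 where "s1 = s\<lparr>extra := Suc (extra s), arrows := (arrows s)(u \<mapsto> v), tagged := insert u (tagged s)\<rparr>"
    have eq: "walk_step w \<omega> u s = move v s1"
      using True unfrozen v by (simp add: walk_step_def follow_def s1_def)
    have arr: "arrows s1 = arrows s" using v' by (auto simp: s1_def)
    have sel: "time s1 = time s" "prev s1 = prev s" "nread s1 = nread s" "frozen s1 = frozen s"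
      "tagged s1 = insert u (tagged s)" "walk s1 = walk s" "extra s1 = Suc (extra s)" by (simp_all add: s1_def)
    have pop: "popped s1 = popped s" "settled s1 = settled s"
      by (auto simp: popped_def settled_def arr sel fun_eq_iff)
    have "- frozen s - tagged s = insert u (- frozen s - insert u (tagged s))" using True unfrozen by auto
    then have "card (- frozen s - tagged s) = Suc (card (- frozen s - insert u (tagged s)))"
      by (simp add: card_insert_if)
    then interpret s1: forest_state w q0 \<omega> s1
    proof (unfold_locales, unfold pop arr sel)
      fix x assume "x \<in> frozen s"
      then show "\<exists>r\<in>frozen s. arrows s r = None \<and> (x, r) \<in> {(a, b). a \<in> frozen s \<and> arrows s a = Some b}\<^sup>*"
        by (rule frozen_root)
    next
      fix x show "\<exists>r. prev s r = None \<and> (x, r) \<in> (Map.graph (prev s))\<^sup>*" by (rule prev_root)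
    qed (use time_nonneg time_le nread_pos arrow_top stop_top circ untagged
          walk_distinct walk_path walk_tail extra_bound in auto)
    have mv: "machine_state w q0 \<omega> (move v s1)"
      "weight s1 < weight (move v s1) \<or> weight s1 = weight (move v s1) \<and> dom (arrows (move v s1)) = dom (arrows s1)"
      "tagged (move v s1) = tagged s1"
      using s1.machine_state_move[of u us v] act walk unfrozen v' by (auto simp: sel arr)
    moreover have "weight s1 = weight s" by (simp add: weight_def pop sel)
    moreover have "card (tagged s) < card (insert u (tagged s))" using True by (simp add: card_insert_if)
    ultimately show ?thesis unfolding eq by (intro conjI progress_less) (auto simp: arr sel)
  next
    case False
    then have read: "(u \<notin> tagged s \<and> u \<in> dom (prev s)) \<longleftrightarrow> False" by blast
    \<comment> \<open>A fresh entry is read only at a node without arrow: a tagged node with an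
      arrow would lie in the tail of the repetition-free walk, and an untagged one agrees with
      \<open>prev\<close>, where it is a root.\<close>
    have root: "u \<notin> dom (arrows s)"
    proof (cases "u \<in> tagged s")
      case True
      with act[of u] unfrozen u_us show ?thesis by blast
    next
      case False
      with \<open>\<not> (u \<notin> tagged s \<and> u \<in> dom (prev s))\<close> untagged[of u] unfrozen show ?thesis by (simp add: domIff)
    qed
    obtain U v where Uv: "\<omega> (u, nread s u) = (U, v)" by fastforce
    show ?thesis
    proof (cases "U < threshold w (time s) u")
      case True
      define s1 where "s1 = s\<lparr>nread := (nread s)(u := Suc (nread s u)), tagged := insert u (tagged s),
        frozen := insert u (frozen s)\<rparr>"
      have eq: "walk_step w \<omega> u s = end_walk s1"
        using unfrozen Uv True unfolding walk_step_def read by (simp add: s1_def)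
      have sel: "time s1 = time s" "prev s1 = prev s" "nread s1 = (nread s)(u := Suc (nread s u))"
        "frozen s1 = insert u (frozen s)" "arrows s1 = arrows s"
        "tagged s1 = insert u (tagged s)" "walk s1 = walk s" "extra s1 = extra s" by (simp_all add: s1_def)
      \<comment> \<open>The new entry adds one to \<open>nread\<close>, and freezing
        \<open>u\<close> as a root subtracts it again.\<close>
      have pop: "popped s1 = popped s" "settled s1 = settled s"
        using root unfrozen by (auto simp: popped_def settled_def sel fun_eq_iff)
      interpret s1: forest_state w q0 \<omega> s1
      proof (unfold_locales, unfold pop sel)
        fix x assume x: "x \<in> insert u (frozen s)"
        show "\<exists>r\<in>insert u (frozen s). arrows s r = None \<and>
          (x, r) \<in> {(a, b). a \<in> insert u (frozen s) \<and> arrows s a = Some b}\<^sup>*"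
        proof (cases "x = u")
          case True
          then show ?thesis using root by (auto simp: domIff)
        next
          case False
          then obtain r where r: "r \<in> frozen s" "arrows s r = None"
              "(x, r) \<in> {(a, b). a \<in> frozen s \<and> arrows s a = Some b}\<^sup>*"
            using frozen_root[of x] x by blast
          have "(x, r) \<in> {(a, b). a \<in> insert u (frozen s) \<and> arrows s a = Some b}\<^sup>*"
            by (rule subsetD[OF rtrancl_mono r(3)]) auto
          with r show ?thesis by blast
        qed
      next
        have "card (- insert u (frozen s) - insert u (tagged s)) \<le> card (- frozen s - tagged s)"
          by (intro card_mono) auto
        with extra_bound show "extra s + card (- insert u (frozen s) - insert u (tagged s))
          \<le> (\<Sum>x\<in>UNIV. \<Sum>i<settled s x. unfreeze_cost w (1 / q0) \<omega> (x, i))" by linarith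
      next
        fix x y assume "arrows s x = Some y"
        then show "interp w (time s) \<omega> (x, ((nread s)(u := Suc (nread s u))) x - 1) = Some y"
          using arrow_top root by auto
      next
        fix x assume "x \<in> insert u (frozen s)" "arrows s x = None"
        then show "fst (\<omega> (x, ((nread s)(u := Suc (nread s u))) x - 1)) \<le> threshold w (time s) x"
          using stop_top[of x] True Uv by auto
      next
        fix x assume "x \<in> set (tl (walk s))"
        then show "x \<in> insert u (tagged s) \<and> x \<notin> insert u (frozen s)"
          using walk_tail[of x] u_us walk by auto
      qed (use time_nonneg time_le nread_pos circ prev_root untagged walk_distinct walk_path in auto)
      have "weight s < weight s1"
        unfolding weight_def pop sel by (intro sum_strict_mono_ex1) auto
      then show ?thesis unfolding eq
        using s1.machine_state_end_walk[of u us] act walk by (auto simp: sel intro!: progress_less)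
    next
      case arrow: False
      define s1 where "s1 = s\<lparr>nread := (nread s)(u := Suc (nread s u)),
        arrows := (arrows s)(u \<mapsto> v), tagged := insert u (tagged s)\<rparr>"
      have eq: "walk_step w \<omega> u s = move v s1"
        using unfrozen Uv arrow unfolding walk_step_def read by (simp add: follow_def s1_def)
      have sel: "time s1 = time s" "prev s1 = prev s" "nread s1 = (nread s)(u := Suc (nread s u))"
        "frozen s1 = frozen s" "arrows s1 = (arrows s)(u \<mapsto> v)"
        "tagged s1 = insert u (tagged s)" "walk s1 = walk s" "extra s1 = extra s" by (simp_all add: s1_def)
      have pop: "popped s1 = popped s"
        using root unfrozen by (auto simp: popped_def sel fun_eq_iff)
      \<comment> \<open>The entry read as an arrow is settled at once; its charge only enlarges the
        budget.\<close>
      have set: "settled s \<le> settled s1"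
        using root unfrozen by (auto simp: settled_def sel le_fun_def)
      interpret s1: forest_state w q0 \<omega> s1
      proof (unfold_locales, unfold pop sel)
        fix x assume "x \<in> frozen s"
        have *: "{(a, b). a \<in> frozen s \<and> ((arrows s)(u \<mapsto> v)) a = Some b} = {(a, b). a \<in> frozen s \<and> arrows s a = Some b}"
          using unfrozen by (auto split: if_splits)
        show "\<exists>r\<in>frozen s. ((arrows s)(u \<mapsto> v)) r = None \<and>
          (x, r) \<in> {(a, b). a \<in> frozen s \<and> ((arrows s)(u \<mapsto> v)) a = Some b}\<^sup>*"
          unfolding * using frozen_root[OF \<open>x \<in> frozen s\<close>] unfrozen by fastforce
      next
        have "card (- frozen s - insert u (tagged s)) \<le> card (- frozen s - tagged s)"
          by (intro card_mono) auto
        moreover have "(\<Sum>x\<in>UNIV. \<Sum>i<settled s x. unfreeze_cost w (1 / q0) \<omega> (x, i))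
          \<le> (\<Sum>x\<in>UNIV. \<Sum>i<settled s1 x. unfreeze_cost w (1 / q0) \<omega> (x, i))"
          using set by (intro sum_mono sum_mono2) (auto simp: le_fun_def intro: less_le_trans)
        ultimately show "extra s + card (- frozen s - insert u (tagged s))
          \<le> (\<Sum>x\<in>UNIV. \<Sum>i<settled s1 x. unfreeze_cost w (1 / q0) \<omega> (x, i))"
          using extra_bound by linarith
      next
        fix x y assume "((arrows s)(u \<mapsto> v)) x = Some y"
        then show "interp w (time s) \<omega> (x, ((nread s)(u := Suc (nread s u))) x - 1) = Some y"
          using arrow_top[of x y] arrow Uv by (auto simp: interp_def split: if_splits)
      next
        fix x assume "x \<in> frozen s" "((arrows s)(u \<mapsto> v)) x = None"
        then show "fst (\<omega> (x, ((nread s)(u := Suc (nread s u))) x - 1)) \<le> threshold w (time s) x"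
          using stop_top[of x] by (auto split: if_splits)
      next
        show "successively (\<lambda>a b. ((arrows s)(u \<mapsto> v)) b = Some a) (walk s)"
          unfolding walk by (rule successively_arrows_cong[OF walk_path[unfolded walk]]) (use u_us in auto)
      next
        fix x assume "x \<in> dom ((arrows s)(u \<mapsto> v)) \<or> x \<in> frozen s"
        then show "0 < ((nread s)(u := Suc (nread s u))) x" using nread_pos[of x] by auto
      qed (use time_nonneg time_le circ prev_root untagged walk_distinct walk_tail in auto)
      have "weight s < weight s1"
        unfolding weight_def pop sel by (intro sum_strict_mono_ex1) auto
      moreover have "machine_state w q0 \<omega> (move v s1)"
        "weight s1 < weight (move v s1) \<or> weight s1 = weight (move v s1)"
        using s1.machine_state_move[of u us v] act walk unfrozen by (auto simp: sel)
      ultimately show ?thesis unfolding eq by (auto intro!: progress_less)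
    qed
  qed
qed

text \<open>An active root exists: between walks an active node with an arrow is untagged, so its
  arrow is that of \<open>prev\<close> and leads to another active node. Following
  \<open>prev\<close>, which ends in a root, must therefore meet an active node without
  arrow.\<close>

lemma (in machine_state) machine_state_new_walk:
  assumes walk: "walk s = []" and "frozen s \<noteq> UNIV" and c: "\<And>A. A \<noteq> {} \<Longrightarrow> c A \<in> A"
  defines "s' \<equiv> s\<lparr>walk := [c (- frozen s - dom (arrows s))]\<rparr>"
  shows "machine_state w q0 \<omega> s' \<and> progress s < progress s'"
proof -
  obtain v where v: "v \<notin> frozen s" using assms(2) by blast
  obtain r where r: "prev s r = None" "(v, r) \<in> (Map.graph (prev s))\<^sup>*" using prev_root by blast
  from r(2) v have "- frozen s - dom (arrows s) \<noteq> {}"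
  proof (induction rule: converse_rtrancl_induct)
    case base
    show ?case
    proof (cases "r \<in> tagged s")
      case True
      with active_arrow[of r] base walk show ?thesis by auto
    next
      case False
      with untagged[of r] base r(1) show ?thesis by auto
    qed
  next
    case (step y z)
    show ?case
    proof (cases "y \<in> dom (arrows s)")
      case True
      then have "y \<notin> tagged s" using active_arrow[of y] step.prems walk by auto
      then have "arrows s y = Some z" using untagged[of y] step.prems step.hyps by (auto dest: in_graphD)
      then have "z \<notin> frozen s" using idle_closed[OF walk] step.prems by blast
      then show ?thesis by (rule step.IH)
    qed (use step.prems in blast)
  qed
  then have "c (- frozen s - dom (arrows s)) \<in> - frozen s - dom (arrows s)" by (rule c)
  then obtain x where x: "x \<notin> frozen s" "s' = s\<lparr>walk := [x]\<rparr>" unfolding s'_def by blast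
  have pop: "popped s' = popped s" "settled s' = settled s"
    by (auto simp: x popped_def settled_def fun_eq_iff)
  have sel: "time s' = time s" "prev s' = prev s" "nread s' = nread s" "frozen s' = frozen s"
    "arrows s' = arrows s" "tagged s' = tagged s" "walk s' = [x]" "extra s' = extra s"
    by (simp_all add: x)
  have "machine_state w q0 \<omega> s'"
    by (unfold_locales, unfold pop sel)
      (use time_nonneg time_le nread_pos arrow_top stop_top circ frozen_root prev_root untagged extra_bound
        active_arrow[OF _ _ domI] walk in auto)
  moreover have "weight s' = weight s" by (simp add: weight_def pop sel)
  then have "progress s < progress s'"
    by (intro progress_less) (simp add: sel stage_def x walk)
  ultimately show ?thesis by blast
qed

text \<open>Moving the time to \<open>t\<close> keeps all arrows, and unfreezing \<open>x\<close>
  settles exactly one more entry, whose charge bounds the size of the tree that becomes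
  active.\<close>

lemma (in machine_state) machine_state_unfreeze:
  assumes walk: "walk s = []" and frozen: "frozen s = UNIV"
    and x: "unfreezes_at w \<omega> s x t" and least: "\<And>x' t'. unfreezes_at w \<omega> s x' t' \<Longrightarrow> t \<le> t'"
    and t: "t \<le> 1 / q0"
  shows "machine_state w q0 \<omega> (unfreeze \<omega> x t s) \<and> progress s < progress (unfreeze \<omega> x t s)"
proof -
  let ?i = "nread s x - 1"
  define v where "v = snd (\<omega> (x, ?i))"
  define C where "C = {v. (v, x) \<in> (Map.graph (arrows s))\<^sup>*}"
  define s1 where "s1 = s\<lparr>time := t, prev := arrows s, frozen := - C, walk := [x],
    arrows := (arrows s)(x \<mapsto> v), tagged := {x}\<rparr>"
  have eq: "unfreeze \<omega> x t s = move v s1"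
    by (simp add: unfreeze_def follow_def s1_def v_def C_def)
  have sel: "time s1 = t" "prev s1 = arrows s" "nread s1 = nread s"
    "frozen s1 = - C" "arrows s1 = (arrows s)(x \<mapsto> v)"
    "tagged s1 = {x}" "walk s1 = [x]" "extra s1 = extra s" by (simp_all add: s1_def)
  have x_root: "x \<notin> dom (arrows s)" and t0: "0 \<le> t" and x_mark: "threshold w t x = fst (\<omega> (x, ?i))"
    using x by (auto simp: unfreezes_at_def)
  have x_w: "0 < node_weight w x" and x_t: "t = unfreeze_time w x (fst (\<omega> (x, ?i)))"
    using x by (auto simp: unfreezes_at_iff)
  have npos: "0 < nread s y" for y using nread_pos frozen by auto
  \<comment> \<open>The entry was still a stop, or just on the threshold, at the previous time, so
    time does not run backwards.\<close>
  have "fst (\<omega> (x, ?i)) \<le> threshold w (time s) x" using stop_top[of x] frozen x_root by auto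
  then have time_t: "time s \<le> t"
    using mark_le_threshold_iff[OF x_w time_nonneg, of "(x, ?i)"] x_t by simp
  have pers: "interp w t \<omega> e = Some y" if "interp w (time s) \<omega> e = Some y" for e y
    using interp_mono[OF that time_nonneg time_t] .
  have circ_t: "circulation (interp w t \<omega>) (popped s)"
    using interp_circulation_mono[OF circ time_nonneg time_t] .
  have C_dom: "y \<in> dom (arrows s) \<or> y = x" if "y \<in> C" for y
    using that graph_rtrancl_dom[of y x "arrows s"] unfolding C_def by blast
  have xC: "x \<in> C" by (simp add: C_def)
  have pop: "popped s1 = popped s"
    using C_dom frozen by (auto simp: popped_def sel fun_eq_iff)
  have set: "settled s1 = (settled s)(x := Suc (settled s x))"
    using C_dom frozen x_root npos xC by (auto simp: settled_def sel fun_eq_iff)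
  have setx: "settled s x = ?i" "popped s x = ?i"
    using frozen x_root by (auto simp: settled_def popped_def)
  have cost: "card C \<le> unfreeze_cost w (1 / q0) \<omega> (x, ?i)"
  proof -
    \<comment> \<open>\<open>popped s\<close> is the circulation that witnesses
      \<open>reaches\<close>: the tree of \<open>x\<close> consists of top arrows and never uses an
      arrow of \<open>x\<close>.\<close>
    have "C \<subseteq> {v. reaches (interp w t \<omega>) x ?i v}"
    proof
      fix y assume "y \<in> C"
      then have y: "(y, x) \<in> (Map.graph (arrows s))\<^sup>*" by (simp add: C_def)
      have "(y, x) \<in> {(a, b). a \<noteq> x \<and> interp w t \<omega> (a, popped s a) = Some b}\<^sup>*"
      proof (rule subsetD[OF rtrancl_mono y], clarify)
        fix a b assume "(a, b) \<in> Map.graph (arrows s)"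
        then have "arrows s a = Some b" by (rule in_graphD)
        then show "a \<noteq> x \<and> interp w t \<omega> (a, popped s a) = Some b"
          using pers[OF arrow_top] x_root by (auto simp: popped_def)
      qed
      then show "y \<in> {v. reaches (interp w t \<omega>) x ?i v}"
        unfolding reaches_def using circ_t setx by blast
    qed
    moreover have "threshold w (1 / q0) x \<le> fst (\<omega> (x, ?i))"
      using threshold_antimono[OF t0 t, of x] x_mark by simp
    then have "unfreeze_cost w (1 / q0) \<omega> (x, ?i) = card {v. reaches (interp w t \<omega>) x ?i v}"
      by (simp add: unfreeze_cost_def tree_size_def x_t)
    ultimately show ?thesis by (simp add: card_mono)
  qed
  interpret s1: forest_state w q0 \<omega> s1
  proof (unfold_locales, unfold pop sel)
    fix y z assume yz: "((arrows s)(x \<mapsto> v)) y = Some z"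
    show "interp w t \<omega> (y, nread s y - 1) = Some z"
    proof (cases "y = x")
      case True
      then show ?thesis using yz x_mark by (simp add: interp_def v_def)
    next
      case False
      then show ?thesis using yz pers[OF arrow_top, of y z] by simp
    qed
  next
    fix y assume y: "y \<in> - C" "((arrows s)(x \<mapsto> v)) y = None"
    then have y': "y \<notin> dom (arrows s)" by (auto split: if_splits)
    show "fst (\<omega> (y, nread s y - 1)) \<le> threshold w t y"
    proof (cases "0 < node_weight w y")
      case True
      \<comment> \<open>By minimality of \<open>t\<close>, the stop of any other root lasts at least
        until \<open>t\<close>.\<close>
      then have "unfreezes_at w \<omega> s y (unfreeze_time w y (fst (\<omega> (y, nread s y - 1))))"
        using y' by (simp add: unfreezes_at_iff)
      from least[OF this] show ?thesis using mark_le_threshold_iff[OF True t0] by simp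
    next
      case False
      then have "node_weight w y = 0" using node_weight_ge_0[of y] by simp
      then show ?thesis using mark_less_1[of "(y, nread s y - 1)"] by (simp add: threshold_def)
    qed
  next
    fix y assume y: "y \<in> - C"
    obtain r where r: "r \<notin> dom (arrows s)" "(y, r) \<in> (Map.graph (arrows s))\<^sup>*"
      using frozen_root_graph[of y] frozen by blast
    have "r \<noteq> x" using r(2) y by (auto simp: C_def)
    then have rC: "r \<notin> C" using C_dom r(1) by blast
    \<comment> \<open>Backwards along the path: each node has a single arrow, so a node of
      \<open>C\<close> other than \<open>x\<close> steps inside \<open>C\<close>, and a path that
      ends outside never met \<open>C\<close>.\<close>
    from r(2) have "y \<notin> C \<and> (y, r) \<in> {(a, b). a \<in> - C \<and> ((arrows s)(x \<mapsto> v)) a = Some b}\<^sup>*"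
    proof (induction rule: converse_rtrancl_induct)
      case (step a b)
      have ab: "arrows s a = Some b" using step.hyps(1) by (rule in_graphD)
      have "a \<notin> C"
      proof
        assume "a \<in> C"
        then have "(a, x) \<in> (Map.graph (arrows s))\<^sup>*" by (simp add: C_def)
        then show False
        proof (cases rule: converse_rtranclE)
          case base
          with ab x_root show False by auto
        next
          case (step b')
          then have "b' = b" using ab in_graphD[OF step(1)] by simp
          with step(2) \<open>b \<notin> C \<and> _\<close> show False by (simp add: C_def)
        qed
      qed
      moreover have "a \<noteq> x" using \<open>a \<notin> C\<close> xC by blast
      ultimately have "(a, b) \<in> {(a, b). a \<in> - C \<and> ((arrows s)(x \<mapsto> v)) a = Some b}" using ab by simp
      with step.IH \<open>a \<notin> C\<close> show ?case by (meson converse_rtrancl_into_rtrancl)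
    qed (use rC in simp)
    then show "\<exists>r\<in>- C. ((arrows s)(x \<mapsto> v)) r = None \<and>
        (y, r) \<in> {(a, b). a \<in> - C \<and> ((arrows s)(x \<mapsto> v)) a = Some b}\<^sup>*"
      using rC r(1) \<open>r \<noteq> x\<close> by (auto simp: domIff intro!: bexI[of _ r])
  next
    fix y show "\<exists>r. arrows s r = None \<and> (y, r) \<in> (Map.graph (arrows s))\<^sup>*"
      using frozen_root_graph[of y] frozen by (metis UNIV_I domIff)
  next
    have "(\<Sum>y\<in>UNIV. \<Sum>i<settled s1 y. unfreeze_cost w (1 / q0) \<omega> (y, i)) =
      (\<Sum>y\<in>UNIV. (\<Sum>i<settled s y. unfreeze_cost w (1 / q0) \<omega> (y, i)) +
         (if y = x then unfreeze_cost w (1 / q0) \<omega> (x, ?i) else 0))"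
      by (intro sum.cong refl) (auto simp: set setx)
    also have "\<dots> = (\<Sum>y\<in>UNIV. \<Sum>i<settled s y. unfreeze_cost w (1 / q0) \<omega> (y, i))
        + unfreeze_cost w (1 / q0) \<omega> (x, ?i)"
      by (simp add: sum.distrib)
    finally have eq: "(\<Sum>y\<in>UNIV. \<Sum>i<settled s1 y. unfreeze_cost w (1 / q0) \<omega> (y, i)) =
      (\<Sum>y\<in>UNIV. \<Sum>i<settled s y. unfreeze_cost w (1 / q0) \<omega> (y, i)) + unfreeze_cost w (1 / q0) \<omega> (x, ?i)" .
    have "card (- (- C) - {x}) \<le> card C" by (intro card_mono) auto
    with cost extra_bound show "extra s + card (- (- C) - {x}) \<le>
       (\<Sum>y\<in>UNIV. \<Sum>i<settled s1 y. unfreeze_cost w (1 / q0) \<omega> (y, i))"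
      unfolding eq by linarith
  qed (use t0 t npos circ_t in auto)
  have "card (dom (arrows s)) < card (dom (arrows s1))"
    using x_root by (simp add: sel card_insert_if)
  moreover have "weight s1 = weight s" by (simp add: weight_def pop sel)
  moreover have "machine_state w q0 \<omega> (move v s1)"
    "weight s1 < weight (move v s1) \<or> weight s1 = weight (move v s1) \<and>
      dom (arrows (move v s1)) = dom (arrows s1)"
    using s1.machine_state_move[of x "[]" v] xC by (auto simp: sel)
  ultimately show ?thesis unfolding eq by (auto intro!: progress_less)
qed

section \<open>Comparison with the odometer, and termination\<close>

definition finished :: "('a::finite \<Rightarrow> 'a \<Rightarrow> real) \<Rightarrow> real \<Rightarrow> 'a stacks \<Rightarrow> 'a state \<Rightarrow> bool" where
  "finished w q0 \<omega> s \<longleftrightarrow> walk s = [] \<and> frozen s = UNIV \<and> \<not> (\<exists>t\<le>1 / q0. \<exists>x. unfreezes_at w \<omega> s x t)"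

lemma (in machine_state) machine_state_step:
  assumes c: "\<And>A. A \<noteq> {} \<Longrightarrow> c A \<in> A"
  shows "machine_state w q0 \<omega> (step w q0 c \<omega> s)"
    and "progress s < progress (step w q0 c \<omega> s) \<or> finished w q0 \<omega> s"
proof -
  have "machine_state w q0 \<omega> (step w q0 c \<omega> s) \<and> (progress s < progress (step w q0 c \<omega> s) \<or> finished w q0 \<omega> s)"
  proof (cases "walk s")
    case (Cons u us)
    then show ?thesis using machine_state_walk_step[OF Cons] by (simp add: step_def)
  next
    case walk: Nil
    show ?thesis
    proof (cases "frozen s = UNIV")
      case False
      then show ?thesis using machine_state_new_walk[OF walk False c] walk by (simp add: step_def)
    next
      case frozen: True
      show ?thesis
      proof (cases "\<exists>t\<le>1 / q0. \<exists>x. unfreezes_at w \<omega> s x t")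
        case False
        then have "step w q0 c \<omega> s = s" using walk frozen by (auto simp: step_def)
        then show ?thesis using False walk frozen machine_state_axioms by (simp add: finished_def)
      next
        case True
        then obtain t0 x0 where 0: "t0 \<le> 1 / q0" "unfreezes_at w \<omega> s x0 t0" by blast
        define t where "t = (LEAST t. \<exists>x. unfreezes_at w \<omega> s x t)"
        define x where "x = c {x. unfreezes_at w \<omega> s x t}"
        note least = least_unfreezing[OF 0(2), folded t_def]
        have "x \<in> {x. unfreezes_at w \<omega> s x t}" unfolding x_def using least(1) by (intro c) auto
        then have x: "unfreezes_at w \<omega> s x t" by simp
        have "step w q0 c \<omega> s = unfreeze \<omega> x t s"
          using walk frozen True by (simp add: step_def t_def x_def Let_def)
        then show ?thesis
          using machine_state_unfreeze[OF walk frozen x least(2)] least(2)[OF 0(2)] 0(1) by auto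
      qed
    qed
  qed
  then show "machine_state w q0 \<omega> (step w q0 c \<omega> s)"
    and "progress s < progress (step w q0 c \<omega> s) \<or> finished w q0 \<omega> s" by blast+
qed

context marked_stacks begin

lemma machine_state_init: "machine_state w q0 \<omega> init"
proof -
  have sel: "time init = 0" "prev init = Map.empty" "nread init = (\<lambda>x. 1)"
    "frozen init = UNIV" "arrows init = Map.empty" "tagged init = {}" "walk init = []" "extra init = 0"
    by (simp_all add: init_def)
  have pop: "popped init = (\<lambda>x. 0)" by (auto simp: popped_def init_def)
  show ?thesis
    by (unfold_locales, unfold pop sel)
      (use q0 mark_less_1 in \<open>auto simp: circulation_def inflow_def threshold_def less_imp_le\<close>)
qed

lemma machine_state_run:
  assumes c: "\<And>k A. A \<noteq> {} \<Longrightarrow> pick \<omega> k A \<in> A"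
  shows "machine_state w q0 \<omega> (run w q0 pick \<omega> k)"
proof (induction k)
  case (Suc k)
  then interpret machine_state w q0 \<omega> "run w q0 pick \<omega> k" .
  show ?case using machine_state_step(1)[of "pick \<omega> k"] c by simp
qed (simp add: machine_state_init)

end

text \<open>\<open>popped s\<close> remains a circulation at \<open>1 / q0\<close> and hence is
  smaller than the odometer at \<open>x\<close>; \<open>nread\<close> exceeds it by at most one.
  This holds at every step, finished or not.\<close>

lemma (in machine_state) nread_le_odometer:
  assumes B: "\<And>k y. odometer (interp w (1 / q0) \<omega>) x k y \<le> B"
  shows "\<exists>k. nread s x \<le> odometer (interp w (1 / q0) \<omega>) x k x"
proof -
  obtain k where k: "odometer (interp w (1 / q0) \<omega>) x (Suc k) = odometer (interp w (1 / q0) \<omega>) x k"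
    using odometer_stable[of "interp w (1 / q0) \<omega>" x B] B by blast
  have "popped s x < odometer (interp w (1 / q0) \<omega>) x k x"
    using circulation_less_odometer[OF interp_circulation_mono[OF circ time_nonneg time_le] k] .
  then show ?thesis by (intro exI[of _ k]) (auto simp: popped_def split: if_splits)
qed

text \<open>In a finished state the path from \<open>x\<close> in the forest ends at an entry that
  is a stop at \<open>1 / q0\<close> too, so \<open>popped s\<close> plus that path dominates the
  odometer.\<close>

lemma (in machine_state) odometer_le_nread:
  assumes "finished w q0 \<omega> s"
  shows "odometer (interp w (1 / q0) \<omega>) x k x \<le> nread s x"
proof -
  let ?\<zeta> = "interp w (1 / q0) \<omega>"
  have frozen: "frozen s = UNIV" and none: "\<And>x t. unfreezes_at w \<omega> s x t \<Longrightarrow> 1 / q0 < t"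
    using assms by (auto simp: finished_def not_le)
  have pop: "popped s y = nread s y - 1" "0 < nread s y" for y
    using frozen nread_pos[of y] by (auto simp: popped_def)
  have circ': "circulation ?\<zeta> (popped s)" using interp_circulation_mono[OF circ time_nonneg time_le] .
  obtain r where r: "r \<notin> dom (arrows s)" "(x, r) \<in> (Map.graph (arrows s))\<^sup>*"
    using frozen_root_graph[of x] frozen by blast
  have "(x, r) \<in> (top_graph ?\<zeta> (popped s))\<^sup>*"
  proof (rule subsetD[OF rtrancl_mono r(2)], clarify)
    fix a b assume "(a, b) \<in> Map.graph (arrows s)"
    then have "interp w (time s) \<omega> (a, nread s a - 1) = Some b" using arrow_top in_graphD by metis
    then show "(a, b) \<in> top_graph ?\<zeta> (popped s)"
      using interp_mono[OF _ time_nonneg time_le] by (simp add: top_graph_def pop)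
  qed
  moreover have "?\<zeta> (r, popped s r) = None"
  proof -
    let ?e = "(r, nread s r - 1)"
    \<comment> \<open>An unfreezing time strictly beyond \<open>1 / q0\<close> rules out
      equality.\<close>
    have "fst (\<omega> ?e) < threshold w (1 / q0) r"
    proof (cases "0 < node_weight w r")
      case True
      then have "1 / q0 < unfreeze_time w r (fst (\<omega> ?e))"
        using none r(1) by (simp add: unfreezes_at_iff)
      moreover have "0 \<le> 1 / q0" using q0 by simp
      ultimately show ?thesis
        using True mark_le_threshold_iff[OF True, of "1 / q0" ?e] threshold_eq_mark[of "1 / q0" r ?e] by fastforce
    next
      case False
      then have "node_weight w r = 0" using node_weight_ge_0[of r] by simp
      then show ?thesis using mark_less_1[of ?e] by (simp add: threshold_def)
    qed
    then show ?thesis by (simp add: interp_def pop)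
  qed
  ultimately have "odometer ?\<zeta> x k x \<le> Suc (popped s x)"
    by (intro odometer_le_Suc_circulation[OF circ'])
  then show ?thesis using pop by simp
qed

context marked_stacks begin

lemma run_finishes:
  assumes c: "\<And>k A. A \<noteq> {} \<Longrightarrow> pick \<omega> k A \<in> A"
    and B: "\<And>x k y. odometer (interp w (1 / q0) \<omega>) x k y \<le> B"
  shows "\<exists>k. finished w q0 \<omega> (run w q0 pick \<omega> k)"
proof (rule ccontr)
  assume not: "\<nexists>k. finished w q0 \<omega> (run w q0 pick \<omega> k)"
  let ?s = "run w q0 pick \<omega>"
  let ?n = "CARD('a)"
  have le: "k \<le> progress (?s k)" for k
  proof (induction k)
    case (Suc k)
    interpret machine_state w q0 \<omega> "?s k" using c by (rule machine_state_run)
    have "progress (?s k) < progress (?s (Suc k))" using machine_state_step(2)[of "pick \<omega> k"] c not by auto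
    with Suc show ?case by linarith
  qed simp
  \<comment> \<open>This is \<open>progress\<close> at the largest possible digits, with
    \<open>nread\<close> and \<open>popped\<close> at most \<open>B\<close> at each node.\<close>
  have "progress (?s k) \<le> ((?n * (2 * B) * Suc ?n + ?n) * Suc ?n + ?n) * 3 + 2" for k
  proof -
    interpret machine_state w q0 \<omega> "?s k" using c by (rule machine_state_run)
    have "nread (?s k) x + popped (?s k) x \<le> 2 * B" for x
    proof -
      have "nread (?s k) x \<le> B" using nread_le_odometer[of x B] B by (meson le_trans)
      then show ?thesis by (auto simp: popped_def)
    qed
    then have "weight (?s k) \<le> ?n * (2 * B)"
      unfolding weight_def using sum_bounded_above[of UNIV "\<lambda>x. nread (?s k) x + popped (?s k) x" "2 * B"] by simp
    moreover have "stage (?s k) \<le> 2" by (auto simp: stage_def split: list.split)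
    ultimately show ?thesis
      unfolding progress_def by (intro add_mono mult_le_mono card_le_CARD) auto
  qed
  with le show False by (meson Suc_n_not_le_n le_trans)
qed

lemma sampled_arrows_eq:
  assumes c: "\<And>k A. A \<noteq> {} \<Longrightarrow> pick \<omega> k A \<in> A"
    and B: "\<And>x k y. odometer (interp w (1 / q0) \<omega>) x k y \<le> B"
  shows "sampled_arrows w q0 pick \<omega> = (\<Sum>x\<in>UNIV. SUP k. of_nat (odometer (interp w (1 / q0) \<omega>) x k x))"
proof (rule antisym)
  let ?\<zeta> = "interp w (1 / q0) \<omega>"
  show "sampled_arrows w q0 pick \<omega> \<le> (\<Sum>x\<in>UNIV. SUP k. of_nat (odometer ?\<zeta> x k x))"
    unfolding sampled_arrows_def
  proof (rule SUP_least)
    fix k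
    interpret machine_state w q0 \<omega> "run w q0 pick \<omega> k" using c by (rule machine_state_run)
    have "of_nat (nread (run w q0 pick \<omega> k) x) \<le> (SUP k. of_nat (odometer ?\<zeta> x k x) :: ennreal)" for x
      using nread_le_odometer[of x B] B by (auto intro!: SUP_upper2)
    then show "of_nat (\<Sum>x\<in>UNIV. nread (run w q0 pick \<omega> k) x) \<le> (\<Sum>x\<in>UNIV. SUP k. of_nat (odometer ?\<zeta> x k x) :: ennreal)"
      by (simp add: sum_mono)
  qed
  obtain k where k: "finished w q0 \<omega> (run w q0 pick \<omega> k)" using run_finishes[of pick B] c B by blast
  interpret machine_state w q0 \<omega> "run w q0 pick \<omega> k" using c by (rule machine_state_run)
  have "(\<Sum>x\<in>UNIV. SUP k. of_nat (odometer ?\<zeta> x k x)) \<le> (\<Sum>x\<in>UNIV. of_nat (nread (run w q0 pick \<omega> k) x) :: ennreal)"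
    using odometer_le_nread[OF k] by (intro sum_mono SUP_least) auto
  also have "\<dots> \<le> sampled_arrows w q0 pick \<omega>"
    unfolding sampled_arrows_def by (intro SUP_upper2[of k]) auto
  finally show "(\<Sum>x\<in>UNIV. SUP k. of_nat (odometer ?\<zeta> x k x)) \<le> sampled_arrows w q0 pick \<omega>" .
qed

text \<open>The budget of \<open>extra_bound\<close> is extended to all entries of the stacks, which
  removes its dependence on the run.\<close>

lemma extra_reads_le:
  assumes c: "\<And>k A. A \<noteq> {} \<Longrightarrow> pick \<omega> k A \<in> A"
  shows "extra_reads w q0 pick \<omega> \<le> (\<Sum>x\<in>UNIV. \<Sum>i. of_nat (unfreeze_cost w (1 / q0) \<omega> (x, i)))"
  unfolding extra_reads_def
proof (rule SUP_least)
  fix k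
  interpret machine_state w q0 \<omega> "run w q0 pick \<omega> k" using c by (rule machine_state_run)
  have "of_nat (extra (run w q0 pick \<omega> k)) \<le>
    (of_nat (\<Sum>x\<in>UNIV. \<Sum>i<settled (run w q0 pick \<omega> k) x. unfreeze_cost w (1 / q0) \<omega> (x, i)) :: ennreal)"
    using extra_bound by (subst of_nat_le_iff) linarith
  also have "\<dots> = (\<Sum>x\<in>UNIV. \<Sum>i<settled (run w q0 pick \<omega> k) x. of_nat (unfreeze_cost w (1 / q0) \<omega> (x, i)))"
    by simp
  also have "\<dots> \<le> (\<Sum>x\<in>UNIV. \<Sum>i. of_nat (unfreeze_cost w (1 / q0) \<omega> (x, i)))"
    by (intro sum_mono sum_le_suminf) auto
  finally show "of_nat (extra (run w q0 pick \<omega> k)) \<le> (\<Sum>x\<in>UNIV. \<Sum>i. of_nat (unfreeze_cost w (1 / q0) \<omega> (x, i)) :: ennreal)" .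
qed

end

section \<open>Random stacks\<close>

definition entry_space :: "('a::finite \<Rightarrow> 'a \<Rightarrow> real) \<Rightarrow> 'a \<times> nat \<Rightarrow> (real \<times> 'a) measure" where
  "entry_space w e = uniform_measure lborel {0..1} \<Otimes>\<^sub>M measure_pmf (arrow_pmf w (fst e))"

lemma stack_space_eq: "stack_space w = PiM UNIV (entry_space w)"
  by (simp add: stack_space_def entry_space_def[abs_def] case_prod_beta')

lemma prob_space_unit_interval: "prob_space (uniform_measure lborel {0..1::real})"
  by (rule prob_space_uniform_measure) auto

lemma prob_space_entry_space: "prob_space (entry_space w e)"
  unfolding entry_space_def
  by (intro prob_space_pair prob_space_unit_interval measure_pmf.prob_space_axioms)

lemma prob_space_stack_space: "prob_space (stack_space w)"
  unfolding stack_space_eq by (intro prob_space_PiM prob_space_entry_space)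

lemma sets_entry_space [measurable_cong]:
  "sets (entry_space w e) = sets (borel \<Otimes>\<^sub>M count_space UNIV)"
  unfolding entry_space_def by (intro sets_pair_measure_cong) auto

lemma space_stack_space [simp]: "space (stack_space w) = UNIV"
  by (auto simp: stack_space_eq space_PiM entry_space_def space_pair_measure)

lemma measurable_entry: "(\<lambda>\<omega>. \<omega> e) \<in> measurable (stack_space w) (borel \<Otimes>\<^sub>M count_space UNIV)"
proof -
  have "(\<lambda>\<omega>. \<omega> e) \<in> measurable (stack_space w) (entry_space w e)"
    unfolding stack_space_eq by (intro measurable_component_singleton) simp
  then show ?thesis by (simp cong: measurable_cong_sets add: sets_entry_space)
qed

lemma measurable_mark [measurable]: "(\<lambda>\<omega>. fst (\<omega> e)) \<in> borel_measurable (stack_space w)"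
  using measurable_compose[OF measurable_entry measurable_fst] .

lemma measurable_arrow [measurable]: "(\<lambda>\<omega>. snd (\<omega> e)) \<in> measurable (stack_space w) (count_space UNIV)"
  using measurable_compose[OF measurable_entry measurable_snd] .

text \<open>Functions from a finite to a countable type form a countable discrete space, so equality
  with a given one is a finite conjunction.\<close>

lemma measurable_finite_fun:
  fixes f :: "'b \<Rightarrow> 'a::finite \<Rightarrow> 'c::countable"
  assumes "\<And>y. (\<lambda>\<omega>. f \<omega> y) \<in> measurable M (count_space UNIV)"
  shows "f \<in> measurable M (count_space UNIV)"
  unfolding measurable_count_space_eq2_countable
proof (intro conjI ballI)
  fix a :: "'a \<Rightarrow> 'c"
  have [measurable]: "Measurable.pred M (\<lambda>\<omega>. f \<omega> y = a y)" for y
    by (rule measurable_compose[OF assms]) simp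
  have "f -` {a} \<inter> space M = {\<omega>\<in>space M. \<forall>y. f \<omega> y = a y}" by auto
  then show "f -` {a} \<inter> space M \<in> sets M" by simp
qed auto

lemma measurable_countable_op:
  fixes f :: "'b \<Rightarrow> 'c::countable" and g :: "'b \<Rightarrow> 'd::countable"
  assumes "f \<in> measurable M (count_space UNIV)" "g \<in> measurable M (count_space UNIV)"
  shows "(\<lambda>x. h (f x) (g x)) \<in> measurable M (count_space UNIV)"
  by (rule measurable_compose_countable[OF _ assms(1)], rule measurable_compose[OF assms(2)]) simp

lemma measurable_sum_count_space:
  fixes f :: "'i \<Rightarrow> 'b \<Rightarrow> nat"
  assumes "finite A" "\<And>i. f i \<in> measurable M (count_space UNIV)"
  shows "(\<lambda>x. \<Sum>i\<in>A. f i x) \<in> measurable M (count_space UNIV)"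
  using assms(1)
  by (induction A rule: finite_induct) (auto intro!: measurable_countable_op[where h = "(+)"] assms(2))

lemma measurable_interp [measurable]:
  assumes [measurable]: "f \<in> borel_measurable N" "g \<in> measurable N (stack_space w)"
  shows "(\<lambda>x. interp w (f x) (g x) e) \<in> measurable N (count_space UNIV)"
proof -
  have [measurable]: "(\<lambda>x. fst (g x e)) \<in> borel_measurable N"
    using measurable_compose[OF assms(2) measurable_mark] .
  have [measurable]: "(\<lambda>x. snd (g x e)) \<in> measurable N (count_space UNIV)"
    using measurable_compose[OF assms(2) measurable_arrow] .
  have "(\<lambda>x. Some (snd (g x e))) \<in> measurable N (count_space UNIV)"
    by (rule measurable_compose[where g = Some and N = "count_space UNIV"]) auto
  then show ?thesis unfolding interp_def threshold_def by measurable
qed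

lemma measurable_inflow:
  assumes \<zeta>: "\<And>e. (\<lambda>x. \<zeta> x e) \<in> measurable N (count_space UNIV)"
  shows "(\<lambda>x. inflow (\<zeta> x) h y) \<in> measurable N (count_space UNIV)"
  unfolding inflow_def
proof (rule measurable_sum_count_space)
  fix z
  have [measurable]: "Measurable.pred N (\<lambda>x. \<zeta> x (z, i) = Some y)" for i
    by (rule measurable_compose[OF \<zeta>]) simp
  show "(\<lambda>x. card {i. i < h z \<and> \<zeta> x (z, i) = Some y}) \<in> measurable N (count_space UNIV)"
    by (rule measurable_card) simp
qed simp

text \<open>Split by the countably many values \<open>h\<close> of the previous round; for fixed
  \<open>h\<close> the next round depends on finitely many entries.\<close>

lemma measurable_odometer:
  assumes \<zeta>: "\<And>e. (\<lambda>x. \<zeta> x e) \<in> measurable N (count_space UNIV)"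
  shows "(\<lambda>\<omega>. odometer (\<zeta> \<omega>) x k) \<in> measurable N (count_space UNIV)"
proof (induction k)
  case (Suc k)
  have "(\<lambda>\<omega>. (\<lambda>y. (if y = x then 1 else 0) + inflow (\<zeta> \<omega>) h y)) \<in> measurable N (count_space UNIV)" for h
    by (intro measurable_finite_fun measurable_countable_op[where h = "(+)"] measurable_inflow \<zeta>) simp
  from measurable_compose_countable[OF this Suc] show ?case by simp
qed simp

text \<open>The existential ranges over the countably many functions from nodes to naturals.\<close>

lemma measurable_reaches:
  assumes \<zeta>: "\<And>e. (\<lambda>x. \<zeta> x e) \<in> measurable N (count_space UNIV)"
  shows "Measurable.pred N (\<lambda>\<omega>. reaches (\<zeta> \<omega>) x i v)"
proof -
  have [measurable]: "Measurable.pred N (\<lambda>\<omega>. circulation (\<zeta> \<omega>) c)" for c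
  proof -
    have [measurable]: "Measurable.pred N (\<lambda>\<omega>. \<zeta> \<omega> (y, j) \<noteq> None)" for y j
      by (rule measurable_compose[OF \<zeta>]) simp
    have [measurable]: "Measurable.pred N (\<lambda>\<omega>. inflow (\<zeta> \<omega>) c y = c y)" for y
      by (rule measurable_compose[OF measurable_inflow[OF \<zeta>]]) simp
    show ?thesis unfolding circulation_def by measurable
  qed
  have [measurable]: "Measurable.pred N (\<lambda>\<omega>. (v, x) \<in> {(a, b). a \<noteq> x \<and> \<zeta> \<omega> (a, c a) = Some b}\<^sup>*)" for c
  proof -
    have "(\<lambda>\<omega> a. \<zeta> \<omega> (a, c a)) \<in> measurable N (count_space UNIV)"
      by (intro measurable_finite_fun \<zeta>)
    from measurable_compose[OF this, of "\<lambda>F. (v, x) \<in> {(a, b). a \<noteq> x \<and> F a = Some b}\<^sup>*" "count_space UNIV"]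
    show ?thesis by simp
  qed
  show ?thesis unfolding reaches_def by measurable
qed

lemma of_nat_tree_size:
  "of_nat (tree_size w \<omega> e t) = (\<Sum>v\<in>UNIV. if reaches (interp w t \<omega>) (fst e) (snd e) v then 1 else 0 :: ennreal)"
  unfolding tree_size_def by (simp add: sum.If_cases)

lemma measurable_tree_size [measurable]:
  assumes [measurable]: "f \<in> borel_measurable N" "g \<in> measurable N (stack_space w)"
  shows "(\<lambda>x. of_nat (tree_size w (g x) e (f x)) :: ennreal) \<in> borel_measurable N"
proof -
  have [measurable]: "Measurable.pred N (\<lambda>x. reaches (interp w (f x) (g x)) (fst e) (snd e) v)" for v
    by (rule measurable_reaches) measurable
  show ?thesis unfolding of_nat_tree_size by measurable
qed

lemma tree_size_upd: "tree_size w (fun_upd \<omega> e v) e t = tree_size w \<omega> e t"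
proof -
  have eq: "interp w t (fun_upd \<omega> e v) = (interp w t \<omega>)((fst e, snd e) := interp w t (fun_upd \<omega> e v) e)"
    by (cases e) (auto simp: interp_def fun_eq_iff)
  show ?thesis unfolding tree_size_def by (subst eq, intro arg_cong[where f = card] Collect_cong reaches_upd)
qed

section \<open>Resampling one entry\<close>

lemma measurable_resample [measurable]:
  "(\<lambda>(v, \<omega>). fun_upd \<omega> e v) \<in> measurable (entry_space w e \<Otimes>\<^sub>M stack_space w) (stack_space w)"
  unfolding stack_space_eq split_beta' by (rule measurable_fun_upd[where J = UNIV]) auto

text \<open>The product measure is invariant when one coordinate is replaced by an independent
  copy.\<close>

lemma nn_integral_resample:
  assumes F [measurable]: "F \<in> borel_measurable (stack_space w)"
  shows "(\<integral>\<^sup>+\<omega>. F \<omega> \<partial>stack_space w) = (\<integral>\<^sup>+\<omega>. \<integral>\<^sup>+v. F (fun_upd \<omega> e v) \<partial>entry_space w e \<partial>stack_space w)"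
proof -
  interpret E: prob_space "entry_space w e" by (rule prob_space_entry_space)
  interpret P: prob_space "stack_space w" by (rule prob_space_stack_space)
  interpret pair_sigma_finite "entry_space w e" "stack_space w" ..
  have distr: "distr (entry_space w e \<Otimes>\<^sub>M stack_space w) (stack_space w) (\<lambda>(v, \<omega>). fun_upd \<omega> e v) = stack_space w"
    using distr_pair_PiM_eq_PiM[of UNIV "entry_space w" e, OF prob_space_entry_space prob_space_entry_space]
    by (simp add: stack_space_eq)
  have "(\<integral>\<^sup>+\<omega>. F \<omega> \<partial>stack_space w) = (\<integral>\<^sup>+p. F ((\<lambda>(v, \<omega>). fun_upd \<omega> e v) p) \<partial>(entry_space w e \<Otimes>\<^sub>M stack_space w))"
    by (subst distr[symmetric], subst nn_integral_distr) auto
  also have "\<dots> = (\<integral>\<^sup>+\<omega>. \<integral>\<^sup>+v. F (fun_upd \<omega> e v) \<partial>entry_space w e \<partial>stack_space w)"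
    by (subst nn_integral_snd[symmetric]) (auto simp: split_beta')
  finally show ?thesis .
qed

lemma nn_integral_indep_entry:
  assumes F [measurable]: "F \<in> borel_measurable (stack_space w)" and "\<And>\<omega> v. F (fun_upd \<omega> e v) = F \<omega>"
    and g [measurable]: "g \<in> borel_measurable (borel \<Otimes>\<^sub>M count_space UNIV)"
  shows "(\<integral>\<^sup>+\<omega>. F \<omega> * g (\<omega> e) \<partial>stack_space w) = (\<integral>\<^sup>+\<omega>. F \<omega> \<partial>stack_space w) * (\<integral>\<^sup>+v. g v \<partial>entry_space w e)"
proof -
  have [measurable]: "(\<lambda>\<omega>. g (\<omega> e)) \<in> borel_measurable (stack_space w)"
    using measurable_compose[OF measurable_entry g] .
  show ?thesis
    by (subst nn_integral_resample[of _ w e]) (simp_all add: assms(2) nn_integral_cmult nn_integral_multc)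
qed

lemma nn_integral_unit_interval:
  assumes [measurable]: "f \<in> borel_measurable borel"
  shows "(\<integral>\<^sup>+u. f u \<partial>uniform_measure lborel {0..1::real}) = (\<integral>\<^sup>+u. f u * indicator {0..1} u \<partial>lborel)"
  by (subst nn_integral_uniform_measure) (auto simp: divide_ennreal_def)

lemma nn_integral_mark:
  assumes [measurable]: "f \<in> borel_measurable borel"
  shows "(\<integral>\<^sup>+v. f (fst v) \<partial>entry_space w e) = (\<integral>\<^sup>+u. f u * indicator {0..1} u \<partial>lborel)"
proof -
  interpret U: prob_space "uniform_measure lborel {0..1::real}" by (rule prob_space_unit_interval)
  have "(\<integral>\<^sup>+v. f (fst v) \<partial>entry_space w e) =
    (\<integral>\<^sup>+u. \<integral>\<^sup>+y. f u \<partial>measure_pmf (arrow_pmf w (fst e)) \<partial>uniform_measure lborel {0..1})"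
    unfolding entry_space_def by (subst measure_pmf.nn_integral_fst[symmetric]) auto
  then show ?thesis by (simp add: nn_integral_unit_interval measure_pmf.emeasure_space_1[simplified])
qed

lemma AE_marks: "AE \<omega> in stack_space w. \<forall>e. 0 < fst (\<omega> e) \<and> fst (\<omega> e) < 1"
proof -
  have "AE \<omega> in stack_space w. 0 < fst (\<omega> e) \<and> fst (\<omega> e) < 1" for e
  proof -
    have u: "AE u in uniform_measure lborel {0..1::real}. 0 < u \<and> u < 1"
      using AE_lborel_singleton[of "0::real"] AE_lborel_singleton[of "1::real"]
      by (subst AE_uniform_measure) auto
    interpret U: prob_space "uniform_measure lborel {0..1::real}" by (rule prob_space_unit_interval)
    interpret pair_sigma_finite "uniform_measure lborel {0..1::real}" "measure_pmf (arrow_pmf w (fst e))" ..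
    have "AE v in entry_space w e. 0 < fst v \<and> fst v < 1"
      unfolding entry_space_def by (intro AE_pair_measure) (use u in auto)
    then show ?thesis unfolding stack_space_eq
      by (intro AE_PiM_component[where P = "\<lambda>v. 0 < fst v \<and> fst v < 1"] prob_space_entry_space) auto
  qed
  then show ?thesis by (simp add: AE_all_countable)
qed

section \<open>Expected number of sampled arrows\<close>

lemma sum_node_weight:
  assumes "w x x = 0"
  shows "(\<Sum>y\<in>UNIV. w x y) = node_weight w x"
  unfolding node_weight_def using assms by (simp add: sum.remove[of UNIV x])

locale weighted_graph =
  fixes w :: "'a::finite \<Rightarrow> 'a \<Rightarrow> real" and q0 :: real
  assumes weight_nonneg: "0 \<le> w x y" and no_loop: "w x x = 0" and q0: "0 < q0"
begin

lemma node_weight_ge_0: "0 \<le> node_weight w x"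
  using weight_nonneg by (rule node_weight_nonneg)

lemma q0_node_weight: "0 < q0 + node_weight w x"
  using q0 node_weight_ge_0[of x] by simp

lemma pmf_arrow:
  assumes "node_weight w x \<noteq> 0"
  shows "pmf (arrow_pmf w x) y = w x y / node_weight w x"
proof -
  have "pmf (embed_pmf (\<lambda>y. w x y / node_weight w x)) y = w x y / node_weight w x"
  proof (rule pmf_embed_pmf)
    show "0 \<le> w x y / node_weight w x" for y using weight_nonneg node_weight_ge_0 by simp
    have "(\<integral>\<^sup>+ y. ennreal (w x y / node_weight w x) \<partial>count_space UNIV) = ennreal (\<Sum>y\<in>UNIV. w x y / node_weight w x)"
      using weight_nonneg node_weight_ge_0 by (simp add: nn_integral_count_space_finite)
    also have "(\<Sum>y\<in>UNIV. w x y / node_weight w x) = 1"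
      using assms no_loop by (simp add: sum_divide_distrib[symmetric] sum_node_weight)
    finally show "(\<integral>\<^sup>+ y. ennreal (w x y / node_weight w x) \<partial>count_space UNIV) = 1" by simp
  qed
  then show ?thesis using assms by (simp add: arrow_pmf_def)
qed

lemma weight_eq_0: "node_weight w x = 0 \<Longrightarrow> w x y = 0"
  using sum_nonneg_eq_0_iff[of UNIV "w x"] sum_node_weight[of w x] weight_nonneg no_loop by simp

lemma threshold_bounds:
  assumes "0 \<le> t"
  shows "0 < threshold w t x" "threshold w t x \<le> 1"
proof -
  have "0 \<le> t * node_weight w x" using assms node_weight_ge_0 by simp
  then show "0 < threshold w t x" "threshold w t x \<le> 1"
    by (auto simp: threshold_def)
qed

text \<open>The probability \<open>1 - \<theta> = w(x) / (q0 + w(x))\<close> of not stopping cancels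
  the normalisation of the arrow law; at weight 0 both sides vanish.\<close>

lemma nn_integral_arrow:
  "(\<integral>\<^sup>+v. (if \<not> fst v < threshold w (1 / q0) x \<and> snd v = y then 1 else 0) \<partial>entry_space w (x, i))
     = ennreal (w x y / (q0 + node_weight w x))"
proof -
  define \<theta> where "\<theta> = threshold w (1 / q0) x"
  have \<theta>: "0 < \<theta>" "\<theta> \<le> 1" unfolding \<theta>_def using q0 by (intro threshold_bounds; simp)+
  have "(\<integral>\<^sup>+v. (if \<not> fst v < \<theta> \<and> snd v = y then 1 else 0) \<partial>entry_space w (x, i))
    = (\<integral>\<^sup>+v. indicator ({\<theta>..} \<times> {y}) v \<partial>entry_space w (x, i))"
    by (intro nn_integral_cong) (auto simp: indicator_def)
  also have "\<dots> = emeasure (entry_space w (x, i)) ({\<theta>..} \<times> {y})"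
    by (intro nn_integral_indicator) (simp add: sets_entry_space)
  also have "\<dots> = emeasure (uniform_measure lborel {0..1}) {\<theta>..} * emeasure (measure_pmf (arrow_pmf w x)) {y}"
    unfolding entry_space_def by (subst measure_pmf.emeasure_pair_measure_Times) auto
  also have "emeasure (uniform_measure lborel {0..1}) {\<theta>..} = ennreal (1 - \<theta>)"
  proof -
    have "{0..1} \<inter> {\<theta>..} = {\<theta>..1}" using \<theta> by auto
    then show ?thesis using \<theta> by (simp add: divide_ennreal_def)
  qed
  also have "emeasure (measure_pmf (arrow_pmf w x)) {y} = ennreal (pmf (arrow_pmf w x) y)"
    by (rule emeasure_pmf_single)
  also have "ennreal (1 - \<theta>) * ennreal (pmf (arrow_pmf w x) y) = ennreal ((1 - \<theta>) * pmf (arrow_pmf w x) y)"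
    using \<theta> by (simp add: ennreal_mult)
  also have "(1 - \<theta>) * pmf (arrow_pmf w x) y = w x y / (q0 + node_weight w x)"
  proof (cases "node_weight w x = 0")
    case True
    then show ?thesis using weight_eq_0[of x y] by (simp add: \<theta>_def threshold_def)
  next
    case False
    have "1 - \<theta> = node_weight w x / (q0 + node_weight w x)"
      using q0 q0_node_weight[of x] by (simp add: \<theta>_def threshold_def field_simps)
    then show ?thesis using False by (simp add: pmf_arrow)
  qed
  finally show ?thesis unfolding \<theta>_def .
qed

definition visits :: "'a \<Rightarrow> nat \<Rightarrow> 'a \<Rightarrow> 'a stacks \<Rightarrow> nat" where
  "visits x k y \<omega> = odometer (interp w (1 / q0) \<omega>) x k y"

lemma measurable_visits [measurable]:
  "visits x k y \<in> measurable (stack_space w) (count_space UNIV)"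
proof -
  have "(\<lambda>\<omega>. odometer (interp w (1 / q0) \<omega>) x k) \<in> measurable (stack_space w) (count_space UNIV)"
    by (rule measurable_odometer) measurable
  from measurable_compose[OF this, of "\<lambda>h. h y" "count_space UNIV"] show ?thesis
    by (simp add: visits_def[abs_def])
qed

lemma visits_upd: "i < visits x k z (fun_upd \<omega> (z, i) v) \<longleftrightarrow> i < visits x k z \<omega>"
proof -
  have eq: "interp w (1 / q0) (fun_upd \<omega> (z, i) v) =
    (interp w (1 / q0) \<omega>)((z, i) := interp w (1 / q0) (fun_upd \<omega> (z, i) v) (z, i))"
    by (auto simp: interp_def fun_eq_iff)
  show ?thesis unfolding visits_def by (subst eq) (simp only: less_odometer_upd)
qed

lemma of_nat_eq_suminf:
  "(of_nat (card {i. i < n \<and> P i}) :: ennreal) = (\<Sum>i. (if i < n then 1 else 0) * (if P i then 1 else 0))"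
proof -
  have "(\<Sum>i. (if i < n then 1 else 0) * (if P i then 1 else 0 :: ennreal))
    = (\<Sum>i<n. (if i < n then 1 else 0) * (if P i then 1 else 0))"
    by (rule suminf_finite) auto
  also have "\<dots> = (\<Sum>i<n. if P i then 1 else 0)" by (intro sum.cong) auto
  also have "\<dots> = of_nat (card ({..<n} \<inter> {i. P i}))" by (simp add: sum.If_cases)
  also have "{..<n} \<inter> {i. P i} = {i. i < n \<and> P i}" by auto
  finally show ?thesis by simp
qed

text \<open>A Wald identity: entry by entry, being used is independent of where the entry
  points.\<close>

lemma expectation_inflow:
  "(\<integral>\<^sup>+\<omega>. of_nat (card {i. i < visits x k z \<omega> \<and> interp w (1 / q0) \<omega> (z, i) = Some y}) \<partial>stack_space w)
    = (\<integral>\<^sup>+\<omega>. of_nat (visits x k z \<omega>) \<partial>stack_space w) * ennreal (w z y / (q0 + node_weight w z))"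
proof -
  let ?g = "\<lambda>v. if \<not> fst v < threshold w (1 / q0) z \<and> snd v = y then 1 else 0 :: ennreal"
  have [measurable]: "?g \<in> borel_measurable (borel \<Otimes>\<^sub>M count_space UNIV)" by measurable
  have gm [measurable]: "(\<lambda>\<omega>. ?g (\<omega> e)) \<in> borel_measurable (stack_space w)" for e by measurable
  have "of_nat (card {i. i < visits x k z \<omega> \<and> interp w (1 / q0) \<omega> (z, i) = Some y})
    = (\<Sum>i. (if i < visits x k z \<omega> then 1 else 0) * ?g (\<omega> (z, i)))" for \<omega>
    unfolding of_nat_eq_suminf by (intro suminf_cong arg_cong2[where f = "(*)"] refl) (auto simp: interp_def)
  then have "(\<integral>\<^sup>+\<omega>. of_nat (card {i. i < visits x k z \<omega> \<and> interp w (1 / q0) \<omega> (z, i) = Some y}) \<partial>stack_space w)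
    = (\<integral>\<^sup>+\<omega>. (\<Sum>i. (if i < visits x k z \<omega> then 1 else 0) * ?g (\<omega> (z, i))) \<partial>stack_space w)"
    by (simp only:)
  also have "\<dots> = (\<Sum>i. \<integral>\<^sup>+\<omega>. (if i < visits x k z \<omega> then 1 else 0) * ?g (\<omega> (z, i)) \<partial>stack_space w)"
    by (intro nn_integral_suminf borel_measurable_times_ennreal gm) measurable
  also have "\<dots> = (\<Sum>i. (\<integral>\<^sup>+\<omega>. (if i < visits x k z \<omega> then 1 else 0) \<partial>stack_space w) *
      (\<integral>\<^sup>+v. ?g v \<partial>entry_space w (z, i)))"
    by (intro suminf_cong nn_integral_indep_entry) (simp_all only: visits_upd, measurable)
  also have "\<dots> = (\<Sum>i. (\<integral>\<^sup>+\<omega>. (if i < visits x k z \<omega> then 1 else 0) \<partial>stack_space w))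
      * ennreal (w z y / (q0 + node_weight w z))"
    by (simp only: nn_integral_arrow ennreal_suminf_multc)
  also have "(\<Sum>i. (\<integral>\<^sup>+\<omega>. (if i < visits x k z \<omega> then 1 else 0) \<partial>stack_space w))
    = (\<integral>\<^sup>+\<omega>. of_nat (visits x k z \<omega>) \<partial>stack_space w)"
  proof -
    have "(\<Sum>i. (if i < n then 1 else 0 :: ennreal)) = of_nat n" for n :: nat
      using of_nat_eq_suminf[of n "\<lambda>_. True"] by simp
    then show ?thesis by (subst nn_integral_suminf[symmetric]) auto
  qed
  finally show ?thesis .
qed

section \<open>Mean visits and the Green function\<close>

primrec mean_visits :: "'a \<Rightarrow> nat \<Rightarrow> 'a \<Rightarrow> real" where
  "mean_visits x 0 = (\<lambda>y. 0)"
| "mean_visits x (Suc k) = (\<lambda>y. (if y = x then 1 else 0) + (\<Sum>z\<in>UNIV. mean_visits x k z * w z y / (q0 + node_weight w z)))"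

lemma mean_visits_nonneg: "0 \<le> mean_visits x k y"
proof (induction k arbitrary: y)
  case (Suc k)
  then show ?case using weight_nonneg q0_node_weight
    by (auto intro!: add_nonneg_nonneg sum_nonneg divide_nonneg_pos mult_nonneg_nonneg)
qed simp

lemma expectation_visits:
  "(\<integral>\<^sup>+\<omega>. of_nat (visits x k y \<omega>) \<partial>stack_space w) = ennreal (mean_visits x k y)"
proof (induction k arbitrary: y)
  case 0
  then show ?case by (simp add: visits_def)
next
  case (Suc k)
  interpret P: prob_space "stack_space w" by (rule prob_space_stack_space)
  have [measurable]: "(\<lambda>\<omega>. of_nat (card {i. i < visits x k z \<omega> \<and> interp w (1 / q0) \<omega> (z, i) = Some y}) :: ennreal)
     \<in> borel_measurable (stack_space w)" for z
    by measurable
  have "of_nat (visits x (Suc k) y \<omega>) = (if y = x then 1 else 0 :: ennreal) +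
     (\<Sum>z\<in>UNIV. of_nat (card {i. i < visits x k z \<omega> \<and> interp w (1 / q0) \<omega> (z, i) = Some y}))" for \<omega>
    by (simp add: visits_def inflow_def)
  then have "(\<integral>\<^sup>+\<omega>. of_nat (visits x (Suc k) y \<omega>) \<partial>stack_space w) = (if y = x then 1 else 0) +
     (\<Sum>z\<in>UNIV. (\<integral>\<^sup>+\<omega>. of_nat (visits x k z \<omega>) \<partial>stack_space w) * ennreal (w z y / (q0 + node_weight w z)))"
    by (simp add: nn_integral_add nn_integral_sum expectation_inflow P.emeasure_space_1[simplified])
  also have "\<dots> = (if y = x then 1 else 0) + (\<Sum>z\<in>UNIV. ennreal (mean_visits x k z * w z y / (q0 + node_weight w z)))"
    using mean_visits_nonneg weight_nonneg q0_node_weight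
    by (simp add: Suc ennreal_mult[symmetric] divide_nonneg_pos)
  also have "\<dots> = ennreal (mean_visits x (Suc k) y)"
  proof -
    have "0 \<le> mean_visits x k z * w z y / (q0 + node_weight w z)" for z
      using mean_visits_nonneg weight_nonneg q0_node_weight by (intro divide_nonneg_pos mult_nonneg_nonneg)
    then show ?thesis by (simp add: sum_nonneg)
  qed
  finally show ?case .
qed

lemma mean_visits_mono_Suc: "mean_visits x k y \<le> mean_visits x (Suc k) y"
proof (induction k arbitrary: y)
  case 0
  show ?case by simp
next
  case (Suc k)
  then show ?case using weight_nonneg q0_node_weight
    by (auto intro!: sum_mono divide_right_mono mult_right_mono less_imp_le[OF q0_node_weight])
qed

text \<open>The left side is the mean number of stops used. As mean visits grow with
  \<open>k\<close>, summing the recursion over all nodes bounds their total by 1 plus the mean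
  number of arrows followed, and the difference is the stops.\<close>

lemma mean_stops_le_1: "(\<Sum>z\<in>UNIV. mean_visits x k z * q0 / (q0 + node_weight w z)) \<le> 1"
proof -
  have "(\<Sum>z\<in>UNIV. mean_visits x k z) \<le> (\<Sum>z\<in>UNIV. mean_visits x (Suc k) z)"
    by (intro sum_mono mean_visits_mono_Suc)
  also have "\<dots> = 1 + (\<Sum>y\<in>UNIV. \<Sum>z\<in>UNIV. mean_visits x k z * w z y / (q0 + node_weight w z))"
    by (simp add: sum.distrib)
  also have "(\<Sum>y\<in>UNIV. \<Sum>z\<in>UNIV. mean_visits x k z * w z y / (q0 + node_weight w z))
    = (\<Sum>z\<in>UNIV. mean_visits x k z * node_weight w z / (q0 + node_weight w z))"
    by (subst sum.swap) (simp add: sum_divide_distrib[symmetric] sum_distrib_left[symmetric] sum_node_weight no_loop)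
  finally have "(\<Sum>z\<in>UNIV. mean_visits x k z - mean_visits x k z * node_weight w z / (q0 + node_weight w z)) \<le> 1"
    by (simp add: sum_subtractf)
  moreover have "mean_visits x k z - mean_visits x k z * node_weight w z / (q0 + node_weight w z)
     = mean_visits x k z * q0 / (q0 + node_weight w z)" for z
    using q0_node_weight[of z] by (simp add: field_simps)
  ultimately show ?thesis by simp
qed

text \<open>Mean visits to \<open>y\<close> of the walk killed at rate \<open>q0\<close>; dividing
  by \<open>q0 + w(y)\<close> gives the resolvent kernel.\<close>

definition green :: "'a \<Rightarrow> 'a \<Rightarrow> real" where
  "green x y = lim (\<lambda>k. mean_visits x k y)"

lemma mean_visits_LIMSEQ: "(\<lambda>k. mean_visits x k y) \<longlonglongrightarrow> green x y"
proof -
  \<comment> \<open>One summand of the bound on mean stops.\<close>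
  have "mean_visits x k y \<le> (q0 + node_weight w y) / q0" for k
  proof -
    have "mean_visits x k y * q0 / (q0 + node_weight w y) \<le> (\<Sum>z\<in>UNIV. mean_visits x k z * q0 / (q0 + node_weight w z))"
      using mean_visits_nonneg q0 q0_node_weight
      by (intro member_le_sum) (auto intro!: divide_nonneg_pos mult_nonneg_nonneg)
    also note mean_stops_le_1
    finally show ?thesis using q0 q0_node_weight[of y] by (simp add: field_simps)
  qed
  then have "\<exists>B. \<forall>k. mean_visits x k y \<le> B" by blast
  then have "convergent (\<lambda>k. mean_visits x k y)"
    using incseq_SucI[of "\<lambda>k. mean_visits x k y"] mean_visits_mono_Suc
    by (metis incseq_convergent convergentI)
  then show ?thesis unfolding green_def by (simp add: convergent_LIMSEQ_iff)
qed

lemma green_eq: "green x y = (if y = x then 1 else 0) + (\<Sum>z\<in>UNIV. green x z * w z y / (q0 + node_weight w z))"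
proof (rule LIMSEQ_unique)
  show "(\<lambda>k. mean_visits x (Suc k) y) \<longlonglongrightarrow> green x y"
    using mean_visits_LIMSEQ by (rule LIMSEQ_Suc)
  show "(\<lambda>k. mean_visits x (Suc k) y) \<longlonglongrightarrow> (if y = x then 1 else 0) + (\<Sum>z\<in>UNIV. green x z * w z y / (q0 + node_weight w z))"
    unfolding mean_visits.simps using q0_node_weight
    by (intro tendsto_intros mean_visits_LIMSEQ) (simp add: less_imp_neq[symmetric])
qed

lemma green_nonneg: "0 \<le> green x y"
  using mean_visits_LIMSEQ by (rule LIMSEQ_le_const) (auto simp: mean_visits_nonneg)

lemma green_stops_le_1: "(\<Sum>z\<in>UNIV. green x z * q0 / (q0 + node_weight w z)) \<le> 1"
proof (rule LIMSEQ_le_const2)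
  show "(\<lambda>k. \<Sum>z\<in>UNIV. mean_visits x k z * q0 / (q0 + node_weight w z)) \<longlonglongrightarrow> (\<Sum>z\<in>UNIV. green x z * q0 / (q0 + node_weight w z))"
    using q0_node_weight
    by (intro tendsto_intros mean_visits_LIMSEQ) (simp add: less_imp_neq[symmetric])
qed (use mean_stops_le_1 in auto)

lemma SUP_mean_visits: "(SUP k. ennreal (mean_visits x k y)) = ennreal (green x y)"
proof (rule LIMSEQ_unique)
  show "(\<lambda>k. ennreal (mean_visits x k y)) \<longlonglongrightarrow> ennreal (green x y)"
    using mean_visits_LIMSEQ by (rule tendsto_ennrealI)
  show "(\<lambda>k. ennreal (mean_visits x k y)) \<longlonglongrightarrow> (SUP k. ennreal (mean_visits x k y))"
    by (intro LIMSEQ_SUP incseq_SucI ennreal_leI mean_visits_mono_Suc)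
qed

lemma expectation_SUP_visits:
  "(\<integral>\<^sup>+\<omega>. (SUP k. of_nat (visits x k y \<omega>)) \<partial>stack_space w) = ennreal (green x y)"
proof -
  have "incseq (\<lambda>k \<omega>. of_nat (visits x k y \<omega>) :: ennreal)"
    by (intro incseq_SucI le_funI) (simp add: visits_def odometer_mono_Suc del: odometer.simps)
  then have "(\<integral>\<^sup>+\<omega>. (SUP k. of_nat (visits x k y \<omega>)) \<partial>stack_space w) = (SUP k. \<integral>\<^sup>+\<omega>. of_nat (visits x k y \<omega>) \<partial>stack_space w)"
    by (intro nn_integral_monotone_convergence_SUP) measurable
  then show ?thesis by (simp add: expectation_visits SUP_mean_visits)
qed

text \<open>Finite expectation makes each limit almost surely finite; finitely many pairs of nodes
  give one common bound. This is what yields almost sure termination.\<close>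

lemma AE_visits_bounded: "AE \<omega> in stack_space w. \<exists>B. \<forall>x k y. visits x k y \<omega> \<le> B"
proof -
  have "AE \<omega> in stack_space w. (SUP k. of_nat (visits x k y \<omega>)) \<noteq> (\<infinity>::ennreal)" for x y
    by (rule nn_integral_PInf_AE) (auto simp: expectation_SUP_visits)
  then have "AE \<omega> in stack_space w. \<forall>x y. (SUP k. of_nat (visits x k y \<omega>)) \<noteq> (\<infinity>::ennreal)"
    by (simp add: AE_all_countable)
  then show ?thesis
  proof eventually_elim
    case (elim \<omega>)
    have "\<exists>B. \<forall>k. visits x k y \<omega> \<le> B" for x y
    proof -
      obtain r where r: "0 \<le> r" "(SUP k. of_nat (visits x k y \<omega>)) = ennreal r"
        using elim by (metis ennreal_cases infinity_ennreal_def)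
      have "visits x k y \<omega> \<le> nat \<lceil>r\<rceil>" for k
      proof -
        have "of_nat (visits x k y \<omega>) \<le> ennreal r" unfolding r(2)[symmetric] by (rule SUP_upper) simp
        then have "real (visits x k y \<omega>) \<le> r" using r(1) by (simp add: ennreal_of_nat_eq_real_of_nat)
        then show ?thesis by linarith
      qed
      then show ?thesis by blast
    qed
    then obtain B where B: "visits x k y \<omega> \<le> B x y" for x k y by metis
    have "visits x k y \<omega> \<le> Max (range (\<lambda>(x, y). B x y))" for x k y
      using B by (rule order_trans) (auto intro!: Max_ge)
    then show ?case by blast
  qed
qed

text \<open>The recursion \<open>green_eq\<close> says that the kernel is a left inverse, which for
  square matrices is also a right inverse.\<close>

lemma matrix_inv_eq:
  "matrix_inv (mat q0 - graph_laplacian w) = (\<chi> x y. green x y / (q0 + node_weight w y))" (is "_ = ?A")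
proof -
  have "(?A ** (mat q0 - graph_laplacian w)) $ x $ y = mat 1 $ x $ y" for x y
  proof -
    have "(?A ** (mat q0 - graph_laplacian w)) $ x $ y =
      (\<Sum>z\<in>UNIV. green x z / (q0 + node_weight w z) * ((if z = y then q0 + node_weight w z else 0) - w z y))"
      unfolding matrix_matrix_mult_def
      by (auto intro!: sum.cong simp: mat_def graph_laplacian_def no_loop)
    also have "\<dots> = (\<Sum>z\<in>UNIV. (if z = y then green x z else 0) - green x z * w z y / (q0 + node_weight w z))"
      using q0_node_weight by (intro sum.cong) (auto simp: right_diff_distrib less_imp_neq[symmetric])
    also have "\<dots> = green x y - (\<Sum>z\<in>UNIV. green x z * w z y / (q0 + node_weight w z))"
      by (simp add: sum_subtractf)
    also have "\<dots> = mat 1 $ x $ y" using green_eq[of x y] by (simp add: mat_def)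
    finally show ?thesis .
  qed
  then have 1: "?A ** (mat q0 - graph_laplacian w) = mat 1" by (simp add: vec_eq_iff)
  then have 2: "(mat q0 - graph_laplacian w) ** ?A = mat 1" by (simp add: matrix_left_right_inverse)
  \<comment> \<open>\<open>matrix_inv\<close> is given by a choice, so the two inverses still have
    to be identified.\<close>
  have "(mat q0 - graph_laplacian w) ** matrix_inv (mat q0 - graph_laplacian w) = mat 1 \<and>
      matrix_inv (mat q0 - graph_laplacian w) ** (mat q0 - graph_laplacian w) = mat 1"
    unfolding matrix_inv_def by (rule someI[of _ ?A]) (use 1 2 in blast)
  then have "?A ** ((mat q0 - graph_laplacian w) ** matrix_inv (mat q0 - graph_laplacian w)) = ?A" by simp
  then show ?thesis by (simp add: matrix_mul_assoc 1)
qed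

lemma trace_eq: "trace (matrix_inv (mat q0 - graph_laplacian w) ** (mat q0 + weight_matrix w)) = (\<Sum>x\<in>UNIV. green x x)"
proof -
  have "(\<Sum>z\<in>UNIV. green x z / (q0 + node_weight w z) * (mat q0 + weight_matrix w) $ z $ x) = green x x" for x
  proof -
    have "(\<Sum>z\<in>UNIV. green x z / (q0 + node_weight w z) * (mat q0 + weight_matrix w) $ z $ x)
      = (\<Sum>z\<in>UNIV. if z = x then green x z else 0)"
      using q0_node_weight by (intro sum.cong) (auto simp: mat_def weight_matrix_def less_imp_neq[symmetric])
    then show ?thesis by simp
  qed
  then show ?thesis by (simp add: trace_def matrix_inv_eq matrix_matrix_mult_def)
qed

text \<open>\<open>green x x - 1\<close> is the mean number of returns to \<open>x\<close>. Bounding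
  every weight into \<open>x\<close> by its maximum leaves the mean number of stops, at most 1,
  divided by \<open>q0\<close>; this is the origin of \<open>\<beta> / q0\<close>.\<close>

lemma trace_le:
  "trace (matrix_inv (mat q0 - graph_laplacian w) ** (mat q0 + weight_matrix w))
    \<le> CARD('a) * (1 + mean_max_weight w / q0)"
proof -
  have "green x x \<le> 1 + Max (range (\<lambda>y. w y x)) / q0" for x
  proof -
    let ?m = "Max (range (\<lambda>y. w y x))"
    have m: "w z x \<le> ?m" for z by (intro Max_ge) auto
    then have m0: "0 \<le> ?m" using weight_nonneg[of x x] by (rule order_trans[rotated])
    have "green x x = 1 + (\<Sum>z\<in>UNIV. green x z * w z x / (q0 + node_weight w z))"
      using green_eq[of x x] by simp
    also have "(\<Sum>z\<in>UNIV. green x z * w z x / (q0 + node_weight w z))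
      \<le> (\<Sum>z\<in>UNIV. ?m / q0 * (green x z * q0 / (q0 + node_weight w z)))"
    proof (intro sum_mono)
      fix z
      have "green x z * w z x / (q0 + node_weight w z) \<le> green x z * ?m / (q0 + node_weight w z)"
        using q0_node_weight[of z] by (intro divide_right_mono mult_left_mono m green_nonneg) simp
      then show "green x z * w z x / (q0 + node_weight w z) \<le> ?m / q0 * (green x z * q0 / (q0 + node_weight w z))"
        using q0 by (simp add: mult.commute)
    qed
    also have "\<dots> = ?m / q0 * (\<Sum>z\<in>UNIV. green x z * q0 / (q0 + node_weight w z))"
      by (simp only: sum_distrib_left)
    also have "\<dots> \<le> ?m / q0 * 1"
      using m0 q0 by (intro mult_left_mono green_stops_le_1) simp
    finally show ?thesis by simp
  qed
  then have "(\<Sum>x\<in>UNIV. green x x) \<le> (\<Sum>x\<in>UNIV. 1 + Max (range (\<lambda>y. w y x)) / q0)" by (rule sum_mono)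
  also have "\<dots> = CARD('a) * (1 + mean_max_weight w / q0)"
    by (simp add: sum.distrib mean_max_weight_def sum_divide_distrib[symmetric] field_simps)
  finally show ?thesis by (simp add: trace_eq)
qed

end

section \<open>Expected number of extra reads\<close>

text \<open>Change of variables from the uniform mark \<open>u = 1 / (1 + t c)\<close> to the time
  \<open>t\<close>; the new factor is the density of the unfreezing time.\<close>

lemma nn_integral_unfreeze_time:
  fixes G :: "real \<Rightarrow> ennreal"
  assumes [measurable]: "G \<in> borel_measurable borel" and c: "0 < c" and T: "0 < T"
  shows "(\<integral>\<^sup>+u. G ((1 / u - 1) / c) * indicator {1 / (1 + T * c)..1} u \<partial>lborel)
    = (\<integral>\<^sup>+t. G t * ennreal (c / (1 + t * c)^2) * indicator {0..T} t \<partial>lborel)"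
proof -
  define g where "g = (\<lambda>t. 1 - 1 / (1 + t * c))"
  have pos: "0 < 1 + t * c" if "t \<in> {0..T}" for t
    using that c by (auto intro: add_pos_nonneg)
  \<comment> \<open>Reflection \<open>u = 1 - v\<close>, because the substitution that follows is
    along an increasing map.\<close>
  have "(\<integral>\<^sup>+u. G ((1 / u - 1) / c) * indicator {1 / (1 + T * c)..1} u \<partial>lborel)
    = (\<integral>\<^sup>+v. G ((1 / (1 - v) - 1) / c) * indicator {g 0..g T} v \<partial>lborel)"
    by (subst nn_integral_real_affine[of _ "-1" 1])
      (auto intro!: nn_integral_cong simp: g_def indicator_def)
  also have "\<dots> = (\<integral>\<^sup>+t. G ((1 / (1 - g t) - 1) / c) * ennreal (c / (1 + t * c)^2) * indicator {0..T} t \<partial>lborel)"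
  proof (rule nn_integral_substitution_aux)
    show "(g has_real_derivative c / (1 + t * c)^2) (at t)" if "t \<in> {0..T}" for t
      unfolding g_def using pos[OF that]
      by (auto intro!: derivative_eq_intros simp: power2_eq_square)
    show "continuous_on {0..T} (\<lambda>t. c / (1 + t * c)^2)"
      using pos by (intro continuous_intros) (auto simp: less_imp_neq[symmetric])
  qed (use T c in auto)
  also have "\<dots> = (\<integral>\<^sup>+t. G t * ennreal (c / (1 + t * c)^2) * indicator {0..T} t \<partial>lborel)"
    using pos c by (intro nn_integral_cong) (auto simp: g_def indicator_def)
  finally show ?thesis .
qed

lemma sum_suminf_unique_le_1:
  fixes Q :: "'a::finite \<Rightarrow> nat \<Rightarrow> bool"
  assumes "\<And>x i x' i'. Q x i \<Longrightarrow> Q x' i' \<Longrightarrow> x = x' \<and> i = i'"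
  shows "(\<Sum>x\<in>UNIV. \<Sum>i. if Q x i then 1 else 0 :: ennreal) \<le> 1"
proof (cases "\<exists>x i. Q x i")
  case True
  then obtain x0 i0 where "Q x0 i0" by blast
  then have "Q x i \<longleftrightarrow> x = x0 \<and> i = i0" for x i using assms by blast
  then have "(\<Sum>i. if Q x i then 1 else 0 :: ennreal) = (if x = x0 then 1 else 0)" for x
    using suminf_finite[of "{i0}" "\<lambda>i. if i = i0 then 1 else 0 :: ennreal"] by auto
  then show ?thesis by simp
qed simp

text \<open>Count pairs of a node \<open>v\<close> and a stop that it reaches:
  \<open>reaches_stop_unique\<close> allows at most one for each \<open>v\<close>.\<close>

lemma sum_tree_size_le:
  fixes w :: "'a::finite \<Rightarrow> 'a \<Rightarrow> real"
  shows "(\<Sum>x\<in>UNIV. \<Sum>i. of_nat (tree_size w \<omega> (x, i) t) * (if interp w t \<omega> (x, i) = None then 1 else 0 :: ennreal))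
    \<le> of_nat CARD('a)"
proof -
  let ?Q = "\<lambda>v x i. reaches (interp w t \<omega>) x i v \<and> interp w t \<omega> (x, i) = None"
  have "(\<Sum>x\<in>UNIV. \<Sum>i. of_nat (tree_size w \<omega> (x, i) t) * (if interp w t \<omega> (x, i) = None then 1 else 0 :: ennreal))
    = (\<Sum>x\<in>UNIV. \<Sum>i. \<Sum>v\<in>UNIV. if ?Q v x i then 1 else 0)"
    unfolding of_nat_tree_size sum_distrib_right
    by (intro sum.cong refl suminf_cong) auto
  also have "\<dots> = (\<Sum>x\<in>UNIV. \<Sum>v\<in>UNIV. \<Sum>i. if ?Q v x i then 1 else 0)"
    by (intro sum.cong refl suminf_sum) simp
  also have "\<dots> = (\<Sum>v\<in>UNIV. \<Sum>x\<in>UNIV. \<Sum>i. if ?Q v x i then 1 else 0)"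
    by (rule sum.swap)
  also have "\<dots> \<le> (\<Sum>v\<in>(UNIV::'a set). 1)"
    by (intro sum_mono sum_suminf_unique_le_1) (blast dest: reaches_stop_unique)
  finally show ?thesis by simp
qed

context weighted_graph begin

lemma nn_integral_stop:
  assumes "0 \<le> t"
  shows "(\<integral>\<^sup>+v. (if fst v < threshold w t x then 1 else 0) \<partial>entry_space w (x, i)) = ennreal (threshold w t x)"
proof -
  note \<theta> = threshold_bounds[OF assms, of x]
  have "(\<integral>\<^sup>+v. (if fst v < threshold w t x then 1 else 0) \<partial>entry_space w (x, i))
    = (\<integral>\<^sup>+u. (if u < threshold w t x then 1 else 0) * indicator {0..1} u \<partial>lborel)"
    by (subst nn_integral_mark[where f = "\<lambda>u. if u < threshold w t x then 1 else 0"]) auto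
  also have "\<dots> = (\<integral>\<^sup>+u. indicator {0..<threshold w t x} u \<partial>lborel)"
    using \<theta> by (intro nn_integral_cong) (auto simp: indicator_def)
  finally show ?thesis using \<theta> by simp
qed

lemma expectation_tree_size_stop:
  assumes "0 \<le> t"
  shows "(\<integral>\<^sup>+\<omega>. of_nat (tree_size w \<omega> (x, i) t) * (if interp w t \<omega> (x, i) = None then 1 else 0) \<partial>stack_space w)
    = (\<integral>\<^sup>+\<omega>. of_nat (tree_size w \<omega> (x, i) t) \<partial>stack_space w) * ennreal (threshold w t x)"
proof -
  have "(\<integral>\<^sup>+\<omega>. of_nat (tree_size w \<omega> (x, i) t) * (if interp w t \<omega> (x, i) = None then 1 else 0) \<partial>stack_space w)
    = (\<integral>\<^sup>+\<omega>. of_nat (tree_size w \<omega> (x, i) t) * (\<lambda>v. if fst v < threshold w t x then 1 else 0) (\<omega> (x, i)) \<partial>stack_space w)"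
    by (intro nn_integral_cong) (auto simp: interp_def)
  also have "\<dots> = (\<integral>\<^sup>+\<omega>. of_nat (tree_size w \<omega> (x, i) t) \<partial>stack_space w) *
      (\<integral>\<^sup>+v. (if fst v < threshold w t x then 1 else 0) \<partial>entry_space w (x, i))"
    by (rule nn_integral_indep_entry) (simp_all only: tree_size_upd, measurable)
  finally show ?thesis by (simp only: nn_integral_stop[OF assms])
qed

lemma max_node_weight_ge: "node_weight w x \<le> max_node_weight w"
  unfolding max_node_weight_def by (intro Max_ge) auto

lemma max_node_weight_nonneg: "0 \<le> max_node_weight w"
  using node_weight_ge_0 max_node_weight_ge by (rule order_trans)

text \<open>Resampling the entry integrates its mark against a tree that does not depend on
  it.\<close>

lemma expectation_unfreeze_cost:
  "(\<integral>\<^sup>+\<omega>. of_nat (unfreeze_cost w (1 / q0) \<omega> (x, i)) \<partial>stack_space w) \<le>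
    (\<integral>\<^sup>+t. ennreal (max_node_weight w / (1 + t * max_node_weight w)) * indicator {0..1 / q0} t *
      (\<integral>\<^sup>+\<omega>. of_nat (tree_size w \<omega> (x, i) t) * (if interp w t \<omega> (x, i) = None then 1 else 0) \<partial>stack_space w) \<partial>lborel)"
proof -
  interpret P: prob_space "stack_space w" by (rule prob_space_stack_space)
  interpret pair_sigma_finite "stack_space w" lborel ..
  define c where "c = node_weight w x"
  define \<theta> where "\<theta> = 1 / (1 + (1 / q0) * c)"
  have thr: "threshold w t x = 1 / (1 + t * c)" for t by (simp add: threshold_def c_def)
  have c0: "0 \<le> c" unfolding c_def by (rule node_weight_ge_0)
  have \<theta>: "0 < \<theta>" "\<theta> \<le> 1" using threshold_bounds[of "1 / q0" x] q0 by (auto simp: thr \<theta>_def)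
  define G :: "'a stacks \<Rightarrow> real \<Rightarrow> ennreal" where "G = (\<lambda>\<omega> t. of_nat (tree_size w \<omega> (x, i) t))"
  have G_upd: "G (fun_upd \<omega> (x, i) v) = G \<omega>" for \<omega> v by (simp add: G_def tree_size_upd fun_eq_iff)
  have G [measurable (raw)]: "(\<lambda>y. G (g y) (f y)) \<in> borel_measurable N"
    if [measurable]: "f \<in> borel_measurable N" "g \<in> measurable N (stack_space w)" for f g and N :: "'z measure"
    unfolding G_def by measurable
  have G' [measurable]: "G \<omega> \<in> borel_measurable borel" for \<omega>
    using measurable_tree_size[of "\<lambda>t. t" borel "\<lambda>_. \<omega>" w "(x, i)"] by (simp add: G_def)
  have G2 [measurable]: "(\<lambda>p. G (fst p) (snd p)) \<in> borel_measurable (stack_space w \<Otimes>\<^sub>M lborel)"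
    unfolding G_def by measurable
  have cost: "of_nat (unfreeze_cost w (1 / q0) \<omega> (x, i)) = (if \<theta> \<le> fst (\<omega> (x, i)) then G \<omega> ((1 / fst (\<omega> (x, i)) - 1) / c) else 0)" for \<omega>
    by (simp add: unfreeze_cost_def G_def thr \<theta>_def unfreeze_time_def c_def)
  have [measurable]: "(\<lambda>\<omega>. if \<theta> \<le> fst (\<omega> (x, i)) then G \<omega> ((1 / fst (\<omega> (x, i)) - 1) / c) else 0) \<in> borel_measurable (stack_space w)"
    unfolding G_def by measurable
  have "(\<integral>\<^sup>+\<omega>. of_nat (unfreeze_cost w (1 / q0) \<omega> (x, i)) \<partial>stack_space w)
    = (\<integral>\<^sup>+\<omega>. \<integral>\<^sup>+v. (if \<theta> \<le> fst v then G \<omega> ((1 / fst v - 1) / c) else 0) \<partial>entry_space w (x, i) \<partial>stack_space w)"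
    unfolding cost by (subst nn_integral_resample[of _ w "(x, i)"]) (simp_all add: G_upd cong: if_cong)
  also have "\<dots> = (\<integral>\<^sup>+\<omega>. \<integral>\<^sup>+u. G \<omega> ((1 / u - 1) / c) * indicator {\<theta>..1} u \<partial>lborel \<partial>stack_space w)"
  proof (intro nn_integral_cong)
    fix \<omega>
    have "(\<integral>\<^sup>+v. (if \<theta> \<le> fst v then G \<omega> ((1 / fst v - 1) / c) else 0) \<partial>entry_space w (x, i))
      = (\<integral>\<^sup>+u. (if \<theta> \<le> u then G \<omega> ((1 / u - 1) / c) else 0) * indicator {0..1} u \<partial>lborel)"
      by (subst nn_integral_mark[where f = "\<lambda>u. if \<theta> \<le> u then G \<omega> ((1 / u - 1) / c) else 0"]) auto
    also have "\<dots> = (\<integral>\<^sup>+u. G \<omega> ((1 / u - 1) / c) * indicator {\<theta>..1} u \<partial>lborel)"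
      using \<theta> by (intro nn_integral_cong) (auto simp: indicator_def)
    finally show "(\<integral>\<^sup>+v. (if \<theta> \<le> fst v then G \<omega> ((1 / fst v - 1) / c) else 0) \<partial>entry_space w (x, i)) = \<dots>" .
  qed
  also have "\<dots> \<le> (\<integral>\<^sup>+t. ennreal (max_node_weight w / (1 + t * max_node_weight w)) * indicator {0..1 / q0} t *
      (\<integral>\<^sup>+\<omega>. of_nat (tree_size w \<omega> (x, i) t) * (if interp w t \<omega> (x, i) = None then 1 else 0) \<partial>stack_space w) \<partial>lborel)"
  proof (cases "c = 0")
    case True
    \<comment> \<open>At weight 0 \<open>\<theta> = 1\<close>, so only the single mark 1
      remains.\<close>
    have "AE u in lborel. G \<omega> ((1 / u - 1) / c) * indicator {\<theta>..1} u = 0" for \<omega>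
      using AE_lborel_singleton[of "1::real"] by eventually_elim (simp add: \<theta>_def True)
    then have "(\<integral>\<^sup>+u. G \<omega> ((1 / u - 1) / c) * indicator {\<theta>..1} u \<partial>lborel) = 0" for \<omega>
      by (subst nn_integral_0_iff_AE) auto
    then show ?thesis by simp
  next
    case False
    then have c: "0 < c" using c0 by simp
    have "(\<integral>\<^sup>+\<omega>. \<integral>\<^sup>+u. G \<omega> ((1 / u - 1) / c) * indicator {\<theta>..1} u \<partial>lborel \<partial>stack_space w)
      = (\<integral>\<^sup>+\<omega>. \<integral>\<^sup>+t. G \<omega> t * ennreal (c / (1 + t * c)^2) * indicator {0..1 / q0} t \<partial>lborel \<partial>stack_space w)"
      unfolding \<theta>_def using q0 by (intro nn_integral_cong nn_integral_unfreeze_time c G') simp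
    also have "\<dots> = (\<integral>\<^sup>+t. \<integral>\<^sup>+\<omega>. G \<omega> t * ennreal (c / (1 + t * c)^2) * indicator {0..1 / q0} t \<partial>stack_space w \<partial>lborel)"
      by (rule Fubini'[symmetric]) (simp add: split_beta')
    also have "\<dots> \<le> (\<integral>\<^sup>+t. ennreal (max_node_weight w / (1 + t * max_node_weight w)) * indicator {0..1 / q0} t *
      (\<integral>\<^sup>+\<omega>. of_nat (tree_size w \<omega> (x, i) t) * (if interp w t \<omega> (x, i) = None then 1 else 0) \<partial>stack_space w) \<partial>lborel)"
    proof (intro nn_integral_mono)
      fix t :: real
      show "(\<integral>\<^sup>+\<omega>. G \<omega> t * ennreal (c / (1 + t * c)^2) * indicator {0..1 / q0} t \<partial>stack_space w) \<le>
        ennreal (max_node_weight w / (1 + t * max_node_weight w)) * indicator {0..1 / q0} t *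
        (\<integral>\<^sup>+\<omega>. of_nat (tree_size w \<omega> (x, i) t) * (if interp w t \<omega> (x, i) = None then 1 else 0) \<partial>stack_space w)"
      proof (cases "t \<in> {0..1 / q0}")
        case True
        then have t: "0 \<le> t" by simp
        have pos: "0 < 1 + t * c" "0 < 1 + t * max_node_weight w"
          using t c max_node_weight_nonneg by (auto intro: add_pos_nonneg)
        have "ennreal (c / (1 + t * c)^2) = ennreal (threshold w t x) * ennreal (c / (1 + t * c))"
          using c pos by (simp add: thr ennreal_mult[symmetric] power2_eq_square)
        \<comment> \<open>\<open>c / (1 + t * c)\<close> increases with \<open>c\<close>, so the
          maximal weight gives a rate common to all nodes.\<close>
        also have "\<dots> \<le> ennreal (threshold w t x) * ennreal (max_node_weight w / (1 + t * max_node_weight w))"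
          using pos max_node_weight_ge[of x] t
          by (intro mult_left_mono ennreal_leI) (simp_all add: c_def field_simps)
        finally have le: "ennreal (c / (1 + t * c)^2) \<le> ennreal (threshold w t x) *
             ennreal (max_node_weight w / (1 + t * max_node_weight w))" .
        have "(\<integral>\<^sup>+\<omega>. G \<omega> t * ennreal (c / (1 + t * c)^2) * indicator {0..1 / q0} t \<partial>stack_space w)
          = (\<integral>\<^sup>+\<omega>. G \<omega> t \<partial>stack_space w) * ennreal (c / (1 + t * c)^2)"
          using True by (simp add: nn_integral_multc)
        also have "\<dots> \<le> (\<integral>\<^sup>+\<omega>. G \<omega> t \<partial>stack_space w) * (ennreal (threshold w t x) *
             ennreal (max_node_weight w / (1 + t * max_node_weight w)))"
          using le by (rule mult_left_mono) simp
        finally have "(\<integral>\<^sup>+\<omega>. G \<omega> t * ennreal (c / (1 + t * c)^2) * indicator {0..1 / q0} t \<partial>stack_space w) \<le>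
          (\<integral>\<^sup>+\<omega>. G \<omega> t \<partial>stack_space w) * (ennreal (threshold w t x) *
             ennreal (max_node_weight w / (1 + t * max_node_weight w)))" .
        then show ?thesis
          using True unfolding expectation_tree_size_stop[OF t] by (simp add: G_def mult_ac)
      qed simp
    qed
    finally show ?thesis .
  qed
  finally show ?thesis .
qed

text \<open>With a common rate the sum over all entries can be taken at each fixed \<open>t\<close>,
  where it is at most the number of nodes; \<open>ln (1 + t * \<alpha>)\<close> is the primitive of
  the rate.\<close>

lemma expectation_sum_unfreeze_cost:
  "(\<integral>\<^sup>+\<omega>. (\<Sum>x\<in>UNIV. \<Sum>i. of_nat (unfreeze_cost w (1 / q0) \<omega> (x, i))) \<partial>stack_space w)
    \<le> ennreal (CARD('a) * ln (1 + max_node_weight w / q0))"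
proof -
  interpret P: prob_space "stack_space w" by (rule prob_space_stack_space)
  define \<alpha> where "\<alpha> = max_node_weight w"
  have \<alpha>: "0 \<le> \<alpha>" unfolding \<alpha>_def by (rule max_node_weight_nonneg)
  let ?h = "\<lambda>t. ennreal (\<alpha> / (1 + t * \<alpha>)) * indicator {0..1 / q0} t"
  define H where "H = (\<lambda>x i t. \<integral>\<^sup>+\<omega>. of_nat (tree_size w \<omega> (x, i) t) * (if interp w t \<omega> (x, i) = None then 1 else 0 :: ennreal) \<partial>stack_space w)"
  have K [measurable]: "(\<lambda>\<omega>. of_nat (tree_size w \<omega> (x, i) t) * (if interp w t \<omega> (x, i) = None then 1 else 0 :: ennreal)) \<in> borel_measurable (stack_space w)" for x i t
    by measurable
  have "(\<lambda>p. of_nat (tree_size w (snd p) (x, i) (fst p)) * (if interp w (fst p) (snd p) (x, i) = None then 1 else 0 :: ennreal))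
      \<in> borel_measurable (lborel \<Otimes>\<^sub>M stack_space w)" for x i
    by measurable
  then have [measurable]: "H x i \<in> borel_measurable lborel" for x i
    unfolding H_def by (intro P.borel_measurable_nn_integral) (simp add: split_beta')
  have [measurable]: "(\<lambda>\<omega>. of_nat (unfreeze_cost w (1 / q0) \<omega> e) :: ennreal) \<in> borel_measurable (stack_space w)" for e
    unfolding unfreeze_cost_def if_distrib[of of_nat] unfreeze_time_def of_nat_0 by measurable
  have "(\<integral>\<^sup>+\<omega>. (\<Sum>x\<in>UNIV. \<Sum>i. of_nat (unfreeze_cost w (1 / q0) \<omega> (x, i))) \<partial>stack_space w)
    = (\<Sum>x\<in>UNIV. \<Sum>i. \<integral>\<^sup>+\<omega>. of_nat (unfreeze_cost w (1 / q0) \<omega> (x, i)) \<partial>stack_space w)"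
    by (simp add: nn_integral_sum nn_integral_suminf)
  also have "\<dots> \<le> (\<Sum>x\<in>UNIV. \<Sum>i. \<integral>\<^sup>+t. ?h t * H x i t \<partial>lborel)"
    unfolding H_def \<alpha>_def by (intro sum_mono suminf_le expectation_unfreeze_cost) auto
  also have "\<dots> = (\<integral>\<^sup>+t. (\<Sum>x\<in>UNIV. \<Sum>i. ?h t * H x i t) \<partial>lborel)"
    by (simp add: nn_integral_sum nn_integral_suminf del: ennreal_suminf_cmult)
  also have "\<dots> \<le> (\<integral>\<^sup>+t. ?h t * of_nat CARD('a) \<partial>lborel)"
  proof (intro nn_integral_mono)
    fix t
    have "(\<Sum>x\<in>UNIV. \<Sum>i. ?h t * H x i t) = ?h t * (\<Sum>x\<in>UNIV. \<Sum>i. H x i t)"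
      by (simp only: sum_distrib_left ennreal_suminf_cmult)
    also have "(\<Sum>x\<in>UNIV. \<Sum>i. H x i t) = (\<integral>\<^sup>+\<omega>. (\<Sum>x\<in>UNIV. \<Sum>i. of_nat (tree_size w \<omega> (x, i) t) *
        (if interp w t \<omega> (x, i) = None then 1 else 0)) \<partial>stack_space w)"
      unfolding H_def by (simp add: nn_integral_sum nn_integral_suminf K)
    also have "\<dots> \<le> (\<integral>\<^sup>+\<omega>. of_nat CARD('a) \<partial>stack_space w)"
      by (intro nn_integral_mono sum_tree_size_le)
    also have "\<dots> = of_nat CARD('a)" by (simp add: P.emeasure_space_1[simplified])
    finally show "(\<Sum>x\<in>UNIV. \<Sum>i. ?h t * H x i t) \<le> ?h t * of_nat CARD('a)"
      by (simp add: mult_left_mono)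
  qed
  also have "\<dots> = (\<integral>\<^sup>+t. ?h t \<partial>lborel) * of_nat CARD('a)"
    by (rule nn_integral_multc) measurable
  also have "(\<integral>\<^sup>+t. ?h t \<partial>lborel) = ennreal (ln (1 + 1 / q0 * \<alpha>) - ln (1 + 0 * \<alpha>))"
  proof (rule nn_integral_FTC_Icc)
    fix t assume t: "t \<in> {0..1 / q0}"
    then have pos: "0 < 1 + t * \<alpha>" using \<alpha> by (intro add_pos_nonneg) auto
    then show "((\<lambda>t. ln (1 + t * \<alpha>)) has_real_derivative \<alpha> / (1 + t * \<alpha>)) (at t)"
      by (auto intro!: derivative_eq_intros)
    show "0 \<le> \<alpha> / (1 + t * \<alpha>)" using \<alpha> pos by simp
  qed (use q0 in auto)
  also have "\<dots> * of_nat CARD('a) = ennreal (CARD('a) * ln (1 + max_node_weight w / q0))"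
    using \<alpha> q0 by (simp add: \<alpha>_def ennreal_of_nat_eq_real_of_nat ennreal_mult[symmetric] mult.commute)
  finally show ?thesis .
qed

end

section \<open>Measurability of a run\<close>

type_synonym 'a config =
  "('a \<Rightarrow> 'a option) \<times> ('a \<Rightarrow> 'a option) \<times> ('a \<Rightarrow> nat) \<times> 'a set \<times> 'a set \<times> 'a list \<times> nat"

text \<open>Only \<open>time\<close> is real. The other components take countably many values, so
  measurability can be checked with them fixed.\<close>

definition config :: "'a state \<Rightarrow> 'a config" where
  "config s = (prev s, arrows s, nread s, frozen s, tagged s, walk s, extra s)"

definition state_of :: "real \<Rightarrow> 'a config \<Rightarrow> 'a state" where
  "state_of t d = (case d of (p, a, n, f, g, l, e) \<Rightarrow>
     \<lparr>time = t, prev = p, arrows = a, nread = n, frozen = f, tagged = g, walk = l, extra = e\<rparr>)"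

lemma state_of_config: "state_of (time s) (config s) = s"
  by (simp add: state_of_def config_def)

lemma state_of_time_update: "state_of t d = (state_of 0 d)\<lparr>time := t\<rparr>"
  by (simp add: state_of_def split: prod.split)

lemma config_time_update: "config (s\<lparr>time := t\<rparr>) = config s"
  by (simp add: config_def)

text \<open>A walk step that receives the interpreted entry as an argument and so depends on the
  stacks through a discrete value only.\<close>

definition read_step :: "'a \<Rightarrow> 'a option \<Rightarrow> 'a state \<Rightarrow> 'a state" where
  "read_step u entry s =
     (if u \<in> frozen s then end_walk s
      else if u \<notin> tagged s \<and> u \<in> dom (prev s)
      then follow u (the (prev s u)) (s\<lparr>extra := Suc (extra s)\<rparr>)
      else let s' = s\<lparr>nread := (nread s)(u := Suc (nread s u)), tagged := insert u (tagged s)\<rparr>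
           in case entry of None \<Rightarrow> end_walk (s'\<lparr>frozen := insert u (frozen s')\<rparr>) | Some v \<Rightarrow> follow u v s')"

lemma walk_step_eq: "walk_step w \<omega> u s = read_step u (interp w (time s) \<omega> (u, nread s u)) s"
  by (simp add: walk_step_def read_step_def interp_def Let_def split: prod.split)

lemma read_step_time_update: "read_step u en (s\<lparr>time := t\<rparr>) = (read_step u en s)\<lparr>time := t\<rparr>"
  by (cases s) (simp add: read_step_def follow_def move_def end_walk_def Let_def split: option.split)

definition unfreeze_by :: "'a \<Rightarrow> 'a \<Rightarrow> 'a state \<Rightarrow> 'a state" where
  "unfreeze_by x v s = follow x v (s\<lparr>prev := arrows s, frozen := - {v. (v, x) \<in> (Map.graph (arrows s))\<^sup>*},
          tagged := {}, walk := [x]\<rparr>)"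

lemma unfreeze_eq: "unfreeze \<omega> x t s = (unfreeze_by x (snd (\<omega> (x, nread s x - 1))) s)\<lparr>time := t\<rparr>"
  by (cases s) (simp add: unfreeze_def unfreeze_by_def follow_def move_def Let_def)

context weighted_graph begin

text \<open>Measurability concerns every \<open>\<omega>\<close>, so exceptional marks are included:
  at weight 0 the threshold is constantly 1, and a mark 1 unfreezes at every time from 0 on.\<close>

definition unfreezable :: "'a stacks \<Rightarrow> 'a state \<Rightarrow> 'a set" where
  "unfreezable \<omega> s = {x. x \<notin> dom (arrows s) \<and>
     (if node_weight w x = 0 then fst (\<omega> (x, nread s x - 1)) = 1
      else 0 < fst (\<omega> (x, nread s x - 1)) \<and> fst (\<omega> (x, nread s x - 1)) \<le> 1)}"

definition next_time :: "'a stacks \<Rightarrow> 'a state \<Rightarrow> real" where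
  "next_time \<omega> s = Min ((\<lambda>x. unfreeze_time w x (fst (\<omega> (x, nread s x - 1)))) ` unfreezable \<omega> s)"

lemma unfreezes_at_unfreezable:
  assumes "unfreezes_at w \<omega> s x t"
  shows "x \<in> unfreezable \<omega> s" "unfreeze_time w x (fst (\<omega> (x, nread s x - 1))) \<le> t"
proof -
  let ?U = "fst (\<omega> (x, nread s x - 1))"
  have t: "0 \<le> t" "x \<notin> dom (arrows s)" and U: "?U = 1 / (1 + t * node_weight w x)"
    using assms by (auto simp: unfreezes_at_def threshold_def)
  have "x \<in> unfreezable \<omega> s \<and> unfreeze_time w x ?U \<le> t"
  proof (cases "node_weight w x = 0")
    case True
    then show ?thesis using U t by (simp add: unfreezable_def unfreeze_time_def)
  next
    case False
    have "0 \<le> t * node_weight w x" using t node_weight_ge_0 by simp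
    then have "0 < ?U" "?U \<le> 1" unfolding U by (auto simp: field_simps)
    moreover have "1 / ?U - 1 = t * node_weight w x" unfolding U by simp
    ultimately show ?thesis using False t by (simp add: unfreezable_def unfreeze_time_def)
  qed
  then show "x \<in> unfreezable \<omega> s" "unfreeze_time w x ?U \<le> t" by blast+
qed

lemma unfreezable_unfreezes_at:
  assumes "x \<in> unfreezable \<omega> s"
  shows "unfreezes_at w \<omega> s x (unfreeze_time w x (fst (\<omega> (x, nread s x - 1))))"
proof (cases "node_weight w x = 0")
  case True
  then show ?thesis using assms by (simp add: unfreezable_def unfreezes_at_def threshold_def unfreeze_time_def)
next
  case False
  then show ?thesis using assms node_weight_ge_0[of x]
    by (auto simp: unfreezable_def unfreezes_at_def threshold_def unfreeze_time_def)
qed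

lemma next_time_unfreezes:
  assumes "unfreezable \<omega> s \<noteq> {}"
  shows "\<exists>x. unfreezes_at w \<omega> s x (next_time \<omega> s)"
proof -
  have "next_time \<omega> s \<in> (\<lambda>x. unfreeze_time w x (fst (\<omega> (x, nread s x - 1)))) ` unfreezable \<omega> s"
    unfolding next_time_def using assms by (intro Min_in) auto
  then obtain x where "x \<in> unfreezable \<omega> s" "next_time \<omega> s = unfreeze_time w x (fst (\<omega> (x, nread s x - 1)))"
    by blast
  then show ?thesis using unfreezable_unfreezes_at by metis
qed

lemma next_time_le:
  assumes "unfreezes_at w \<omega> s x t"
  shows "next_time \<omega> s \<le> t"
proof -
  have "next_time \<omega> s \<le> unfreeze_time w x (fst (\<omega> (x, nread s x - 1)))"
    unfolding next_time_def using unfreezes_at_unfreezable(1)[OF assms] by (intro Min_le) auto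
  also note unfreezes_at_unfreezable(2)[OF assms]
  finally show ?thesis .
qed

text \<open>Replaces \<open>LEAST\<close> by a minimum over finitely many measurable times.\<close>

lemma least_unfreezing_eq:
  assumes "unfreezable \<omega> s \<noteq> {}"
  shows "(LEAST t. \<exists>x. unfreezes_at w \<omega> s x t) = next_time \<omega> s"
  using next_time_unfreezes[OF assms] next_time_le by (intro Least_equality) auto

lemma ex_unfreezing_iff:
  "(\<exists>t\<le>T. \<exists>x. unfreezes_at w \<omega> s x t) \<longleftrightarrow> unfreezable \<omega> s \<noteq> {} \<and> next_time \<omega> s \<le> T"
proof
  assume "\<exists>t\<le>T. \<exists>x. unfreezes_at w \<omega> s x t"
  then obtain t x where "t \<le> T" "unfreezes_at w \<omega> s x t" by blast
  then show "unfreezable \<omega> s \<noteq> {} \<and> next_time \<omega> s \<le> T"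
    using next_time_le[of \<omega> s x t] unfreezes_at_unfreezable(1)[of \<omega> s x t] by auto
qed (use next_time_unfreezes in blast)

lemma measurable_finite_set:
  fixes Q :: "'b \<Rightarrow> 'c::finite set"
  assumes "\<And>x. Measurable.pred M (\<lambda>\<omega>. x \<in> Q \<omega>)"
  shows "Q \<in> measurable M (count_space UNIV)"
proof -
  have "(\<lambda>\<omega> x. x \<in> Q \<omega>) \<in> measurable M (count_space UNIV)"
    by (rule measurable_finite_fun) (use assms in \<open>simp add: pred_def\<close>)
  from measurable_compose[OF this, of Collect "count_space UNIV"] show ?thesis by simp
qed

lemma measurable_unfreezable:
  "(\<lambda>\<omega>. unfreezable \<omega> s) \<in> measurable (stack_space w) (count_space UNIV)"
  by (rule measurable_finite_set) (simp add: unfreezable_def)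

lemma measurable_next_time [measurable]: "(\<lambda>\<omega>. next_time \<omega> s) \<in> borel_measurable (stack_space w)"
proof -
  have "(\<lambda>\<omega>. Min ((\<lambda>x. unfreeze_time w x (fst (\<omega> (x, nread s x - 1)))) ` Q)) \<in> borel_measurable (stack_space w)" for Q :: "'a set"
    unfolding unfreeze_time_def by (rule borel_measurable_Min) simp_all
  from measurable_compose_countable[OF this measurable_unfreezable[of s]]
  show ?thesis by (simp add: next_time_def)
qed

lemma step_idle:
  assumes "walk s = []" "frozen s = UNIV"
  shows "step w q0 c \<omega> s = (if unfreezable \<omega> s \<noteq> {} \<and> next_time \<omega> s \<le> 1 / q0
    then let x = c {x. unfreezes_at w \<omega> s x (next_time \<omega> s)}
         in (unfreeze_by x (snd (\<omega> (x, nread s x - 1))) s)\<lparr>time := next_time \<omega> s\<rparr>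
    else s)"
  using assms unfolding step_def ex_unfreezing_iff
  by (simp add: least_unfreezing_eq unfreeze_eq Let_def)

lemma unfreezable_time_update:
  "unfreezable \<omega> (s\<lparr>time := t\<rparr>) = unfreezable \<omega> s" "next_time \<omega> (s\<lparr>time := t\<rparr>) = next_time \<omega> s"
  "unfreezes_at w \<omega> (s\<lparr>time := t\<rparr>) x t' \<longleftrightarrow> unfreezes_at w \<omega> s x t'"
  "unfreeze_by x v (s\<lparr>time := t\<rparr>) = (unfreeze_by x v s)\<lparr>time := t\<rparr>"
  by (cases s; simp add: unfreezable_def next_time_def unfreezes_at_def unfreeze_by_def follow_def move_def Let_def)+

text \<open>The configuration \<open>d\<close> and the choice function \<open>c\<close> are fixed;
  only the time and the stacks vary.\<close>

lemma measurable_step: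
  assumes tm [measurable]: "tm \<in> borel_measurable (stack_space w)"
  shows "(\<lambda>\<omega>. config (step w q0 c \<omega> (state_of (tm \<omega>) d))) \<in> measurable (stack_space w) (count_space UNIV)"
    and "(\<lambda>\<omega>. time (step w q0 c \<omega> (state_of (tm \<omega>) d))) \<in> borel_measurable (stack_space w)"
proof -
  let ?s = "state_of 0 d"
  have s: "state_of t d = ?s\<lparr>time := t\<rparr>" for t by (rule state_of_time_update)
  have "(\<lambda>\<omega>. config (step w q0 c \<omega> (state_of (tm \<omega>) d))) \<in> measurable (stack_space w) (count_space UNIV)
    \<and> (\<lambda>\<omega>. time (step w q0 c \<omega> (state_of (tm \<omega>) d))) \<in> borel_measurable (stack_space w)"
  proof (cases "walk ?s")
    case (Cons u us)
    have eq: "step w q0 c \<omega> (state_of t d) = (read_step u (interp w t \<omega> (u, nread ?s u)) ?s)\<lparr>time := t\<rparr>" for \<omega> t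
      unfolding s[of t] using Cons by (simp add: step_def walk_step_eq read_step_time_update)
    have [measurable]: "(\<lambda>\<omega>. interp w (tm \<omega>) \<omega> (u, nread ?s u)) \<in> measurable (stack_space w) (count_space UNIV)"
      by measurable
    have "(\<lambda>\<omega>. config (read_step u (interp w (tm \<omega>) \<omega> (u, nread ?s u)) ?s)) \<in> measurable (stack_space w) (count_space UNIV)"
      by (rule measurable_compose[of "\<lambda>\<omega>. interp w (tm \<omega>) \<omega> (u, nread ?s u)" _ "count_space UNIV"]) auto
    then show ?thesis unfolding eq by (simp add: config_time_update)
  next
    case walk: Nil
    show ?thesis
    proof (cases "frozen ?s = UNIV")
      case False
      have "step w q0 c \<omega> (state_of t d) = (?s\<lparr>walk := [c (- frozen ?s - dom (arrows ?s))]\<rparr>)\<lparr>time := t\<rparr>" for \<omega> t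
        unfolding s[of t] using walk False by (simp add: step_def)
      then show ?thesis by (simp add: config_time_update)
    next
      case frozen: True
      let ?X = "\<lambda>\<omega>. c {x. unfreezes_at w \<omega> ?s x (next_time \<omega> ?s)}"
      let ?C = "\<lambda>\<omega>. unfreezable \<omega> ?s \<noteq> {} \<and> next_time \<omega> ?s \<le> 1 / q0"
      have eq: "step w q0 c \<omega> (state_of t d) = (if ?C \<omega>
          then (unfreeze_by (?X \<omega>) (snd (\<omega> (?X \<omega>, nread ?s (?X \<omega>) - 1))) ?s)\<lparr>time := next_time \<omega> ?s\<rparr>
          else ?s\<lparr>time := t\<rparr>)" for \<omega> t
        unfolding s[of t] using walk frozen by (simp add: step_idle unfreezable_time_update Let_def)
      have [measurable]: "Measurable.pred (stack_space w) (\<lambda>\<omega>. unfreezable \<omega> ?s \<noteq> {})"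
        by (rule measurable_compose[OF measurable_unfreezable]) simp
      have "Measurable.pred (stack_space w) ?C" by measurable
      then have C: "{\<omega>. ?C \<omega>} \<in> sets (stack_space w)" by (simp add: pred_def)
      have [measurable]: "Measurable.pred (stack_space w) (\<lambda>\<omega>. threshold w (next_time \<omega> ?s) x = fst (\<omega> e))" for x e
      proof -
        have "(\<lambda>\<omega>. threshold w (next_time \<omega> ?s) x) \<in> borel_measurable (stack_space w)"
          unfolding threshold_def
          by (intro borel_measurable_divide borel_measurable_add borel_measurable_times measurable_next_time borel_measurable_const)
        from borel_measurable_eq[OF this measurable_mark[of e w]] show ?thesis
          by (simp add: pred_def)
      qed
      have "(\<lambda>\<omega>. {x. unfreezes_at w \<omega> ?s x (next_time \<omega> ?s)}) \<in> measurable (stack_space w) (count_space UNIV)"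
        by (rule measurable_finite_set, unfold mem_Collect_eq unfreezes_at_def) measurable
      then have X [measurable]: "?X \<in> measurable (stack_space w) (count_space UNIV)"
        by (rule measurable_compose) simp
      have "(\<lambda>\<omega>. snd (\<omega> (x, nread ?s x - 1))) \<in> measurable (stack_space w) (count_space UNIV)" for x
        by measurable
      then have "(\<lambda>\<omega>. config (unfreeze_by x (snd (\<omega> (x, nread ?s x - 1))) ?s)) \<in> measurable (stack_space w) (count_space UNIV)" for x
        by (rule measurable_compose) simp
      from measurable_compose_countable[OF this X]
      have [measurable]: "(\<lambda>\<omega>. config (unfreeze_by (?X \<omega>) (snd (\<omega> (?X \<omega>, nread ?s (?X \<omega>) - 1))) ?s)) \<in> measurable (stack_space w) (count_space UNIV)" .
      show ?thesis unfolding eq if_distrib[of config] if_distrib[of time] config_time_update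
        by (intro conjI measurable_If) (simp_all add: C)
    qed
  qed
  then show "(\<lambda>\<omega>. config (step w q0 c \<omega> (state_of (tm \<omega>) d))) \<in> measurable (stack_space w) (count_space UNIV)"
    and "(\<lambda>\<omega>. time (step w q0 c \<omega> (state_of (tm \<omega>) d))) \<in> borel_measurable (stack_space w)" by blast+
qed

lemma measurable_run:
  assumes "choice_rule w pick"
  shows "(\<lambda>\<omega>. config (run w q0 pick \<omega> k)) \<in> measurable (stack_space w) (count_space UNIV)
    \<and> (\<lambda>\<omega>. time (run w q0 pick \<omega> k)) \<in> borel_measurable (stack_space w)"
proof (induction k)
  case (Suc k)
  then have C: "(\<lambda>\<omega>. config (run w q0 pick \<omega> k)) \<in> measurable (stack_space w) (count_space UNIV)"
    and tm: "(\<lambda>\<omega>. time (run w q0 pick \<omega> k)) \<in> borel_measurable (stack_space w)" by blast+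
  \<comment> \<open>Choice functions on a finite type are finitely many, so the random one can be
    handled by cases like the configuration.\<close>
  have pick: "(\<lambda>\<omega>. pick \<omega> k) \<in> measurable (stack_space w) (count_space UNIV)"
    using assms by (intro measurable_finite_fun) (simp add: choice_rule_def)
  have eq: "run w q0 pick \<omega> (Suc k) = step w q0 (pick \<omega> k) \<omega> (state_of (time (run w q0 pick \<omega> k)) (config (run w q0 pick \<omega> k)))" for \<omega>
    by (simp add: state_of_config)
  show ?case unfolding eq
    by (intro conjI measurable_compose_countable[OF measurable_compose_countable[OF measurable_step(1)[OF tm] C] pick]
      measurable_compose_countable[OF measurable_compose_countable[OF measurable_step(2)[OF tm] C] pick])
qed simp

lemma measurable_sampled_arrows:
  assumes "choice_rule w pick"
  shows "sampled_arrows w q0 pick \<in> borel_measurable (stack_space w)"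
proof -
  have "(\<lambda>\<omega>. of_nat (\<Sum>x\<in>UNIV. nread (run w q0 pick \<omega> k) x) :: ennreal) \<in> borel_measurable (stack_space w)" for k
    using measurable_compose[OF conjunct1[OF measurable_run[OF assms, of k]],
      of "\<lambda>(p, a, n, f, g, l, e). of_nat (\<Sum>x\<in>UNIV. n x) :: ennreal" borel] by (simp add: config_def)
  then show ?thesis unfolding sampled_arrows_def[abs_def] by (intro borel_measurable_SUP) auto
qed

lemma measurable_extra_reads:
  assumes "choice_rule w pick"
  shows "extra_reads w q0 pick \<in> borel_measurable (stack_space w)"
proof -
  have "(\<lambda>\<omega>. of_nat (extra (run w q0 pick \<omega> k)) :: ennreal) \<in> borel_measurable (stack_space w)" for k
    using measurable_compose[OF conjunct1[OF measurable_run[OF assms, of k]],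
      of "\<lambda>(p, a, n, f, g, l, e). of_nat e :: ennreal" borel] by (simp add: config_def)
  then show ?thesis unfolding extra_reads_def[abs_def] by (intro borel_measurable_SUP) auto
qed

lemma AE_marked_stacks: "AE \<omega> in stack_space w. marked_stacks w q0 \<omega>"
  using AE_marks
proof eventually_elim
  case (elim \<omega>)
  then show ?case by unfold_locales (use weight_nonneg q0 in blast)+
qed

lemma expectation_sampled_arrows:
  assumes "choice_rule w pick"
  shows "(\<integral>\<^sup>+\<omega>. sampled_arrows w q0 pick \<omega> \<partial>stack_space w)
    = ennreal (trace (matrix_inv (mat q0 - graph_laplacian w) ** (mat q0 + weight_matrix w)))"
proof -
  have c: "A \<noteq> {} \<Longrightarrow> pick \<omega> k A \<in> A" for \<omega> k A using assms by (simp add: choice_rule_def)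
  have "AE \<omega> in stack_space w. sampled_arrows w q0 pick \<omega> = (\<Sum>x\<in>UNIV. SUP k. of_nat (visits x k x \<omega>))"
    using AE_marked_stacks AE_visits_bounded
  proof eventually_elim
    case (elim \<omega>)
    then obtain B where B: "visits x k y \<omega> \<le> B" for x k y by blast
    interpret marked_stacks w q0 \<omega> by (rule elim(1))
    show ?case using sampled_arrows_eq[of pick B, OF c] B by (simp add: visits_def)
  qed
  then have "(\<integral>\<^sup>+\<omega>. sampled_arrows w q0 pick \<omega> \<partial>stack_space w)
    = (\<integral>\<^sup>+\<omega>. (\<Sum>x\<in>UNIV. SUP k. of_nat (visits x k x \<omega>)) \<partial>stack_space w)"
    by (rule nn_integral_cong_AE)
  also have "\<dots> = (\<Sum>x\<in>UNIV. ennreal (green x x))"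
    by (subst nn_integral_sum) (simp_all add: expectation_SUP_visits)
  finally show ?thesis by (simp add: trace_eq sum_ennreal green_nonneg)
qed

lemma expectation_extra_reads:
  assumes "choice_rule w pick"
  shows "(\<integral>\<^sup>+\<omega>. extra_reads w q0 pick \<omega> \<partial>stack_space w) \<le> ennreal (CARD('a) * ln (1 + max_node_weight w / q0))"
proof -
  have c: "A \<noteq> {} \<Longrightarrow> pick \<omega> k A \<in> A" for \<omega> k A using assms by (simp add: choice_rule_def)
  have "AE \<omega> in stack_space w. extra_reads w q0 pick \<omega> \<le> (\<Sum>x\<in>UNIV. \<Sum>i. of_nat (unfreeze_cost w (1 / q0) \<omega> (x, i)))"
    using AE_marked_stacks
  proof eventually_elim
    case (elim \<omega>)
    interpret marked_stacks w q0 \<omega> by (rule elim)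
    show ?case by (rule extra_reads_le) (rule c)
  qed
  from order_trans[OF nn_integral_mono_AE[OF this] expectation_sum_unfreeze_cost] show ?thesis .
qed

end

theorem theorem3:
  fixes w :: "'a::finite \<Rightarrow> 'a \<Rightarrow> real"
    and q0 :: real
    and pick :: "'a stacks \<Rightarrow> nat \<Rightarrow> 'a set \<Rightarrow> 'a"
  assumes "\<And>x y. w x y = w y x"
    and "\<And>x y. 0 \<le> w x y"
    and "\<And>x. w x x = 0"
    and "0 < q0"
    and "choice_rule w pick"
  shows "sampled_arrows w q0 pick \<in> borel_measurable (stack_space w)
    \<and> (\<integral>\<^sup>+ \<omega>. sampled_arrows w q0 pick \<omega> \<partial>stack_space w)
        = ennreal (trace (matrix_inv (mat q0 - graph_laplacian w) ** (mat q0 + weight_matrix w)))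
    \<and> trace (matrix_inv (mat q0 - graph_laplacian w) ** (mat q0 + weight_matrix w))
        \<le> CARD('a) * (1 + mean_max_weight w / q0)
    \<and> extra_reads w q0 pick \<in> borel_measurable (stack_space w)
    \<and> (\<integral>\<^sup>+ \<omega>. extra_reads w q0 pick \<omega> \<partial>stack_space w)
        \<le> ennreal (CARD('a) * ln (1 + max_node_weight w / q0))"
proof -
  interpret weighted_graph w q0 by unfold_locales (use assms in auto)
  show ?thesis
    using measurable_sampled_arrows expectation_sampled_arrows trace_le measurable_extra_reads
      expectation_extra_reads assms(5) by blast
qed

end
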